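(* Consider the continuum model $$\partial_t\mu_t+\operatorname{div}\bigl(F[\mu_{t-\tau(t)}]\mu_t\bigr)=0,\quad x\in\mathbb{R}^d,\ t>0,\qquad \mu_s=g_s,\quad s\in[-\tau(0),0],$$ with $F$ given by either of the two choices (A) or (B) described in the context and with $g\in\mathcal{C}([-\tau(0),0];\mathcal{M}(\mathbb{R}^d))$. Suppose that there exists a constant $R>0$ such that $\operatorname{supp} g_t\subset B^d(0,R)$ for all $t\in[-\tau(0),0]$. Then for any $T>0$ there exists a unique measure-valued solution $\mu_t\in\mathcal{C}([0,T);\mathcal{M}(\mathbb{R}^d))$ of this problem. Moreover, $\mu_t$ is uniformly compactly supported, and $$\mu_t=X(t;\cdot)\#\mu_0,$$ where $X(t;\cdot)$ is the flow map generated by $F[\mu_{t-\tau(t)}]$, i.e. $\frac{d}{dt}X(t;x)=F[\mu_{t-\tau(t)}](X(t;x))$, $X(0;x)=x$ for $x\in\mathbb{R}^d$.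
   Context: $\mathcal{M}(\mathbb{R}^d)$ is the set of probability measures on $\mathbb{R}^d$ (continuity of curves of measures is understood with respect to the narrow topology), $B^d(0,R)$ is the ball of radius $R$ in $\mathbb{R}^d$ centered at the origin, and $\mathcal{T}\#\mu$ is the push-forward, $\mathcal{T}\#\mu(B)=\mu(\mathcal{T}^{-1}(B))$ for Borel $B$. The function $\psi:[0,+\infty)\to(0,+\infty)$ is non-increasing and Lipschitz continuous with $\psi(0)=1$. The velocity field is either (A) $F[\mu_{t-\tau(t)}](x)=\int_{\mathbb{R}^d}\psi(|x-y|)(y-x)\,d\mu_{t-\tau(t)}(y)$, or (B) $F[\mu_{t-\tau(t)}](x)=\dfrac{\int_{\mathbb{R}^d}\psi(|x-y|)(y-x)\,d\mu_{t-\tau(t)}(y)}{\int_{\mathbb{R}^d}\psi(|x-y|)\,d\mu_{t-\tau(t)}(y)}$. The time delay $\tau\in W^{1,\infty}_{loc}(0,+\infty)$ satisfies $0<\tau^*\le\tau(t)\le\overline\tau$ for all $t\ge0$ and $\tau'(t)\le c$ for all $t>0$ (a.e.), with constants $\tau^*,\overline\tau>0$ and $c\in(0,1)$; $\tau(0)$ is the value at $0$ by continuity. A measure-valued solution on $[0,T)$ is a curve $\mu_t\in\mathcal{C}([0,T);\mathcal{M}(\mathbb{R}^d))$, extended by $\mu_s=g_s$ for $s\in[-\tau(0),0]$, such that for all $\phi\in\mathcal{C}_c^\infty(\mathbb{R}^d\times[0,T))$ $$\int_0^T\int_{\mathbb{R}^d}\bigl(\partial_t\phi+F[\mu_{t-\tau(t)}](x)\cdot\nabla_x\phi\bigr)\,d\mu_t(x)\,dt+\int_{\mathbb{R}^d}\phi(x,0)\,dg_0(x)=0.$$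 "Uniformly compactly supported" means that there is a single compact set of $\mathbb{R}^d$ containing $\operatorname{supp}\mu_t$ for all $t\in[0,T)$. *)

theory Defs
  imports "HOL-Probability.Probability"
begin

section \<open>Probability measures with the narrow topology\<close>

definition prob_measures :: "'a::topological_space measure set" where
  "prob_measures = {m. prob_space m \<and> sets m = sets borel}"

definition bounded_continuous :: "('a::topological_space \<Rightarrow> real) set" where
  "bounded_continuous = {f. continuous_on UNIV f \<and> bounded (range f)}"

text \<open>The narrow topology is the initial topology with respect to the maps
  \<open>m \<mapsto> \<integral>f dm\<close>, \<open>f\<close> bounded and continuous.  Its carrier is the set of Borel probability
  measures, so a map that is continuous into it takes values in that set.\<close>

definition narrow_topology :: "'a::topological_space measure topology" where
  "narrow_topology =
     pullback_topology prob_measures (\<lambda>m. \<lambda>f\<in>bounded_continuous. \<integral>x. f x \<partial>m)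
       (product_topology (\<lambda>_. euclideanreal) bounded_continuous)"

lemma topspace_narrow_topology: "topspace narrow_topology = prob_measures"
  by (auto simp: narrow_topology_def topspace_pullback_topology)

lemma continuous_map_narrow_iff:
  "continuous_map X narrow_topology \<mu> \<longleftrightarrow>
     \<mu> \<in> topspace X \<rightarrow> prob_measures \<and>
     (\<forall>f\<in>bounded_continuous. continuous_map X euclideanreal (\<lambda>t. \<integral>x. f x \<partial>\<mu> t))"
  (is "?l \<longleftrightarrow> ?r")
proof
  let ?I = "\<lambda>m. \<lambda>f\<in>bounded_continuous. \<integral>x. f x \<partial>(m :: 'b measure)"
  assume l: ?l
  have "\<mu> \<in> topspace X \<rightarrow> prob_measures"
    using l by (auto simp: continuous_map_def topspace_narrow_topology)
  moreover have "continuous_map narrow_topology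
      (product_topology (\<lambda>_. euclideanreal) bounded_continuous) (id \<circ> ?I)"
    unfolding narrow_topology_def by (rule continuous_map_pullback) simp
  then have "continuous_map X (product_topology (\<lambda>_. euclideanreal) bounded_continuous)
      ((id \<circ> ?I) \<circ> \<mu>)"
    using l by (rule continuous_map_compose[rotated])
  ultimately show ?r
    by (auto simp: continuous_map_componentwise o_def)
next
  assume r: ?r
  show ?l
    unfolding narrow_topology_def
    by (rule continuous_map_pullback')
       (use r in \<open>auto simp: continuous_map_componentwise o_def\<close>)
qed

definition msupport :: "'a::topological_space measure \<Rightarrow> 'a set" where
  "msupport m = {x. \<forall>U. open U \<and> x \<in> U \<longrightarrow> emeasure m U > 0}"

section \<open>Smooth compactly supported test functions\<close>

primrec Ck :: "nat \<Rightarrow> ('a::euclidean_space \<Rightarrow> real) \<Rightarrow> bool" where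
  "Ck 0 f \<longleftrightarrow> continuous_on UNIV f"
| "Ck (Suc k) f \<longleftrightarrow>
     (\<forall>x. f differentiable at x) \<and> (\<forall>v. Ck k (\<lambda>x. frechet_derivative f (at x) v))"

definition test_functions :: "'a::euclidean_space set \<Rightarrow> ('a \<Rightarrow> real) set" where
  "test_functions U =
     {\<phi>. (\<forall>k. Ck k \<phi>) \<and> compact (closure {x. \<phi> x \<noteq> 0}) \<and> closure {x. \<phi> x \<noteq> 0} \<subseteq> U}"

definition grad :: "('a::euclidean_space \<Rightarrow> real) \<Rightarrow> 'a \<Rightarrow> 'a" where
  "grad f x = (\<Sum>b\<in>Basis. frechet_derivative f (at x) b *\<^sub>R b)"

section \<open>The Sobolev space \<open>W\<^sup>1\<^sup>,\<^sup>\<infinity>\<close> (local version) on subsets of the line\<close>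

definition Linf_loc :: "real set \<Rightarrow> (real \<Rightarrow> real) \<Rightarrow> bool" where
  "Linf_loc U u \<longleftrightarrow> set_borel_measurable lborel U u \<and>
     (\<forall>K. compact K \<and> K \<subseteq> U \<longrightarrow> (\<exists>C. AE t in lborel. t \<in> K \<longrightarrow> \<bar>u t\<bar> \<le> C))"

definition weak_derivative_on :: "real set \<Rightarrow> (real \<Rightarrow> real) \<Rightarrow> (real \<Rightarrow> real) \<Rightarrow> bool" where
  "weak_derivative_on U u v \<longleftrightarrow>
     (\<forall>\<phi>\<in>test_functions U.
        (LINT t:U|lborel. u t * deriv \<phi> t) = - (LINT t:U|lborel. v t * \<phi> t))"

text \<open>\<open>W1inf_loc U u v\<close>: \<open>u\<close> lies in the local Sobolev space over the open set \<open>U\<close> and has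
  weak derivative \<open>v\<close>.\<close>

definition W1inf_loc :: "real set \<Rightarrow> (real \<Rightarrow> real) \<Rightarrow> (real \<Rightarrow> real) \<Rightarrow> bool" where
  "W1inf_loc U u v \<longleftrightarrow> Linf_loc U u \<and> Linf_loc U v \<and> weak_derivative_on U u v"

section \<open>The delayed continuity equation\<close>

definition force :: "(real \<Rightarrow> real) \<Rightarrow> 'a::euclidean_space \<Rightarrow> 'a \<Rightarrow> 'a" where
  "force \<psi> x y = \<psi> (norm (x - y)) *\<^sub>R (y - x)"

definition velocity_A ::
    "(real \<Rightarrow> real) \<Rightarrow> 'a::euclidean_space measure \<Rightarrow> 'a \<Rightarrow> 'a" where
  "velocity_A \<psi> m x = (\<integral>y. force \<psi> x y \<partial>m)"

definition velocity_B ::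
    "(real \<Rightarrow> real) \<Rightarrow> 'a::euclidean_space measure \<Rightarrow> 'a \<Rightarrow> 'a" where
  "velocity_B \<psi> m x = (\<integral>y. force \<psi> x y \<partial>m) /\<^sub>R (\<integral>y. \<psi> (norm (x - y)) \<partial>m)"

definition transport_integrand ::
    "('a::euclidean_space \<Rightarrow> 'a) \<Rightarrow> ('a \<times> real \<Rightarrow> real) \<Rightarrow> real \<Rightarrow> 'a \<Rightarrow> real" where
  "transport_integrand V \<phi> t x =
     deriv (\<lambda>s. \<phi> (x, s)) t + V x \<bullet> grad (\<lambda>y. \<phi> (y, t)) x"

text \<open>Measure-valued solutions on \<open>[0,T)\<close> with velocity field \<open>F\<close>, delay \<open>\<tau>\<close> and history \<open>g\<close>.
  The values of \<open>\<mu>\<close> outside \<open>[-\<tau>(0),T)\<close> are irrelevant.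

  Test functions on \<open>\<real>\<^sup>d \<times> [0,T)\<close> are the restrictions of smooth functions on
  \<open>\<real>\<^sup>d \<times> \<real>\<close> with compact support in \<open>\<real>\<^sup>d \<times> (-\<infinity>,T)\<close>; they need not vanish at \<open>t = 0\<close>.

  The Bochner integral of a non-integrable function is \<open>0\<close>.  The three integrability
  conditions say that all integrals in the weak formulation exist; the first one concerns
  the integral defining \<open>F\<close> (the denominator in \<open>velocity_B\<close> always exists, because \<open>\<psi>\<close> is
  bounded and continuous).  They hold for every narrowly continuous \<open>\<mu>\<close> that has a common
  compact support.\<close>

definition mv_solution ::
    "(real \<Rightarrow> real) \<Rightarrow> ('a::euclidean_space measure \<Rightarrow> 'a \<Rightarrow> 'a) \<Rightarrow> (real \<Rightarrow> real) \<Rightarrow>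
     (real \<Rightarrow> 'a measure) \<Rightarrow> real \<Rightarrow> (real \<Rightarrow> 'a measure) \<Rightarrow> bool" where
  "mv_solution \<psi> F \<tau> g T \<mu> \<longleftrightarrow>
     continuous_map (top_of_set {0..<T}) narrow_topology \<mu> \<and>
     (\<forall>s\<in>{-\<tau> 0..0}. \<mu> s = g s) \<and>
     (AE t in lborel. t \<in> {0..<T} \<longrightarrow>
        (AE x in \<mu> t. integrable (\<mu> (t - \<tau> t)) (force \<psi> x))) \<and>
     (\<forall>\<phi>\<in>test_functions (UNIV \<times> {..<T}).
        (AE t in lborel. t \<in> {0..<T} \<longrightarrow>
           integrable (\<mu> t) (transport_integrand (F (\<mu> (t - \<tau> t))) \<phi> t)) \<and>
        set_integrable lborel {0..<T}
          (\<lambda>t. \<integral>x. transport_integrand (F (\<mu> (t - \<tau> t))) \<phi> t x \<partial>\<mu> t) \<and>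
        (LINT t:{0..<T}|lborel.
           (\<integral>x. transport_integrand (F (\<mu> (t - \<tau> t))) \<phi> t x \<partial>\<mu> t))
          + (\<integral>x. \<phi> (x, 0) \<partial>g 0) = 0)"

text \<open>\<open>X t x\<close> is the position at time \<open>t\<close> of the trajectory of \<open>V\<close> that starts at \<open>x\<close>;
  the time derivative at \<open>t = 0\<close> is one-sided.\<close>

definition flow_map ::
    "real \<Rightarrow> (real \<Rightarrow> 'a::euclidean_space \<Rightarrow> 'a) \<Rightarrow> (real \<Rightarrow> 'a \<Rightarrow> 'a) \<Rightarrow> bool" where
  "flow_map T V X \<longleftrightarrow>
     (\<forall>x. X 0 x = x \<and>
        (\<forall>t\<in>{0..<T}. ((\<lambda>s. X s x) has_vector_derivative V t (X t x)) (at t within {0..<T})))"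

end

theory Submission
  imports Defs "HOL-Computational_Algebra.Polynomial"
begin

text \<open>
The velocity at time \<open>t\<close> depends on the solution at the time \<open>t - \<tau> t\<close>, which lies at least
\<open>\<tau>_low > 0\<close> in the past.  It also lies in the domain of the history: a weak derivative bounded
by \<open>c < 1\<close> forces \<open>\<tau> t - \<tau> 0 \<le> c * t\<close> and hence \<open>t - \<tau> t \<ge> - \<tau> 0\<close>
(\<open>weak_derivative_le_imp_increment_le\<close>).  The problem can therefore be solved by the method of
steps: once the solution is known up to time \<open>k * \<tau>_low\<close>, the velocity field is known up to time
\<open>(k + 1) * \<tau>_low\<close>, where the equation is a linear continuity equation.

For a delayed curve of measures on the ball of radius \<open>R\<close>, either velocity field is continuous,
locally Lipschitz in space, of linear growth, and has no outward component outside that ball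
(\<open>delayed_velocity_confining\<close>).  Such a field has a global forward flow that maps the ball into
itself, so the image of the initial measure stays on the ball, and it is a weak solution
(\<open>pushforward_weak_solution\<close>).

Uniqueness has to be shown among all weak solutions, including those of unbounded support,
for a field that need not be differentiable (\<open>weak_solution_is_transported\<close>).  The natural test
functions are functions transported backwards along the flow; they are compactly supported
and Lipschitz in space, but not smooth.  They are admissible nevertheless: a mollification
of a function that is constant along the trajectories is almost constant along them, since the
field varies little on the scale of the kernel (\<open>weak_formulation_lagrangian\<close>).  In each step of
the induction the linear theorem is applied from time \<open>0\<close> on, so that no solution has to be
restarted at a later time.\<close>

section \<open>Smooth functions and mollification\<close>

lemma Ck_imp_continuous: "Ck k f \<Longrightarrow> continuous_on UNIV f"
proof (cases k)
  case (Suc j)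
  moreover assume "Ck k f"
  ultimately have "continuous (at x) f" for x
    by (intro differentiable_imp_continuous_within) simp
  then show ?thesis by (intro continuous_at_imp_continuous_on) simp
qed simp

lemma Ck_SucD: "Ck (Suc k) f \<Longrightarrow> Ck k f"
proof (induction k arbitrary: f)
  case 0
  then show ?case by (simp only: Ck.simps(1)) (rule Ck_imp_continuous)
next
  case (Suc k)
  have "Ck k (\<lambda>x. frechet_derivative f (at x) v)" for v
    using Suc.prems by (intro Suc.IH) simp
  with Suc.prems show ?case by simp
qed

lemma Ck_SucI:
  assumes "\<And>x. (f has_derivative f' x) (at x)" and "\<And>v. Ck k (\<lambda>x. f' x v)"
  shows "Ck (Suc k) f"
proof -
  have "frechet_derivative f (at x) = f' x" for x
    using assms(1) by (rule frechet_derivative_at[symmetric])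
  with assms show ?thesis by (auto simp: differentiable_def)
qed

lemma Ck_has_derivative:
  "Ck (Suc k) f \<Longrightarrow> (f has_derivative frechet_derivative f (at x)) (at x)"
  using frechet_derivative_works by auto

lemma Ck_const: "Ck k (\<lambda>x. c)"
proof (induction k arbitrary: c)
  case (Suc k)
  show ?case by (rule Ck_SucI[where f' = "\<lambda>_ _. 0"]) (auto intro: Suc)
qed simp

lemma Ck_add: "Ck k f \<Longrightarrow> Ck k g \<Longrightarrow> Ck k (\<lambda>x. f x + g x)"
proof (induction k arbitrary: f g)
  case (Suc k)
  show ?case
    by (rule Ck_SucI[where f' = "\<lambda>x v. frechet_derivative f (at x) v + frechet_derivative g (at x) v"])
       (use Suc in \<open>auto intro!: has_derivative_add Ck_has_derivative\<close>)
qed (auto intro: continuous_intros)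

lemma Ck_mult: "Ck k f \<Longrightarrow> Ck k g \<Longrightarrow> Ck k (\<lambda>x. f x * g x)"
proof (induction k arbitrary: f g)
  case (Suc k)
  have "Ck k f" "Ck k g" using Suc.prems by (auto intro: Ck_SucD simp del: Ck.simps)
  then show ?case
    by (intro Ck_SucI[where f' = "\<lambda>x v. f x * frechet_derivative g (at x) v + frechet_derivative f (at x) v * g x"])
       (use Suc in \<open>auto intro!: has_derivative_mult Ck_has_derivative Ck_add\<close>)
qed (auto intro: continuous_intros)

lemma Ck_inner: "Ck k (\<lambda>x. (x - c) \<bullet> v)"
proof (cases k)
  case (Suc k)
  show ?thesis unfolding Suc
    by (rule Ck_SucI[where f' = "\<lambda>_ w. w \<bullet> v"])
       (auto intro!: derivative_eq_intros Ck_const)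
qed (auto intro!: continuous_intros)

text \<open>The derivative of \<open>h j \<circ> u\<close> is \<open>h (Suc j) \<circ> u\<close> times the derivative of \<open>u\<close>, so the
induction on the order of smoothness has to treat all derivatives \<open>h j\<close> of \<open>h 0\<close> together.\<close>

lemma Ck_compose:
  assumes h: "\<And>j s. (h j has_real_derivative h (Suc j) s) (at s)"
  shows "Ck k u \<Longrightarrow> Ck k (\<lambda>x. h j (u x))"
proof (induction k arbitrary: j)
  case 0
  have "continuous_on UNIV (h j)"
    using h by (meson DERIV_isCont continuous_at_imp_continuous_on)
  from continuous_on_compose2[OF this, of UNIV u] 0 show ?case by simp
next
  case (Suc k)
  then have k: "Ck k u" by (auto intro: Ck_SucD simp del: Ck.simps)
  show ?case
  proof (rule Ck_SucI[where f' = "\<lambda>x v. h (Suc j) (u x) * frechet_derivative u (at x) v"])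
    show "((\<lambda>x. h j (u x)) has_derivative (\<lambda>v. h (Suc j) (u x) * frechet_derivative u (at x) v)) (at x)" for x
      using has_derivative_compose[OF Ck_has_derivative[OF Suc.prems], of "h j" "(*) (h (Suc j) (u x))" x]
        h[of j "u x"] by (simp add: has_field_derivative_def)
    show "Ck k (\<lambda>x. h (Suc j) (u x) * frechet_derivative u (at x) v)" for v
      using Suc.prems by (intro Ck_mult Suc.IH k) auto
  qed
qed

text \<open>The classical smooth function \<open>exp (- 1 / s)\<close>, multiplied by a polynomial in \<open>1 / s\<close> and
extended by zero.  The polynomial factor makes the class closed under differentiation, which
gives the derivatives of all orders of the function with \<open>p = 1\<close>.\<close>

definition flat_exp :: "real poly \<Rightarrow> real \<Rightarrow> real" where
  "flat_exp p s = (if s > 0 then poly p (1 / s) * exp (- (1 / s)) else 0)"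

lemma poly_div_exp_tendsto_0: "((\<lambda>y::real. poly p y / exp y) \<longlongrightarrow> 0) at_top"
proof -
  have "((\<lambda>y. \<Sum>i\<le>degree p. coeff p i * (y ^ i / exp y)) \<longlongrightarrow> (\<Sum>i\<le>degree p. coeff p i * 0)) at_top"
    by (intro tendsto_sum tendsto_mult tendsto_const tendsto_power_div_exp_0)
  then show ?thesis by (simp add: poly_altdef sum_divide_distrib)
qed

text \<open>At \<open>0\<close> the difference quotient from the right is a polynomial in \<open>1 / s\<close> times
\<open>exp (- 1 / s)\<close> and hence tends to \<open>0\<close>, the value prescribed for the derivative there.\<close>

lemma flat_exp_has_derivative:
  "(flat_exp p has_real_derivative flat_exp ([:0, 0, 1:] * (p - pderiv p)) s) (at s)"
proof -
  consider "s > 0" | "s < 0" | "s = 0" by linarith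
  then show ?thesis
  proof cases
    case 1
    have "((\<lambda>s. poly p (1 / s) * exp (- (1 / s))) has_real_derivative
        flat_exp ([:0, 0, 1:] * (p - pderiv p)) s) (at s)"
      using 1
      by (auto intro!: derivative_eq_intros DERIV_chain2[OF poly_DERIV] simp: flat_exp_def field_simps power2_eq_square)
    then show ?thesis
      by (rule DERIV_cong_ev[THEN iffD1, rotated -1, OF _ refl _ refl])
         (use 1 in \<open>auto simp: flat_exp_def eventually_nhds intro!: exI[of _ "{0<..}"]\<close>)
  next
    case 2
    have "((\<lambda>s. 0) has_real_derivative flat_exp ([:0, 0, 1:] * (p - pderiv p)) s) (at s)"
      using 2 by (auto simp: flat_exp_def)
    then show ?thesis
      by (rule DERIV_cong_ev[THEN iffD1, rotated -1, OF _ refl _ refl])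
         (use 2 in \<open>auto simp: flat_exp_def eventually_nhds intro!: exI[of _ "{..<0}"]\<close>)
  next
    case 3
    have "((\<lambda>h. poly ([:0, 1:] * p) (1 / h) / exp (1 / h)) \<longlongrightarrow> 0) (at_right (0::real))"
      by (rule filterlim_compose[OF poly_div_exp_tendsto_0])
         (use filterlim_inverse_at_top_right in \<open>simp add: inverse_eq_divide\<close>)
    then have "((\<lambda>h. flat_exp p h / h) \<longlongrightarrow> 0) (at_right 0)"
      by (rule Lim_transform_eventually)
         (auto simp: flat_exp_def eventually_at_right_less exp_minus field_simps eventually_at intro!: exI[of _ 1])
    moreover have "((\<lambda>h. flat_exp p h / h) \<longlongrightarrow> 0) (at_left 0)"
      by (rule Lim_transform_eventually[OF tendsto_const])
         (auto simp: flat_exp_def eventually_at intro!: exI[of _ 1])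
    ultimately have "((\<lambda>h. flat_exp p h / h) \<longlongrightarrow> 0) (at 0)"
      by (simp add: filterlim_split_at)
    then show ?thesis
      unfolding 3 by (simp add: DERIV_def flat_exp_def)
  qed
qed

lemma smooth_positive_part:
  "\<exists>h :: nat \<Rightarrow> real \<Rightarrow> real. (\<forall>j s. (h j has_real_derivative h (Suc j) s) (at s)) \<and>
     (\<forall>s>0. h 0 s > 0) \<and> (\<forall>s\<le>0. h 0 s = 0)"
proof -
  define q where "q j = ((\<lambda>p. [:0, 0, 1:] * (p - pderiv p)) ^^ j) (1 :: real poly)" for j
  have "(flat_exp (q j) has_real_derivative flat_exp (q (Suc j)) s) (at s)" for j s
    using flat_exp_has_derivative[of "q j" s] by (simp add: q_def del: mult_pCons_left)
  then show ?thesis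
    by (intro exI[of _ "\<lambda>j. flat_exp (q j)"]) (simp add: flat_exp_def q_def)
qed

lemma integrable_lborel_box_support:
  fixes f :: "'a::euclidean_space \<Rightarrow> real"
  assumes "continuous_on UNIV f" and "\<And>q. q \<notin> cbox a b \<Longrightarrow> f q = 0"
  shows "integrable lborel f" and "integral (cbox a b) f = (\<integral>q. f q \<partial>lborel)"
proof -
  have eq: "(\<lambda>q. indicator (cbox a b) q *\<^sub>R f q) = f"
    using assms(2) by (auto simp: fun_eq_iff indicator_def)
  have "integrable lborel (\<lambda>q. indicator (cbox a b) q *\<^sub>R f q)"
    by (rule borel_integrable_compact) (use assms in \<open>auto intro: continuous_on_subset\<close>)
  then show "integrable lborel f" by (simp only: eq)
  have "set_integrable lborel (cbox a b) f"
    using \<open>integrable lborel f\<close> by (simp only: set_integrable_def eq)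
  from set_borel_integral_eq_integral(2)[OF this]
  show "integral (cbox a b) f = (\<integral>q. f q \<partial>lborel)"
    by (simp only: set_lebesgue_integral_def eq)
qed

text \<open>The kernel is a multiple of \<open>h (\<epsilon>\<^sup>2 - norm (q - c)\<^sup>2)\<close>, where \<open>h\<close> is smooth, positive on the
positive half-line and zero elsewhere.  The centre is kept free because a kernel on
space-time that is centred at \<open>(0, \<epsilon>)\<close> averages over later times only.\<close>

lemma mollifier_exists:
  fixes c :: "'a::euclidean_space"
  assumes "\<epsilon> > 0"
  obtains K :: "'a \<Rightarrow> real"
  where "\<And>k. Ck k K" "\<And>q. K q \<ge> 0" "\<And>q. K q \<noteq> 0 \<Longrightarrow> dist c q \<le> \<epsilon>"
    "integrable lborel K" "(\<integral>q. K q \<partial>lborel) = 1"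
proof -
  from smooth_positive_part obtain h :: "nat \<Rightarrow> real \<Rightarrow> real" where
    "\<forall>j s. (h j has_real_derivative h (Suc j) s) (at s)" "\<forall>s>0. h 0 s > 0" "\<forall>s\<le>0. h 0 s = 0"
    by (elim exE conjE)
  then have h: "\<And>j s. (h j has_real_derivative h (Suc j) s) (at s)"
    "\<And>s. s > 0 \<Longrightarrow> h 0 s > 0" "\<And>s. s \<le> 0 \<Longrightarrow> h 0 s = 0"
    by simp_all
  define B where "B q = h 0 (\<epsilon>\<^sup>2 + (- 1) * ((q - c) \<bullet> (q - c)))" for q :: 'a
  have sq: "Ck k (\<lambda>q. (q - c) \<bullet> (q - c))" for k
  proof (cases k)
    case (Suc k)
    show ?thesis unfolding Suc
      by (rule Ck_SucI[where f' = "\<lambda>q v. 2 * ((q - c) \<bullet> v)"])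
         (auto intro!: derivative_eq_intros Ck_mult Ck_const Ck_inner Ck_inner[unfolded inner_commute[of "_ - _"]]
           simp: inner_commute)
  qed (auto intro!: continuous_intros)
  have B: "Ck k B" for k
    unfolding B_def by (intro Ck_compose[where h = h, OF h(1)] Ck_add Ck_mult Ck_const sq)
  have pos: "B q > 0" if "dist c q < \<epsilon>" for q
  proof -
    have "(q - c) \<bullet> (q - c) < \<epsilon>\<^sup>2"
      using that by (auto simp: dist_norm norm_minus_commute dot_square_norm intro!: power_strict_mono)
    then show ?thesis by (simp add: B_def h(2))
  qed
  have nonneg: "B q \<ge> 0" for q
    unfolding B_def using h(2,3) less_imp_le[OF h(2)]
    by (cases "\<epsilon>\<^sup>2 + - 1 * ((q - c) \<bullet> (q - c)) > 0") (simp_all add: not_less)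
  have zero: "B q = 0" if "\<not> dist c q < \<epsilon>" for q
  proof -
    have "(q - c) \<bullet> (q - c) \<ge> \<epsilon>\<^sup>2"
      using that assms by (auto simp: dist_norm norm_minus_commute dot_square_norm intro!: power_mono)
    then show ?thesis by (simp add: B_def h(3))
  qed
  obtain a b where ab: "cball c \<epsilon> \<subseteq> cbox a b"
    using bounded_subset_cbox_symmetric[OF bounded_cball] by metis
  have "B q = 0" if "q \<notin> cbox a b" for q
    using that ab zero[of q] by (meson less_imp_le mem_cball subsetD)
  then have int: "integrable lborel B"
    by (intro integrable_lborel_box_support(1)[of _ a b] Ck_imp_continuous[OF B])
  have "(\<integral>q. B q \<partial>lborel) \<noteq> 0"
  proof
    assume "(\<integral>q. B q \<partial>lborel) = 0"
    then have "AE q in lborel. B q = 0"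
      using int nonneg integral_nonneg_eq_0_iff_AE by blast
    then have "AE q in lborel. q \<notin> ball c \<epsilon>"
      by (rule AE_mp) (use pos in \<open>force intro!: AE_I2\<close>)
    then have "emeasure lborel (ball c \<epsilon>) = 0"
      by (subst (asm) AE_iff_measurable[OF _ refl]) (auto simp: ball_def)
    then show False
      using open_not_negligible[of "ball c \<epsilon>"] assms
      by (auto simp: negligible_iff_null_sets null_sets_def)
  qed
  then have Z: "(\<integral>q. B q \<partial>lborel) > 0"
    using nonneg by (simp add: less_le)
  show ?thesis
  proof (rule that[of "\<lambda>q. (1 / (\<integral>q. B q \<partial>lborel)) * B q"])
    show "Ck k (\<lambda>q. (1 / (\<integral>q. B q \<partial>lborel)) * B q)" for k
      by (intro Ck_mult Ck_const B)
    show "dist c q \<le> \<epsilon>" if "1 / integral\<^sup>L lborel B * B q \<noteq> 0" for q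
      using that zero[of q] by force
  qed (use Z nonneg int in auto)
qed

text \<open>All derivatives fall on the kernel, hence \<open>W\<close> only has to be continuous.  Integration over a
box provides the compact domain that differentiation under the integral sign asks for.\<close>

lemma Ck_box_convolution:
  fixes W K :: "'a::euclidean_space \<Rightarrow> real"
  assumes W: "continuous_on UNIV W"
  shows "Ck k K \<Longrightarrow> Ck k (\<lambda>p. integral (cbox a b) (\<lambda>q. W q * K (q - p)))"
proof (induction k arbitrary: K)
  case 0
  then have "continuous_on (UNIV \<times> cbox a b) (\<lambda>(p, q). W q * K (q - p))"
    by (auto simp: split_beta intro!: continuous_intros continuous_on_compose2[OF W] continuous_on_compose2[of UNIV K])
  from integral_continuous_on_param[OF this] show ?case by simp
next
  case (Suc k)
  let ?D = "\<lambda>x. Blinfun (frechet_derivative K (at x))"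
  have DK: "blinfun_apply (?D x) = frechet_derivative K (at x)" for x
    by (rule bounded_linear_Blinfun_apply) (use Suc.prems in \<open>auto intro!: has_derivative_bounded_linear[OF Ck_has_derivative]\<close>)
  have Dc: "continuous_on UNIV ?D"
    by (rule continuous_on_blinfun_componentwise) (use Suc.prems in \<open>auto simp: DK intro: Ck_imp_continuous\<close>)
  have Kc: "continuous_on UNIV K" using Suc.prems by (rule Ck_imp_continuous)
  have c1: "continuous_on (UNIV \<times> cbox a b) (\<lambda>(p, q). (- W q) *\<^sub>R ?D (q - p))"
    by (auto simp: split_beta intro!: continuous_intros continuous_on_compose2[OF W] continuous_on_compose2[OF Dc])
  have der: "((\<lambda>p. integral (cbox a b) (\<lambda>q. W q * K (q - p))) has_derivative
      integral (cbox a b) (\<lambda>q. (- W q) *\<^sub>R ?D (q - p))) (at p)" for p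
  proof (rule leibniz_rule[where U = UNIV and fx = "\<lambda>p q. (- W q) *\<^sub>R ?D (q - p)", OF _ _ c1])
    show "((\<lambda>p. W q * K (q - p)) has_derivative blinfun_apply ((- W q) *\<^sub>R ?D (q - p))) (at p)" for p q
    proof -
      have "((\<lambda>p. K (q - p)) has_derivative (\<lambda>v. frechet_derivative K (at (q - p)) (- v))) (at p)"
        by (rule has_derivative_compose[of "\<lambda>p. q - p" "\<lambda>v. - v" p UNIV K, OF _ Ck_has_derivative[OF Suc.prems]])
           (auto intro!: derivative_eq_intros)
      from has_derivative_mult_right[OF this, of "W q"]
      have "((\<lambda>p. W q * K (q - p)) has_derivative (\<lambda>v. W q * blinfun_apply (?D (q - p)) (- v))) (at p)"
        by (simp only: DK)
      moreover have "(\<lambda>v. W q * blinfun_apply (?D (q - p)) (- v)) = blinfun_apply ((- W q) *\<^sub>R ?D (q - p))"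
        by (simp add: fun_eq_iff blinfun.minus_right blinfun.minus_left blinfun.scaleR_left)
      ultimately show ?thesis by (simp only:)
    qed
    show "(\<lambda>q. W q * K (q - p)) integrable_on cbox a b" for p
      by (intro integrable_continuous continuous_intros continuous_on_compose2[OF W] continuous_on_compose2[OF Kc]) auto
  qed auto
  show ?case
  proof (rule Ck_SucI[OF der])
    fix v
    have "integral (cbox a b) (\<lambda>q. (- W q) *\<^sub>R ?D (q - p)) v
        = integral (cbox a b) (\<lambda>q. W q * (- frechet_derivative K (at (q - p)) v))" for p
    proof -
      have "(\<lambda>q. (- W q) *\<^sub>R ?D (q - p)) integrable_on cbox a b"
        by (intro integrable_continuous continuous_intros continuous_on_compose2[OF W] continuous_on_compose2[OF Dc]) auto
      from blinfun_apply_integral[OF this, of v] show ?thesis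
        by (simp add: blinfun.bilinear_simps DK)
    qed
    moreover have "Ck k (\<lambda>x. (- 1) * frechet_derivative K (at x) v)"
      using Suc.prems by (intro Ck_mult Ck_const) auto
    from Suc.IH[OF this] have "Ck k (\<lambda>p. integral (cbox a b) (\<lambda>q. W q * (- frechet_derivative K (at (q - p)) v)))"
      by simp
    ultimately show "Ck k (\<lambda>p. integral (cbox a b) (\<lambda>q. (- W q) *\<^sub>R ?D (q - p)) v)" by simp
  qed
qed

text \<open>This is the convolution of \<open>W\<close> with the reflected kernel \<open>\<lambda>q. K (- q)\<close>: the value at \<open>p\<close>
averages \<open>W\<close> over the translate of the support of \<open>K\<close> by \<open>p\<close>.\<close>

definition mollify :: "('a::euclidean_space \<Rightarrow> real) \<Rightarrow> ('a \<Rightarrow> real) \<Rightarrow> 'a \<Rightarrow> real" where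
  "mollify W K p = (\<integral>q. W (p + q) * K q \<partial>lborel)"

lemma mollify_eq_box_convolution:
  assumes W: "continuous_on UNIV W" "\<And>q. q \<notin> cbox a b \<Longrightarrow> W q = 0" and K: "continuous_on UNIV K"
  shows "mollify W K p = integral (cbox a b) (\<lambda>q. W q * K (q - p))"
proof -
  have c: "continuous_on UNIV (\<lambda>q. W q * K (q - p))"
    by (intro continuous_intros continuous_on_compose2[OF W(1)] continuous_on_compose2[OF K]) auto
  have "integral (cbox a b) (\<lambda>q. W q * K (q - p)) = (\<integral>q. W q * K (q - p) \<partial>lborel)"
    using c by (rule integrable_lborel_box_support(2)) (use W in auto)
  also have "\<dots> = (\<integral>q. W q * K (q - p) \<partial>distr lborel borel ((+) p))"
    by (simp add: lborel_distr_plus)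
  also have "\<dots> = (\<integral>q. W (p + q) * K q \<partial>lborel)"
    using borel_measurable_continuous_onI[OF c] by (subst integral_distr) auto
  finally show ?thesis by (simp add: mollify_def)
qed

lemma Ck_mollify:
  assumes "continuous_on UNIV W" "\<And>q. q \<notin> cbox a b \<Longrightarrow> W q = 0" and K: "Ck k K"
  shows "Ck k (mollify W K)"
proof -
  have "mollify W K = (\<lambda>p. integral (cbox a b) (\<lambda>q. W q * K (q - p)))"
    using mollify_eq_box_convolution[OF assms(1,2) Ck_imp_continuous[OF K], of a b] by auto
  then show ?thesis using Ck_box_convolution[OF assms(1) K, of a b] by simp
qed

lemma integrable_mollify:
  fixes W K :: "'a::euclidean_space \<Rightarrow> real"
  assumes W: "continuous_on UNIV W" and K: "continuous_on UNIV K" "bounded {q. K q \<noteq> 0}"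
  shows "integrable lborel (\<lambda>q. W (p + q) * K q)"
proof -
  obtain a b where ab: "{q. K q \<noteq> 0} \<subseteq> cbox a b"
    using bounded_subset_cbox_symmetric[OF K(2)] by metis
  show ?thesis
    by (rule integrable_lborel_box_support(1)[of _ a b])
       (use ab in \<open>auto intro!: continuous_intros continuous_on_compose2[OF W] continuous_on_compose2[OF K(1)]\<close>)
qed

lemma mollify_near:
  fixes W K :: "'a::euclidean_space \<Rightarrow> real"
  assumes W: "continuous_on UNIV W" and K: "continuous_on UNIV K" "bounded {q. K q \<noteq> 0}"
    and K1: "\<And>q. K q \<ge> 0" "(\<integral>q. K q \<partial>lborel) = 1"
    and near: "\<And>q. K q \<noteq> 0 \<Longrightarrow> \<bar>W (p + q) - v\<bar> \<le> \<eta>"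
  shows "\<bar>mollify W K p - v\<bar> \<le> \<eta>"
proof -
  have Ki: "integrable lborel K"
    using K1(2) not_integrable_integral_eq by fastforce
  have "mollify W K p - v = (\<integral>q. W (p + q) * K q - v * K q \<partial>lborel)"
    using K1 Ki integrable_mollify[OF W K] by (subst Bochner_Integration.integral_diff) (auto simp: mollify_def)
  also have "\<bar>\<dots>\<bar> \<le> (\<integral>q. \<eta> * K q \<partial>lborel)"
  proof (rule integral_abs_bound_integral)
    show "\<bar>W (p + q) * K q - v * K q\<bar> \<le> \<eta> * K q" for q
      using near[of q] K1(1)[of q]
      by (cases "K q = 0") (auto simp: left_diff_distrib[symmetric] abs_mult intro!: mult_right_mono)
  qed (use Ki integrable_mollify[OF W K] in auto)
  also have "\<dots> = \<eta>" using K1 by simp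
  finally show ?thesis .
qed

section \<open>Flows of confining fields\<close>

definition trajectory :: "(real \<Rightarrow> 'a::euclidean_space \<Rightarrow> 'a) \<Rightarrow> real set \<Rightarrow> (real \<Rightarrow> 'a) \<Rightarrow> bool" where
  "trajectory V I \<xi> \<longleftrightarrow> (\<forall>t\<in>I. (\<xi> has_vector_derivative V t (\<xi> t)) (at t within I))"

lemma trajectory_subset: "trajectory V I \<xi> \<Longrightarrow> J \<subseteq> I \<Longrightarrow> trajectory V J \<xi>"
  by (auto simp: trajectory_def intro: has_vector_derivative_within_subset)

lemma trajectory_cong:
  "trajectory V I \<xi> \<Longrightarrow> (\<And>t x. t \<in> I \<Longrightarrow> V t x = U t x) \<Longrightarrow> trajectory U I \<xi>"
  by (simp add: trajectory_def)

lemma trajectory_continuous: "trajectory V I \<xi> \<Longrightarrow> continuous_on I \<xi>"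
  by (auto simp: trajectory_def continuous_on_eq_continuous_within intro: has_vector_derivative_continuous)

lemma trajectory_sq_has_derivative:
  assumes "trajectory V I \<xi>" "t \<in> I"
  shows "((\<lambda>t. \<xi> t \<bullet> \<xi> t) has_real_derivative 2 * (\<xi> t \<bullet> V t (\<xi> t))) (at t within I)"
proof -
  have "(\<xi> has_derivative (\<lambda>h. h *\<^sub>R V t (\<xi> t))) (at t within I)"
    using assms by (auto simp: trajectory_def has_vector_derivative_def)
  from has_derivative_inner[OF this this]
  show ?thesis
    unfolding has_field_derivative_def
    by (rule has_derivative_eq_rhs) (auto simp: fun_eq_iff inner_commute)
qed

text \<open>After the last time that the trajectory spends in the ball, its squared norm cannot increase,
because the field has no outward component there.\<close>

lemma trajectory_in_ball:
  assumes traj: "trajectory V {a..b} \<xi>"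
    and inward: "\<And>t x. t \<in> {a..b} \<Longrightarrow> norm x \<ge> \<rho> \<Longrightarrow> x \<bullet> V t x \<le> 0"
    and a: "norm (\<xi> a) \<le> \<rho>" and t: "t \<in> {a..b}"
  shows "norm (\<xi> t) \<le> \<rho>"
proof (rule ccontr)
  assume out: "\<not> norm (\<xi> t) \<le> \<rho>"
  have \<rho>: "\<rho> \<ge> 0" using a norm_ge_zero order_trans by blast
  let ?S = "{s \<in> {a..t}. norm (\<xi> s) \<le> \<rho>}"
  have cont: "continuous_on {a..t} \<xi>"
    using t by (intro trajectory_continuous[of V] trajectory_subset[OF traj]) auto
  have "closed ?S"
    using continuous_closed_preimage[OF continuous_on_norm[OF cont], of "{..\<rho>}"]
    by (simp add: vimage_def Int_def conj_commute)
  moreover have "bounded ?S"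
    by (rule bounded_subset[of "{a..t}"]) auto
  ultimately have "compact ?S" by (simp add: compact_eq_bounded_closed)
  moreover have "?S \<noteq> {}" using a t by auto
  \<comment> \<open>the last time before \<open>t\<close> at which the trajectory is in the ball\<close>
  ultimately obtain s where s: "s \<in> ?S" "\<And>r. r \<in> ?S \<Longrightarrow> r \<le> s"
    using compact_attains_sup[of ?S] by blast
  have st: "s < t" using s out t by (cases "s = t") auto
  have sub: "{s..t} \<subseteq> {a..b}" using s t by auto
  have "\<exists>r\<in>{s<..<t}. \<xi> t \<bullet> \<xi> t - \<xi> s \<bullet> \<xi> s = 2 * (\<xi> r \<bullet> V r (\<xi> r)) * (t - s)"
    using trajectory_sq_has_derivative[OF trajectory_subset[OF traj sub]]
    by (intro mvt_simple st) (auto simp: has_field_derivative_def)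
  then obtain r where r: "r \<in> {s<..<t}" "\<xi> t \<bullet> \<xi> t - \<xi> s \<bullet> \<xi> s = 2 * (\<xi> r \<bullet> V r (\<xi> r)) * (t - s)"
    by blast
  have "norm (\<xi> r) > \<rho>"
  proof (rule ccontr)
    assume "\<not> norm (\<xi> r) > \<rho>"
    then have "r \<in> ?S" using r(1) s(1) by auto
    then show False using s(2) r(1) by force
  qed
  then have "\<xi> r \<bullet> V r (\<xi> r) \<le> 0"
    using r s t by (intro inward) auto
  then have "2 * (\<xi> r \<bullet> V r (\<xi> r)) * (t - s) \<le> 0"
    using st by (intro mult_nonpos_nonneg[of "2 * _"]) auto
  then have "(norm (\<xi> t))\<^sup>2 - (norm (\<xi> s))\<^sup>2 \<le> 0"
    using r(2) by (simp only: dot_square_norm)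
  then have "(norm (\<xi> t))\<^sup>2 \<le> (norm (\<xi> s))\<^sup>2" by simp
  then have "norm (\<xi> t) \<le> norm (\<xi> s)"
    by (rule power2_le_imp_le) simp
  then show False using s out by auto
qed

text \<open>The function \<open>exp (4 * t) * (norm (\<xi> t)\<^sup>2 + R\<^sup>2)\<close> is non-decreasing: at most linear growth of
the field bounds its derivative from below by \<open>exp (4 * t)\<close> times
\<open>(norm (\<xi> t) - R)\<^sup>2 + norm (\<xi> t)\<^sup>2 + 3 * R\<^sup>2\<close>.  Consequently a trajectory that ends in a bounded
set starts in a bounded set, and a function of compact support keeps a compact support when
it is transported backwards along the flow.\<close>

lemma trajectory_backward_bound:
  assumes traj: "trajectory V {a..b} \<xi>" and ab: "a \<le> b"
    and growth: "\<And>t x. t \<in> {a..b} \<Longrightarrow> norm (V t x) \<le> norm x + R"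
  shows "(norm (\<xi> a))\<^sup>2 \<le> exp (4 * (b - a)) * ((norm (\<xi> b))\<^sup>2 + R\<^sup>2)"
proof -
  let ?G = "\<lambda>t. exp (4 * t) * (\<xi> t \<bullet> \<xi> t + R\<^sup>2)"
  let ?G' = "\<lambda>t. exp (4 * t) * (4 * (\<xi> t \<bullet> \<xi> t + R\<^sup>2) + 2 * (\<xi> t \<bullet> V t (\<xi> t)))"
  have "(?G has_real_derivative ?G' t) (at t within {a..b})" if "t \<in> {a..b}" for t
    by (rule derivative_eq_intros trajectory_sq_has_derivative[OF traj that] refl)+
       (simp add: algebra_simps)
  then have "\<exists>t\<in>{a..b}. ?G b - ?G a = ?G' t * (b - a)"
    using ab by (intro mvt_very_simple) (auto simp: has_field_derivative_def)
  then obtain t where t: "t \<in> {a..b}" "?G b - ?G a = ?G' t * (b - a)" by blast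
  have "\<bar>\<xi> t \<bullet> V t (\<xi> t)\<bar> \<le> norm (\<xi> t) * norm (V t (\<xi> t))" by (rule Cauchy_Schwarz_ineq2)
  also have "\<dots> \<le> norm (\<xi> t) * (norm (\<xi> t) + R)" using growth[OF t(1)] by (intro mult_left_mono) auto
  finally have "2 * (\<xi> t \<bullet> V t (\<xi> t)) \<ge> - 2 * (norm (\<xi> t) * (norm (\<xi> t) + R))" by linarith
  moreover have "4 * ((norm (\<xi> t))\<^sup>2 + R\<^sup>2) - 2 * (norm (\<xi> t) * (norm (\<xi> t) + R)) =
      (norm (\<xi> t) - R)\<^sup>2 + (norm (\<xi> t))\<^sup>2 + 3 * R\<^sup>2"
    by (simp add: power2_eq_square algebra_simps)
  ultimately have "4 * (\<xi> t \<bullet> \<xi> t + R\<^sup>2) + 2 * (\<xi> t \<bullet> V t (\<xi> t)) \<ge> 0"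
    unfolding dot_square_norm by (smt (verit) zero_le_power2)
  then have "?G' t * (b - a) \<ge> 0" using ab by simp
  then have "?G a \<le> ?G b" using t by simp
  then have "exp (- (4 * a)) * (exp (4 * a) * ((norm (\<xi> a))\<^sup>2 + R\<^sup>2)) \<le>
      exp (- (4 * a)) * (exp (4 * b) * ((norm (\<xi> b))\<^sup>2 + R\<^sup>2))"
    by (intro mult_left_mono) (auto simp: dot_square_norm)
  then have "(norm (\<xi> a))\<^sup>2 + R\<^sup>2 \<le> exp (4 * (b - a)) * ((norm (\<xi> b))\<^sup>2 + R\<^sup>2)"
    by (simp add: mult.assoc[symmetric] mult_exp_exp right_diff_distrib)
  then show ?thesis by (smt (verit) zero_le_power2)
qed

text \<open>Gronwall's inequality: the squared distance, multiplied by \<open>exp (- 2 * K * t)\<close>, is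
non-increasing.  Uniqueness of trajectories and Lipschitz dependence on the starting point
are both special cases.\<close>

lemma trajectory_stability:
  assumes \<xi>: "trajectory V {a..b} \<xi>" and \<eta>: "trajectory V {a..b} \<eta>" and ab: "a \<le> b"
    and lip: "\<And>t. t \<in> {a..b} \<Longrightarrow> norm (V t (\<xi> t) - V t (\<eta> t)) \<le> K * norm (\<xi> t - \<eta> t)"
  shows "norm (\<xi> b - \<eta> b) \<le> exp (K * (b - a)) * norm (\<xi> a - \<eta> a)"
proof -
  let ?d = "\<lambda>t. \<xi> t - \<eta> t"
  let ?G = "\<lambda>t. exp (- 2 * K * t) * (?d t \<bullet> ?d t)"
  let ?G' = "\<lambda>t. exp (- 2 * K * t) * (2 * (?d t \<bullet> (V t (\<xi> t) - V t (\<eta> t))) - 2 * K * (?d t \<bullet> ?d t))"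
  have d: "trajectory (\<lambda>t _. V t (\<xi> t) - V t (\<eta> t)) {a..b} ?d"
    using \<xi> \<eta> by (auto simp: trajectory_def intro!: has_vector_derivative_diff)
  have "(?G has_real_derivative ?G' t) (at t within {a..b})" if "t \<in> {a..b}" for t
    by (rule derivative_eq_intros trajectory_sq_has_derivative[OF d that] refl)+
       (simp add: algebra_simps)
  then have "\<exists>t\<in>{a..b}. ?G b - ?G a = ?G' t * (b - a)"
    using ab by (intro mvt_very_simple) (auto simp: has_field_derivative_def)
  then obtain t where t: "t \<in> {a..b}" "?G b - ?G a = ?G' t * (b - a)" by blast
  have "?d t \<bullet> (V t (\<xi> t) - V t (\<eta> t)) \<le> norm (?d t) * norm (V t (\<xi> t) - V t (\<eta> t))"
    by (rule norm_cauchy_schwarz)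
  also have "\<dots> \<le> norm (?d t) * (K * norm (?d t))"
    using lip[OF t(1)] by (intro mult_left_mono) auto
  finally have "2 * (?d t \<bullet> (V t (\<xi> t) - V t (\<eta> t))) - 2 * K * (?d t \<bullet> ?d t) \<le> 0"
    by (simp add: dot_square_norm power2_eq_square mult.left_commute)
  then have "?G' t \<le> 0" by (intro mult_nonneg_nonpos) auto
  then have "?G' t * (b - a) \<le> 0" by (rule mult_nonpos_nonneg) (use ab in simp)
  then have "?G b \<le> ?G a" using t by simp
  then have "exp (2 * K * b) * ?G b \<le> exp (2 * K * b) * ?G a"
    by (intro mult_left_mono) auto
  then have "(exp (2 * K * b) * exp (- 2 * K * b)) * (norm (?d b))\<^sup>2 \<le>
      (exp (2 * K * b) * exp (- 2 * K * a)) * (norm (?d a))\<^sup>2"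
    by (simp only: mult.assoc dot_square_norm)
  moreover have "exp (2 * K * b) * exp (- 2 * K * b) = 1"
    by (simp add: mult_exp_exp)
  moreover have "exp (2 * K * b) * exp (- 2 * K * a) = (exp (K * (b - a)))\<^sup>2"
    by (simp add: mult_exp_exp power2_eq_square algebra_simps)
  ultimately have "(norm (?d b))\<^sup>2 \<le> (exp (K * (b - a)) * norm (?d a))\<^sup>2"
    by (simp only: power_mult_distrib mult_1_left)
  then show ?thesis by (rule power2_le_imp_le) simp
qed

lemma integral_has_vector_derivative_halfline:
  fixes f :: "real \<Rightarrow> 'a::banach"
  assumes "continuous_on {0..} f" "t \<ge> 0"
  shows "((\<lambda>u. integral {0..u} f) has_vector_derivative f t) (at t within {0..})"
proof -
  have "((\<lambda>u. integral {0..u} f) has_vector_derivative f t) (at t within {0..t + 1})"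
    using assms by (intro integral_has_vector_derivative) (auto intro: continuous_on_subset)
  moreover have "at t within {0..t + 1} = at t within {0..}"
    by (rule at_within_nhd[of _ "{..<t + 1}"]) auto
  ultimately show ?thesis by simp
qed

text \<open>The Picard operator is a contraction on the whole half-line if it is written for the weighted
unknown \<open>exp (- \<kappa> * t) *\<^sub>R \<xi> t\<close>, which is bounded since \<open>\<xi>\<close> grows at most linearly.  Thus
no local solutions have to be glued together.\<close>

lemma picard_lindelof_global:
  fixes U :: "real \<Rightarrow> 'a::euclidean_space \<Rightarrow> 'a"
  assumes cont: "continuous_on ({0..} \<times> UNIV) (\<lambda>(t, x). U t x)"
    and lip: "\<And>t x y. t \<ge> 0 \<Longrightarrow> norm (U t x - U t y) \<le> K * norm (x - y)"
    and bound: "\<And>t x. t \<ge> 0 \<Longrightarrow> norm (U t x) \<le> M"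
    and K: "K \<ge> 0"
  obtains \<xi> where "\<xi> 0 = x" "trajectory U {0..} \<xi>"
proof -
  \<comment> \<open>this weight makes the contraction constant \<open>K / \<kappa>\<close> at most \<open>1 / 2\<close>\<close>
  define \<kappa> where "\<kappa> = 2 * K + 1"
  have \<kappa>: "\<kappa> > 0" using K by (simp add: \<kappa>_def)
  have M: "M \<ge> 0" using bound[of 0 0] norm_ge_zero order_trans by blast
  \<comment> \<open>\<open>f z\<close> is the velocity along the curve encoded by \<open>z\<close>, \<open>J z\<close> the integrated curve and \<open>P z\<close> its encoding, frozen for negative times\<close>
  define f where "f z s = U s (exp (\<kappa> * s) *\<^sub>R apply_bcontfun z s)" for z s
  have f_cont: "continuous_on {0..} (f z)" for z
    unfolding f_def
    by (rule continuous_on_compose2[OF cont, of _ "\<lambda>s. (s, exp (\<kappa> * s) *\<^sub>R apply_bcontfun z s)", simplified split_conv])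
       (auto intro!: continuous_intros)
  have f_int: "f z integrable_on {0..t}" for z t
    by (intro integrable_continuous_real continuous_on_subset[OF f_cont]) auto
  define J where "J z t = x + integral {0..t} (f z)" for z t
  have J_der: "(J z has_vector_derivative f z t) (at t within {0..})" if "t \<ge> 0" for z t
    unfolding J_def using integral_has_vector_derivative_halfline[OF f_cont that]
    by (auto intro!: derivative_eq_intros)
  have J_cont: "continuous_on {0..} (J z)" for z
    using J_der by (auto simp: continuous_on_eq_continuous_within intro: has_vector_derivative_continuous)
  define P where "P z t = exp (- (\<kappa> * max 0 t)) *\<^sub>R J z (max 0 t)" for z t
  have P_cont: "continuous_on UNIV (P z)" for z
    unfolding P_def by (intro continuous_intros continuous_on_compose2[OF J_cont]) auto
  have P_bound: "norm (P z t) \<le> norm x + M / \<kappa>" for z t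
  proof -
    define u where "u = max 0 t"
    have u: "u \<ge> 0" by (simp add: u_def)
    have "norm (integral {0..u} (f z)) \<le> M * (u - 0)"
      using u by (intro integral_bound continuous_on_subset[OF f_cont]) (auto simp: f_def bound)
    then have "norm (J z u) \<le> norm x + M * u"
      unfolding J_def using norm_triangle_ineq[of x "integral {0..u} (f z)"] by simp
    then have "exp (- (\<kappa> * u)) * norm (J z u) \<le> exp (- (\<kappa> * u)) * (norm x + M * u)"
      by (intro mult_left_mono) auto
    also have "\<dots> = exp (- (\<kappa> * u)) * norm x + M / \<kappa> * (\<kappa> * u * exp (- (\<kappa> * u)))"
      using \<kappa> by (simp add: field_simps)
    also have "\<dots> \<le> 1 * norm x + M / \<kappa> * 1"
    proof -
      have "\<kappa> * u \<le> exp (\<kappa> * u)"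
        using exp_ge_add_one_self[of "\<kappa> * u"] by linarith
      then have "\<kappa> * u * exp (- (\<kappa> * u)) \<le> 1"
        by (simp add: exp_minus field_simps)
      then show ?thesis using \<kappa> u M by (intro add_mono mult_mono) auto
    qed
    finally show ?thesis by (simp add: P_def u_def)
  qed
  define \<Phi> where "\<Phi> z = Bcontfun (P z)" for z
  have \<Phi>: "apply_bcontfun (\<Phi> z) = P z" for z
    unfolding \<Phi>_def by (rule Bcontfun_inverse) (rule bcontfun_normI[OF P_cont P_bound])
  have "dist (\<Phi> z) (\<Phi> w) \<le> 1 / 2 * dist z w" for z w
  proof (rule dist_bound)
    fix t :: real
    define u where "u = max 0 t"
    have u: "u \<ge> 0" by (simp add: u_def)
    let ?D = "dist z w"
    have der: "((\<lambda>s. K * ?D / \<kappa> * exp (\<kappa> * s)) has_vector_derivative K * ?D * exp (\<kappa> * s)) (at s within {0..u})" for s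
      using \<kappa> by (auto simp: has_real_derivative_iff_has_vector_derivative[symmetric] intro!: derivative_eq_intros)
    have hi: "((\<lambda>s. K * ?D * exp (\<kappa> * s)) has_integral
        (K * ?D / \<kappa> * exp (\<kappa> * u) - K * ?D / \<kappa> * exp (\<kappa> * 0))) {0..u}"
      by (rule fundamental_theorem_of_calculus[OF u der])
    have pt: "norm (f z s - f w s) \<le> K * ?D * exp (\<kappa> * s)" if "s \<in> {0..u}" for s
    proof -
      have "norm (f z s - f w s) \<le> K * (exp (\<kappa> * s) * dist (z s) (w s))"
        using lip[of s "exp (\<kappa> * s) *\<^sub>R z s" "exp (\<kappa> * s) *\<^sub>R w s"] that
        by (simp add: f_def scaleR_diff_right[symmetric] dist_norm)
      also have "\<dots> \<le> K * (exp (\<kappa> * s) * ?D)"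
        using K by (intro mult_left_mono dist_bounded) auto
      finally show ?thesis by (simp add: mult_ac)
    qed
    have "norm (J z u - J w u) = norm (integral {0..u} (\<lambda>s. f z s - f w s))"
      by (simp add: J_def integral_diff[OF f_int f_int])
    also have "\<dots> \<le> integral {0..u} (\<lambda>s. K * ?D * exp (\<kappa> * s))"
      using pt hi by (intro integral_norm_bound_integral integrable_diff f_int) (auto simp: has_integral_integrable)
    also have "\<dots> \<le> K * ?D / \<kappa> * exp (\<kappa> * u)"
      using integral_unique[OF hi] K \<kappa> by simp
    finally have "exp (- (\<kappa> * u)) * norm (J z u - J w u) \<le> exp (- (\<kappa> * u)) * (K * ?D / \<kappa> * exp (\<kappa> * u))"
      by (intro mult_left_mono) auto
    also have "\<dots> = K / \<kappa> * ?D"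
      by (simp add: exp_minus field_simps)
    also have "\<dots> \<le> 1 / 2 * ?D"
      using K by (intro mult_right_mono) (auto simp: \<kappa>_def field_simps)
    finally show "dist (apply_bcontfun (\<Phi> z) t) (apply_bcontfun (\<Phi> w) t) \<le> 1 / 2 * ?D"
      by (simp add: \<Phi> P_def dist_norm u_def[symmetric] scaleR_diff_right[symmetric])
  qed
  then have "\<exists>!z. \<Phi> z = z"
    by (intro banach_fix_type[of "1 / 2"]) auto
  then obtain z where z: "\<Phi> z = z" by blast
  have Jz: "exp (\<kappa> * t) *\<^sub>R apply_bcontfun z t = J z t" if "t \<ge> 0" for t
  proof -
    have "apply_bcontfun z t = exp (- (\<kappa> * t)) *\<^sub>R J z t"
      using \<Phi>[of z] z that by (simp add: P_def)
    then show ?thesis by (simp add: mult_exp_exp)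
  qed
  show ?thesis
  proof (rule that[of "J z"])
    show "J z 0 = x" by (simp add: J_def)
    show "trajectory U {0..} (J z)"
      using J_der[of _ z] Jz by (auto simp: trajectory_def f_def)
  qed
qed

text \<open>The trajectory is chosen separately for each starting point.  The choice is meaningful as
soon as a trajectory exists on the half-line, and in a confining field it is unique.\<close>

definition flow :: "(real \<Rightarrow> 'a::euclidean_space \<Rightarrow> 'a) \<Rightarrow> real \<Rightarrow> real \<Rightarrow> 'a \<Rightarrow> 'a" where
  "flow V s t x = (SOME \<xi>. \<xi> s = x \<and> trajectory V {s..} \<xi>) t"

lemma closest_point_cball_outside:
  fixes x :: "'a::euclidean_space"
  assumes "\<rho> > 0" "norm x \<ge> \<rho>"
  shows "closest_point (cball 0 \<rho>) x = (\<rho> / norm x) *\<^sub>R x"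
proof (rule closest_point_unique[symmetric])
  have "x \<noteq> 0" using assms by auto
  have "dist x ((\<rho> / norm x) *\<^sub>R x) = norm x - \<rho>"
  proof -
    have "x - (\<rho> / norm x) *\<^sub>R x = (1 - \<rho> / norm x) *\<^sub>R x" by (simp add: scaleR_diff_left)
    then have "dist x ((\<rho> / norm x) *\<^sub>R x) = \<bar>1 - \<rho> / norm x\<bar> * norm x" by (simp add: dist_norm)
    also have "\<dots> = norm x - \<rho>" using assms \<open>x \<noteq> 0\<close> by (simp add: abs_if field_simps)
    finally show ?thesis .
  qed
  moreover have "norm x - \<rho> \<le> dist x z" if "z \<in> cball 0 \<rho>" for z
    using that norm_triangle_ineq2[of x z] by (simp add: dist_norm)
  ultimately show "\<forall>z\<in>cball 0 \<rho>. dist x ((\<rho> / norm x) *\<^sub>R x) \<le> dist x z" by auto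
qed (use assms in auto)

lemma continuous_on_prod_lipschitz:
  fixes V :: "real \<Rightarrow> 'a::euclidean_space \<Rightarrow> 'b::real_normed_vector"
  assumes t: "\<And>x. continuous_on I (\<lambda>t. V t x)"
    and lip: "\<And>\<rho>. \<exists>K\<ge>0. \<forall>t\<in>I \<inter> cball 0 \<rho>. \<forall>x\<in>cball 0 \<rho>. \<forall>y\<in>cball 0 \<rho>.
      norm (V t x - V t y) \<le> K * norm (x - y)"
  shows "continuous_on (I \<times> UNIV) (\<lambda>(t, x). V t x)"
  unfolding continuous_on_iff
proof (intro ballI allI impI)
  fix p :: "real \<times> 'a" and e :: real assume p: "p \<in> I \<times> UNIV" and e: "e > 0"
  obtain s x where [simp]: "p = (s, x)" by (cases p)
  define \<rho> where "\<rho> = max \<bar>s\<bar> (norm x) + 1"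
  obtain K where K: "K \<ge> 0" "\<forall>t\<in>I \<inter> cball 0 \<rho>. \<forall>y\<in>cball 0 \<rho>. \<forall>z\<in>cball 0 \<rho>.
      norm (V t y - V t z) \<le> K * norm (y - z)"
    using lip by blast
  obtain d where d: "d > 0" "\<And>r. r \<in> I \<Longrightarrow> dist r s < d \<Longrightarrow> dist (V r x) (V s x) < e / 2"
    using t[of x, unfolded continuous_on_iff, rule_format, of s "e / 2"] p e by auto
  define d' where "d' = min d (min 1 (e / (2 * (K + 1))))"
  have d': "d' > 0" "d' \<le> d" "d' \<le> 1" "d' \<le> e / (2 * (K + 1))"
    using d e K by (simp_all add: d'_def min.coboundedI2)
  show "\<exists>d>0. \<forall>q\<in>I \<times> UNIV. dist q p < d \<longrightarrow> dist (case q of (t, x) \<Rightarrow> V t x) (case p of (t, x) \<Rightarrow> V t x) < e"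
  proof (intro exI[of _ d'] conjI d'(1) ballI impI)
    fix q assume q: "q \<in> I \<times> (UNIV :: 'a set)" "dist q p < d'"
    obtain r y where [simp]: "q = (r, y)" by (cases q)
    have r: "r \<in> I" "dist r s < d" using q d' dist_fst_le[of q p] by auto
    have y: "norm (y - x) < d'" using q dist_snd_le[of q p] by (auto simp: dist_norm)
    have "\<bar>r - s\<bar> < d'" using q dist_fst_le[of q p] by (auto simp: dist_real_def)
    then have "\<bar>r\<bar> \<le> \<rho>" "norm y \<le> \<rho>" "norm x \<le> \<rho>"
      using y d' norm_triangle_ineq2[of y x] by (auto simp: \<rho>_def)
    then have "norm (V r y - V r x) \<le> K * norm (y - x)"
      using K(2) r(1) by simp
    also have "\<dots> \<le> K * (e / (2 * (K + 1)))" using y d' K by (intro mult_left_mono) auto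
    also have "\<dots> \<le> e / 2" using K e by (simp add: field_simps)
    finally have "dist (V r y) (V r x) \<le> e / 2" by (simp add: dist_norm)
    then show "dist (case q of (t, x) \<Rightarrow> V t x) (case p of (t, x) \<Rightarrow> V t x) < e"
      using d(2)[OF r] dist_triangle[of "V r y" "V s x" "V r x"] by simp
  qed
qed

text \<open>These conditions make all trajectories global in forward time although the field is only
locally Lipschitz: by \<open>inward\<close>, no ball of radius at least \<open>R\<close> is ever left, and on a ball
the Lipschitz constant is uniform in time.  The bound \<open>growth\<close> controls how far away a
trajectory with a given end point can have started.\<close>

locale confining_field =
  fixes V :: "real \<Rightarrow> 'a::euclidean_space \<Rightarrow> 'a" and R :: real
  assumes R_pos: "R > 0"
    and continuous: "continuous_on ({0..} \<times> UNIV) (\<lambda>(t, x). V t x)"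
    and lipschitz: "\<And>\<rho>. \<exists>K\<ge>0. \<forall>t\<ge>0. \<forall>x\<in>cball 0 \<rho>. \<forall>y\<in>cball 0 \<rho>. norm (V t x - V t y) \<le> K * norm (x - y)"
    and inward: "\<And>t x. t \<ge> 0 \<Longrightarrow> norm x \<ge> R \<Longrightarrow> x \<bullet> V t x \<le> 0"
    and growth: "\<And>t x. t \<ge> 0 \<Longrightarrow> norm (V t x) \<le> norm x + R"
begin

text \<open>Let \<open>\<rho> = max R (norm x)\<close> and compose \<open>V\<close> with the projection onto the ball of radius \<open>\<rho>\<close>.
The resulting field is bounded and globally Lipschitz, and it still points inward outside the
ball.  Its trajectory from \<open>x\<close> therefore stays in the ball, where the two fields agree.\<close>

lemma trajectory_exists:
  assumes s: "s \<ge> 0"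
  shows "\<exists>\<xi>. \<xi> s = x \<and> trajectory V {s..} \<xi>"
proof -
  define \<rho> where "\<rho> = max R (norm x)"
  have \<rho>: "\<rho> > 0" "R \<le> \<rho>" "norm x \<le> \<rho>" using R_pos by (auto simp: \<rho>_def)
  let ?p = "closest_point (cball 0 \<rho> :: 'a set)"
  have p_in: "norm (?p y) \<le> \<rho>" for y
    using closest_point_in_set[of "cball 0 \<rho>" y] \<rho> by (simp add: less_imp_le)
  have p_lip: "norm (?p y - ?p z) \<le> norm (y - z)" for y z
    using closest_point_lipschitz[of "cball 0 \<rho>" y z] \<rho> by (simp add: dist_norm less_imp_le)
  define U where "U t y = V (s + t) (?p y)" for t y
  obtain K where K: "K \<ge> 0" "\<And>t x y. t \<ge> 0 \<Longrightarrow> norm x \<le> \<rho> \<Longrightarrow> norm y \<le> \<rho> \<Longrightarrow>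
      norm (V t x - V t y) \<le> K * norm (x - y)"
    using lipschitz[of \<rho>] by auto
  obtain \<eta> where \<eta>: "\<eta> 0 = x" "trajectory U {0..} \<eta>"
  proof (rule picard_lindelof_global[of U K "\<rho> + R" x])
    have "continuous_on ({0..} \<times> UNIV) (\<lambda>q. (s + fst q, ?p (snd q)))"
      using \<rho> by (intro continuous_intros continuous_on_compose2[OF continuous_on_closest_point[of _ UNIV]]) (auto simp: less_imp_le)
    moreover have "(\<lambda>q. (s + fst q, ?p (snd q))) ` ({0..} \<times> UNIV) \<subseteq> {0..} \<times> UNIV"
      using s by auto
    ultimately have "continuous_on ({0..} \<times> UNIV) (\<lambda>q. case (s + fst q, ?p (snd q)) of (t, x) \<Rightarrow> V t x)"
      by (rule continuous_on_compose2[OF continuous])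
    then show "continuous_on ({0..} \<times> UNIV) (\<lambda>(t, y). U t y)"
      by (simp add: U_def split_beta)
    show "norm (U t y - U t z) \<le> K * norm (y - z)" if "t \<ge> 0" for t y z
    proof -
      have "norm (U t y - U t z) \<le> K * norm (?p y - ?p z)"
        unfolding U_def using that s p_in by (intro K) auto
      also have "\<dots> \<le> K * norm (y - z)" using p_lip K by (intro mult_left_mono)
      finally show ?thesis .
    qed
    show "norm (U t y) \<le> \<rho> + R" if "t \<ge> 0" for t y
      unfolding U_def using growth[of "s + t" "?p y"] p_in[of y] that s by simp
  qed (use K in auto)
  have inw: "y \<bullet> U t y \<le> 0" if "t \<ge> 0" "norm y \<ge> \<rho>" for t y
  proof -
    have p: "?p y = (\<rho> / norm y) *\<^sub>R y" by (rule closest_point_cball_outside[OF \<rho>(1) that(2)])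
    have ny: "norm y > 0" using that \<rho> by linarith
    have "?p y \<bullet> U t y \<le> 0"
      unfolding U_def using that s \<rho> ny by (intro inward) (auto simp: p)
    then have "(norm y / \<rho>) * (?p y \<bullet> U t y) \<le> 0"
      using \<rho> by (intro mult_nonneg_nonpos) auto
    then show ?thesis using ny \<rho> by (simp add: p)
  qed
  have in_ball: "norm (\<eta> t) \<le> \<rho>" if "t \<ge> 0" for t
    by (rule trajectory_in_ball[of U 0 t]) (use \<eta> \<rho> that inw trajectory_subset[OF \<eta>(2), of "{0..t}"] in auto)
  have "trajectory V {s..} (\<lambda>t. \<eta> (t - s))"
    unfolding trajectory_def
  proof
    fix t assume t: "t \<in> {s..}"
    have im: "(\<lambda>t. t - s) ` {s..} = {0..}"
      by (auto simp: image_iff intro!: bexI[of _ "_ + s"])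
    have "(\<eta> has_vector_derivative U (t - s) (\<eta> (t - s))) (at (t - s) within {0..})"
      using \<eta>(2) t by (auto simp: trajectory_def)
    moreover have "((\<lambda>t. t - s) has_vector_derivative 1) (at t within {s..})"
      by (auto intro!: derivative_eq_intros)
    ultimately have "(\<eta> \<circ> (\<lambda>t. t - s) has_vector_derivative 1 *\<^sub>R U (t - s) (\<eta> (t - s))) (at t within {s..})"
      by (intro vector_diff_chain_within) (auto simp: im)
    moreover have "U (t - s) (\<eta> (t - s)) = V t (\<eta> (t - s))"
      using in_ball[of "t - s"] t by (simp add: U_def closest_point_self)
    ultimately show "((\<lambda>t. \<eta> (t - s)) has_vector_derivative V t (\<eta> (t - s))) (at t within {s..})"
      by (simp add: o_def)
  qed
  then show ?thesis using \<eta>(1) by (intro exI[of _ "\<lambda>t. \<eta> (t - s)"]) simp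
qed

lemma
  assumes "s \<ge> 0"
  shows flow_start: "flow V s s x = x"
    and flow_trajectory: "trajectory V {s..} (\<lambda>t. flow V s t x)"
  using someI_ex[OF trajectory_exists[OF assms, of x]] by (simp_all add: flow_def)

lemma trajectory_norm_le:
  assumes "trajectory V {a..b} \<xi>" "a \<ge> 0" "norm (\<xi> a) \<le> \<rho>" "R \<le> \<rho>" "t \<in> {a..b}"
  shows "norm (\<xi> t) \<le> \<rho>"
  by (rule trajectory_in_ball[OF assms(1) _ assms(3,5)]) (use assms inward in auto)

text \<open>To keep the bookkeeping of constants short, the single number \<open>\<rho>\<close> bounds both the final time
and the starting points.\<close>

lemma trajectory_lipschitz:
  obtains C where "C \<ge> 0"
    "\<And>a b \<xi> \<eta>. 0 \<le> a \<Longrightarrow> a \<le> b \<Longrightarrow> b \<le> \<rho> \<Longrightarrow> trajectory V {a..b} \<xi> \<Longrightarrow> trajectory V {a..b} \<eta> \<Longrightarrow>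
       norm (\<xi> a) \<le> \<rho> \<Longrightarrow> norm (\<eta> a) \<le> \<rho> \<Longrightarrow> norm (\<xi> b - \<eta> b) \<le> C * norm (\<xi> a - \<eta> a)"
proof -
  define r where "r = max R \<rho>"
  obtain K where K: "K \<ge> 0" "\<And>t x y. t \<ge> 0 \<Longrightarrow> norm x \<le> r \<Longrightarrow> norm y \<le> r \<Longrightarrow>
      norm (V t x - V t y) \<le> K * norm (x - y)"
    using lipschitz[of r] by auto
  show ?thesis
  proof (rule that[of "exp (K * \<rho>)"])
    fix a b \<xi> \<eta>
    assume *: "0 \<le> a" "a \<le> b" "b \<le> \<rho>" "trajectory V {a..b} \<xi>" "trajectory V {a..b} \<eta>"
      "norm (\<xi> a) \<le> \<rho>" "norm (\<eta> a) \<le> \<rho>"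
    have "norm (\<xi> b - \<eta> b) \<le> exp (K * (b - a)) * norm (\<xi> a - \<eta> a)"
    proof (rule trajectory_stability[OF *(4,5,2)])
      fix t assume "t \<in> {a..b}"
      then show "norm (V t (\<xi> t) - V t (\<eta> t)) \<le> K * norm (\<xi> t - \<eta> t)"
        using * trajectory_norm_le[of a b _ r t] by (intro K) (auto simp: r_def)
    qed
    also have "\<dots> \<le> exp (K * \<rho>) * norm (\<xi> a - \<eta> a)"
      using * K by (intro mult_right_mono) (auto intro!: mult_left_mono)
    finally show "norm (\<xi> b - \<eta> b) \<le> exp (K * \<rho>) * norm (\<xi> a - \<eta> a)" .
  qed simp
qed

lemma trajectory_eq_flow:
  assumes "trajectory V {a..b} \<xi>" "a \<ge> 0" "t \<in> {a..b}"
  shows "\<xi> t = flow V a t (\<xi> a)"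
proof -
  define \<rho> where "\<rho> = max b (norm (\<xi> a))"
  obtain C where C: "\<And>a b \<xi> \<eta>. 0 \<le> a \<Longrightarrow> a \<le> b \<Longrightarrow> b \<le> \<rho> \<Longrightarrow> trajectory V {a..b} \<xi> \<Longrightarrow> trajectory V {a..b} \<eta> \<Longrightarrow>
       norm (\<xi> a) \<le> \<rho> \<Longrightarrow> norm (\<eta> a) \<le> \<rho> \<Longrightarrow> norm (\<xi> b - \<eta> b) \<le> C * norm (\<xi> a - \<eta> a)"
    using trajectory_lipschitz[of \<rho>] by metis
  have "norm (\<xi> t - flow V a t (\<xi> a)) \<le> C * norm (\<xi> a - flow V a a (\<xi> a))"
    by (rule C) (use assms in \<open>auto simp: \<rho>_def flow_start
        intro: trajectory_subset[OF assms(1)] trajectory_subset[OF flow_trajectory]\<close>)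
  then show ?thesis using assms by (simp add: flow_start)
qed

lemma flow_norm_le:
  assumes "0 \<le> s" "s \<le> t" "norm x \<le> \<rho>" "R \<le> \<rho>"
  shows "norm (flow V s t x) \<le> \<rho>"
  by (rule trajectory_norm_le[of s t]) (use assms in \<open>auto simp: flow_start intro: trajectory_subset[OF flow_trajectory]\<close>)

lemma flow_semigroup:
  assumes "0 \<le> s" "s \<le> r" "r \<le> t"
  shows "flow V r t (flow V s r x) = flow V s t x"
  by (rule trajectory_eq_flow[of r t, symmetric])
     (use assms in \<open>auto intro: trajectory_subset[OF flow_trajectory]\<close>)

lemma trajectory_increment:
  assumes traj: "trajectory V {a..b} \<xi>" and "a \<ge> 0" "a \<le> b" "norm (\<xi> a) \<le> \<rho>" "R \<le> \<rho>"
  shows "norm (\<xi> b - \<xi> a) \<le> (\<rho> + R) * (b - a)"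
proof -
  have "norm (\<xi> b - \<xi> a) \<le> (\<rho> + R) * norm (b - a)"
  proof (rule differentiable_bound[of "{a..b}" \<xi> "\<lambda>t h. h *\<^sub>R V t (\<xi> t)"])
    fix t assume t: "t \<in> {a..b}"
    then show "(\<xi> has_derivative (\<lambda>h. h *\<^sub>R V t (\<xi> t))) (at t within {a..b})"
      using traj by (auto simp: trajectory_def has_vector_derivative_def)
    have "norm (V t (\<xi> t)) \<le> \<rho> + R"
      using growth[of t "\<xi> t"] trajectory_norm_le[OF traj, of \<rho> t] assms t by auto
    then show "onorm (\<lambda>h. h *\<^sub>R V t (\<xi> t)) \<le> \<rho> + R"
      by (intro onorm_le) (simp add: mult.commute[of "\<rho> + R"] mult_left_mono)
  qed (use assms in auto)
  then show ?thesis using assms by simp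
qed

lemma flow_increment:
  assumes "0 \<le> s" "s \<le> t" "norm x \<le> \<rho>" "R \<le> \<rho>"
  shows "norm (flow V s t x - x) \<le> (\<rho> + R) * (t - s)"
  using trajectory_increment[of s t "\<lambda>t. flow V s t x" \<rho>] assms
    trajectory_subset[OF flow_trajectory, of s "{s..t}" x]
  by (auto simp: flow_start)

lemma flow_lipschitz:
  obtains C where "C \<ge> 0"
    "\<And>s t x y. 0 \<le> s \<Longrightarrow> s \<le> t \<Longrightarrow> t \<le> \<rho> \<Longrightarrow> norm x \<le> \<rho> \<Longrightarrow> norm y \<le> \<rho> \<Longrightarrow>
       norm (flow V s t x - flow V s t y) \<le> C * norm (x - y)"
proof -
  obtain C where C: "C \<ge> 0" "\<And>a b \<xi> \<eta>. 0 \<le> a \<Longrightarrow> a \<le> b \<Longrightarrow> b \<le> \<rho> \<Longrightarrow> trajectory V {a..b} \<xi> \<Longrightarrow> trajectory V {a..b} \<eta> \<Longrightarrow>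
       norm (\<xi> a) \<le> \<rho> \<Longrightarrow> norm (\<eta> a) \<le> \<rho> \<Longrightarrow> norm (\<xi> b - \<eta> b) \<le> C * norm (\<xi> a - \<eta> a)"
    using trajectory_lipschitz[of \<rho>] by metis
  show ?thesis
  proof (rule that[OF C(1)])
    fix s t and x y :: 'a assume *: "0 \<le> s" "s \<le> t" "t \<le> \<rho>" "norm x \<le> \<rho>" "norm y \<le> \<rho>"
    then show "norm (flow V s t x - flow V s t y) \<le> C * norm (x - y)"
      using C(2)[of s t "\<lambda>t. flow V s t x" "\<lambda>t. flow V s t y"]
        trajectory_subset[OF flow_trajectory, of s "{s..t}"]
      by (auto simp: flow_start)
  qed
qed

lemma flow_continuous_end: "continuous_on ({0..} \<times> UNIV) (\<lambda>(t, x). flow V 0 t x)"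
proof (rule continuous_on_prod_lipschitz)
  show "continuous_on {0..} (\<lambda>t. flow V 0 t x)" for x
    by (rule trajectory_continuous[OF flow_trajectory]) simp
  fix \<rho>
  obtain C where C: "C \<ge> 0" "\<And>s t x y. 0 \<le> s \<Longrightarrow> s \<le> t \<Longrightarrow> t \<le> \<rho> \<Longrightarrow> norm x \<le> \<rho> \<Longrightarrow> norm y \<le> \<rho> \<Longrightarrow>
       norm (flow V s t x - flow V s t y) \<le> C * norm (x - y)"
    using flow_lipschitz[of \<rho>] by metis
  show "\<exists>K\<ge>0. \<forall>t\<in>{0..} \<inter> cball 0 \<rho>. \<forall>x\<in>cball 0 \<rho>. \<forall>y\<in>cball 0 \<rho>.
      norm (flow V 0 t x - flow V 0 t y) \<le> K * norm (x - y)"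
    by (intro exI[of _ C] conjI ballI C) auto
qed

text \<open>A trajectory that starts at time \<open>s\<close> from \<open>x\<close> also starts at time \<open>t\<close> from \<open>flow V s t x\<close>,
and this point is at distance of order \<open>t - s\<close> from \<open>x\<close>.  So Lipschitz dependence on the
starting point yields Lipschitz dependence on the starting time.\<close>

lemma flow_continuous_start: "continuous_on ({0..b} \<times> UNIV) (\<lambda>(s, x). flow V s b x)"
proof (rule continuous_on_prod_lipschitz)
  fix x :: 'a and \<rho>
  define r where "r = max (max b \<rho>) (max R (norm x))"
  have r: "b \<le> r" "\<rho> \<le> r" "R \<le> r" "norm x \<le> r" "0 \<le> r"
    using R_pos by (auto simp: r_def)
  obtain C where C: "C \<ge> 0" "\<And>s t x y. 0 \<le> s \<Longrightarrow> s \<le> t \<Longrightarrow> t \<le> r \<Longrightarrow> norm x \<le> r \<Longrightarrow> norm y \<le> r \<Longrightarrow>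
       norm (flow V s t x - flow V s t y) \<le> C * norm (x - y)"
    using flow_lipschitz[of r] by metis
  have "(C * (r + R))-lipschitz_on {0..b} (\<lambda>s. flow V s b x)"
  proof (rule lipschitz_on_leI)
    fix s t assume st: "s \<in> {0..b}" "t \<in> {0..b}" "s \<le> t"
    have "norm (flow V t b (flow V s t x) - flow V t b x) \<le> C * norm (flow V s t x - x)"
      using st r by (intro C flow_norm_le) auto
    also have "\<dots> \<le> C * ((r + R) * (t - s))"
      using st r C(1) by (intro mult_left_mono flow_increment) auto
    finally show "dist (flow V s b x) (flow V t b x) \<le> C * (r + R) * dist s t"
      using st by (simp add: flow_semigroup dist_norm mult.assoc)
  qed (use C(1) r R_pos in auto)
  then show "continuous_on {0..b} (\<lambda>s. flow V s b x)" by (rule lipschitz_on_continuous_on)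
  show "\<exists>K\<ge>0. \<forall>s\<in>{0..b} \<inter> cball 0 \<rho>. \<forall>x\<in>cball 0 \<rho>. \<forall>y\<in>cball 0 \<rho>.
      norm (flow V s b x - flow V s b y) \<le> K * norm (x - y)"
    using r by (intro exI[of _ C] conjI ballI C) auto
qed

end

section \<open>Weak derivatives that are bounded above\<close>

text \<open>If \<open>\<Phi>\<close> is a primitive of a mollifier \<open>K\<close>, then \<open>\<phi> q = \<Phi> (q - s) - \<Phi> (q - t)\<close> is a smoothed
indicator function of the interval from \<open>s\<close> to \<open>t\<close>.  Integrating \<open>u\<close> against
\<open>deriv \<phi> q = K (q - s) - K (q - t)\<close> gives a smoothed version of \<open>u s - u t\<close>, while the integral
of \<open>v * \<phi>\<close> is at most \<open>c\<close> times the length of the support of \<open>\<phi>\<close>.  The case \<open>s = 0\<close> follows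
by continuity.\<close>

lemma weak_derivative_le_imp_increment_le:
  fixes u v :: "real \<Rightarrow> real"
  assumes weak: "weak_derivative_on {0<..} u v" and cont: "continuous_on {0..} u"
    and v: "AE t in lborel. t > 0 \<longrightarrow> v t \<le> c" and c: "c \<ge> 0"
    and st: "0 \<le> s" "s \<le> t"
  shows "u t - u s \<le> c * (t - s)"
proof -
  \<comment> \<open>extended by a constant, so that mollification makes sense everywhere\<close>
  define w where "w q = u (max 0 q)" for q
  have w: "continuous_on UNIV w"
    unfolding w_def by (intro continuous_on_compose2[OF cont] continuous_intros) auto
  have pos: "u t - u s \<le> c * (t - s) + e" if s: "0 < s" "s \<le> t" and e: "e > 0" for s t e
  proof -
    have near: "\<exists>d>0. \<forall>q. \<bar>q\<bar> < d \<longrightarrow> \<bar>w (p + q) - w p\<bar> < e / 4" for p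
    proof -
      have "isCont w p" using w by (simp add: continuous_on_eq_continuous_at)
      then obtain d where "d > 0" "\<And>q. dist q p < d \<Longrightarrow> dist (w q) (w p) < e / 4"
        using e by (metis continuous_at_eps_delta divide_pos_pos zero_less_numeral)
      then show ?thesis by (intro exI[of _ d]) (auto simp: dist_real_def)
    qed
    obtain d1 where d1: "d1 > 0" "\<And>q. \<bar>q\<bar> < d1 \<Longrightarrow> \<bar>w (s + q) - w s\<bar> < e / 4" using near by blast
    obtain d2 where d2: "d2 > 0" "\<And>q. \<bar>q\<bar> < d2 \<Longrightarrow> \<bar>w (t + q) - w t\<bar> < e / 4" using near by blast
    \<comment> \<open>\<open>\<epsilon> < s\<close> keeps the support of \<open>\<phi>\<close> in the open half-line\<close>
    define \<epsilon> where "\<epsilon> = min (min (d1 / 2) (d2 / 2)) (min (s / 2) (e / (4 * (c + 1))))"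
    have \<epsilon>: "\<epsilon> > 0" "\<epsilon> < d1" "\<epsilon> < d2" "\<epsilon> < s" "2 * c * \<epsilon> \<le> e / 2"
    proof -
      have "e / (4 * (c + 1)) > 0" using e c by simp
      then show "\<epsilon> > 0" unfolding \<epsilon>_def using d1 d2 s by simp
      have "\<epsilon> \<le> d1 / 2" "\<epsilon> \<le> d2 / 2" "\<epsilon> \<le> s / 2"
        unfolding \<epsilon>_def by (meson min.cobounded1 min.cobounded2 order_trans)+
      then show "\<epsilon> < d1" "\<epsilon> < d2" "\<epsilon> < s" using d1 d2 s by linarith+
      have "\<epsilon> \<le> e / (4 * (c + 1))"
        unfolding \<epsilon>_def by (meson min.cobounded1 min.cobounded2 order_trans)
      then have "2 * c * \<epsilon> \<le> 2 * c * (e / (4 * (c + 1)))" using c by (intro mult_left_mono) auto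
      also have "\<dots> \<le> e / 2" using c e by (simp add: field_simps)
      finally show "2 * c * \<epsilon> \<le> e / 2" .
    qed
    obtain K :: "real \<Rightarrow> real" where K: "\<And>k. Ck k K" "\<And>q. K q \<ge> 0" "\<And>q. K q \<noteq> 0 \<Longrightarrow> dist 0 q \<le> \<epsilon>"
      "integrable lborel K" "(\<integral>q. K q \<partial>lborel) = 1"
      using mollifier_exists[OF \<epsilon>(1), of 0] by metis
    have K0: "K q = 0" if "\<bar>q\<bar> > \<epsilon>" for q using K(3)[of q] that by auto
    have Kc: "continuous_on UNIV K" by (rule Ck_imp_continuous[OF K(1)])
    have Kb: "bounded {q. K q \<noteq> 0}"
      by (rule bounded_subset[of "cball 0 \<epsilon>"]) (use K(3) in auto)
    have "\<exists>\<Phi>. \<forall>x :: real. -\<infinity> < ereal x \<longrightarrow> ereal x < \<infinity> \<longrightarrow> (\<Phi> has_vector_derivative K x) (at x)"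
      using Kc by (intro einterval_antiderivative) (auto simp: continuous_on_eq_continuous_at)
    then obtain \<Phi> where \<Phi>: "\<And>x. (\<Phi> has_real_derivative K x) (at x)"
      by (auto simp: has_real_derivative_iff_has_vector_derivative)
    have mono: "\<Phi> x \<le> \<Phi> y" if "x \<le> y" for x y
      using that \<Phi> K(2) by (intro DERIV_nonneg_imp_nondecreasing[of x y \<Phi>]) auto
    have \<Phi>_int: "\<Phi> y - \<Phi> x \<le> 1" if "x \<le> y" for x y
    proof -
      have "(K has_integral (\<Phi> y - \<Phi> x)) {x..y}"
        using \<Phi> by (intro fundamental_theorem_of_calculus that)
          (auto simp: has_real_derivative_iff_has_vector_derivative intro: has_vector_derivative_at_within)
      moreover have "(K has_integral 1) UNIV"
        using has_integral_integral_lborel[OF K(4)] K(5) by simp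
      ultimately show ?thesis
        using K(2) by (intro has_integral_subset_le[of "{x..y}" UNIV K]) auto
    qed
    have const: "\<Phi> x = \<Phi> y" if "x \<le> y" "y \<le> - \<epsilon> \<or> \<epsilon> \<le> x" for x y
    proof (cases "x = y")
      case False
      with that have "x < y" by simp
      from MVT2[OF this, of \<Phi> K] \<Phi> obtain z where "x < z" "z < y" "\<Phi> y - \<Phi> x = (y - x) * K z"
        by blast
      then show ?thesis using K0[of z] that \<epsilon>(1) by auto
    qed simp
    define \<phi> where "\<phi> q = \<Phi> (q - s) - \<Phi> (q - t)" for q
    have \<phi>_deriv: "(\<phi> has_real_derivative K (q - s) - K (q - t)) (at q)" for q
      unfolding \<phi>_def by (auto intro!: derivative_eq_intros DERIV_chain2[OF \<Phi>])
    have \<phi>_range: "0 \<le> \<phi> q" "\<phi> q \<le> 1" for q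
      using mono[of "q - t" "q - s"] \<Phi>_int[of "q - t" "q - s"] s by (auto simp: \<phi>_def)
    have \<phi>_supp: "q \<in> {s - \<epsilon>..t + \<epsilon>}" if "\<phi> q \<noteq> 0" for q
    proof (rule ccontr)
      assume "q \<notin> {s - \<epsilon>..t + \<epsilon>}"
      then have "q - s \<le> - \<epsilon> \<or> \<epsilon> \<le> q - t" by auto
      then show False using const[of "q - t" "q - s"] that s by (simp add: \<phi>_def)
    qed
    have shift: "Ck k (\<lambda>q. K (q - a))" for k a
    proof -
      have "Ck k K \<Longrightarrow> Ck k (\<lambda>q. K (q - a))" for K :: "real \<Rightarrow> real"
      proof (induction k arbitrary: K)
        case 0
        then show ?case by (auto intro!: continuous_intros continuous_on_compose2[of UNIV K])
      next
        case (Suc k)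
        show ?case
        proof (rule Ck_SucI)
          show "((\<lambda>q. K (q - a)) has_derivative frechet_derivative K (at (q - a))) (at q)" for q
            by (rule has_derivative_compose[of "\<lambda>p. p - a" "\<lambda>v. v" q UNIV K, OF _ Ck_has_derivative[OF Suc.prems]])
               (auto intro!: derivative_eq_intros)
          show "Ck k (\<lambda>x. frechet_derivative K (at (x - a)) v)" for v
            using Suc.prems by (intro Suc.IH) auto
        qed
      qed
      then show ?thesis using K(1) by blast
    qed
    have \<phi>_Ck: "Ck k \<phi>" for k
    proof -
      have "Ck (Suc k) \<phi>"
        by (rule Ck_SucI[OF \<phi>_deriv[unfolded has_field_derivative_def]])
           (use Ck_mult[OF Ck_add[OF shift Ck_mult[OF Ck_const[of _ "-1"] shift]] Ck_const] in simp)
      then show ?thesis by (rule Ck_SucD)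
    qed
    have cl: "closure {q. \<phi> q \<noteq> 0} \<subseteq> {s - \<epsilon>..t + \<epsilon>}"
      by (rule closure_minimal) (use \<phi>_supp in auto)
    have "\<phi> \<in> test_functions {0<..}"
    proof -
      have "compact (closure {q. \<phi> q \<noteq> 0})"
        using cl by (intro compact_Int_closed[of "{s - \<epsilon>..t + \<epsilon>}" "closure {q. \<phi> q \<noteq> 0}", simplified Int_absorb1[OF cl]]) auto
      then show ?thesis using cl \<epsilon> \<phi>_Ck by (force simp: test_functions_def)
    qed
    then have weak_eq: "(LINT q:{0<..}|lborel. u q * deriv \<phi> q) = - (LINT q:{0<..}|lborel. v q * \<phi> q)"
      using weak by (simp add: weak_derivative_on_def)
    have wK: "integrable lborel (\<lambda>q. w q * K (q - a))" "(\<integral>q. w q * K (q - a) \<partial>lborel) = mollify w K a" for a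
    proof -
      have "integrable lborel (\<lambda>q. (\<lambda>q. w (a + q) * K q) (- a + 1 * q))"
        by (rule lborel_integrable_real_affine[OF integrable_mollify[OF w Kc Kb]]) simp
      then show "integrable lborel (\<lambda>q. w q * K (q - a))" by simp
      show "(\<integral>q. w q * K (q - a) \<partial>lborel) = mollify w K a"
        using lborel_integral_real_affine[of 1 "\<lambda>q. w q * K (q - a)" a] by (simp add: mollify_def)
    qed
    have "(LINT q:{0<..}|lborel. u q * deriv \<phi> q) = (\<integral>q. w q * K (q - s) - w q * K (q - t) \<partial>lborel)"
      unfolding set_lebesgue_integral_def
    proof (rule Bochner_Integration.integral_cong[OF refl])
      fix q
      show "indicat_real {0<..} q *\<^sub>R (u q * deriv \<phi> q) = w q * K (q - s) - w q * K (q - t)"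
        using K0[of "q - s"] K0[of "q - t"] s \<epsilon>
        by (cases "q > 0") (auto simp: DERIV_imp_deriv[OF \<phi>_deriv] w_def algebra_simps)
    qed
    also have "\<dots> = mollify w K s - mollify w K t"
      using wK by (simp add: Bochner_Integration.integral_diff)
    finally have lhs: "(LINT q:{0<..}|lborel. u q * deriv \<phi> q) = mollify w K s - mollify w K t" .
    have bnd: "(LINT q:{0<..}|lborel. v q * \<phi> q) \<le> c * (t - s + 2 * \<epsilon>)"
    proof (cases "set_integrable lborel {0<..} (\<lambda>q. v q * \<phi> q)")
      case True
      have "(LINT q:{0<..}|lborel. v q * \<phi> q) \<le> (\<integral>q. c * indicator {s - \<epsilon>..t + \<epsilon>} q \<partial>lborel)"
        unfolding set_lebesgue_integral_def
      proof (rule integral_mono_AE)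
        show "AE q in lborel. indicat_real {0<..} q *\<^sub>R (v q * \<phi> q) \<le> c * indicator {s - \<epsilon>..t + \<epsilon>} q"
          using v
        proof eventually_elim
          case (elim q)
          show ?case
          proof (cases "q > 0 \<and> \<phi> q \<noteq> 0")
            case True
            then have "v q * \<phi> q \<le> c * \<phi> q" using elim \<phi>_range by (intro mult_right_mono) auto
            also have "\<dots> \<le> c" using \<phi>_range c by (simp add: mult_left_le)
            finally show ?thesis using True \<phi>_supp[of q] by simp
          qed (use c in auto)
        qed
        show "integrable lborel (\<lambda>q. c * indicat_real {s - \<epsilon>..t + \<epsilon>} q)"
          using emeasure_bounded_finite[of "{s - \<epsilon>..t + \<epsilon>}"]
          by (intro integrable_mult_right integrable_real_indicator) auto
      qed (use True in \<open>simp add: set_integrable_def\<close>)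
      also have "\<dots> = c * (t - s + 2 * \<epsilon>)" using s \<epsilon> by simp
      finally show ?thesis .
    next
      case False
      \<comment> \<open>if \<open>v * \<phi>\<close> is not integrable, its Bochner integral is \<open>0\<close>\<close>
      then show ?thesis
        using c s \<epsilon> by (simp add: set_lebesgue_integral_def set_integrable_def not_integrable_integral_eq)
    qed
    have neard1: "\<bar>w (s + q) - w s\<bar> \<le> e / 4" and neard2: "\<bar>w (t + q) - w t\<bar> \<le> e / 4" if "K q \<noteq> 0" for q
      using K(3)[OF that] d1(2)[of q] d2(2)[of q] \<epsilon> by auto
    have "\<bar>mollify w K s - w s\<bar> \<le> e / 4"
      by (rule mollify_near[OF w Kc Kb K(2,5)]) (use neard1 in auto)
    moreover have "\<bar>mollify w K t - w t\<bar> \<le> e / 4"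
      by (rule mollify_near[OF w Kc Kb K(2,5)]) (use neard2 in auto)
    ultimately have "w t - w s \<le> c * (t - s + 2 * \<epsilon>) + e / 2"
      using lhs weak_eq bnd by linarith
    then show ?thesis using \<epsilon> s by (simp add: w_def algebra_simps)
  qed
  have pos': "u t - u s \<le> c * (t - s)" if "0 < s" "s \<le> t" for s t
    by (rule field_le_epsilon) (use pos[OF that] in auto)
  show ?thesis
  proof (cases "s = 0 \<and> t > 0")
    case True
    have "((\<lambda>s. u t - u s) \<longlongrightarrow> u t - u 0) (at_right 0)"
    proof (intro tendsto_intros)
      have "(u \<longlongrightarrow> u 0) (at 0 within {0..})" using cont by (simp add: continuous_on_def)
      then show "(u \<longlongrightarrow> u 0) (at_right 0)" by (rule tendsto_within_subset) auto
    qed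
    moreover have "((\<lambda>s. c * (t - s)) \<longlongrightarrow> c * (t - 0)) (at_right 0)"
      by (intro tendsto_intros)
    moreover have "\<forall>\<^sub>F s in at_right 0. u t - u s \<le> c * (t - s)"
      using True pos'[of _ t] by (auto simp: eventually_at_right_field intro!: exI[of _ t])
    ultimately have "u t - u 0 \<le> c * (t - 0)"
      by (intro tendsto_le[of "at_right (0 :: real)"]) auto
    with True show ?thesis by simp
  next
    case False
    then show ?thesis using pos'[of s t] st by (cases "s = 0") auto
  qed
qed

section \<open>Measures on a ball and their velocity fields\<close>

text \<open>By second countability the complement of the support is covered by countably many basic open
sets of measure zero.\<close>

lemma AE_in_msupport:
  fixes m :: "'a::second_countable_topology measure"
  assumes "sets m = sets borel"
  shows "AE x in m. x \<in> msupport m"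
proof -
  obtain \<B> :: "'a set set" where \<B>: "countable \<B>" "topological_basis \<B>"
    using ex_countable_basis by blast
  define N where "N = (\<Union>b\<in>{b\<in>\<B>. emeasure m b = 0}. b)"
  have "N \<in> null_sets m"
    unfolding N_def
    by (rule null_sets_UN') (use \<B> assms topological_basis_open[OF \<B>(2)] in \<open>auto simp: null_sets_def\<close>)
  moreover have "{x \<in> space m. x \<notin> msupport m} \<subseteq> N"
  proof
    fix x assume "x \<in> {x \<in> space m. x \<notin> msupport m}"
    then obtain U where U: "open U" "x \<in> U" "emeasure m U = 0"
      by (auto simp: msupport_def zero_less_iff_neq_zero)
    then obtain b where b: "b \<in> \<B>" "x \<in> b" "b \<subseteq> U"
      using topological_basisE[OF \<B>(2)] by metis
    have "emeasure m b \<le> emeasure m U"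
      using b U assms by (intro emeasure_mono) auto
    with U b show "x \<in> N" by (auto simp: N_def)
  qed
  ultimately show ?thesis by (rule AE_I')
qed

lemma msupport_subset_closed:
  assumes m: "sets m = sets borel" and K: "closed K" and AE: "AE x in m. x \<in> K"
  shows "msupport m \<subseteq> K"
proof
  fix x assume x: "x \<in> msupport m"
  show "x \<in> K"
  proof (rule ccontr)
    assume "x \<notin> K"
    then have "emeasure m (- K) > 0" using x K by (auto simp: msupport_def open_Compl)
    moreover have "emeasure m (- K) = 0"
      using AE m K sets_eq_imp_space_eq[OF m]
      by (subst (asm) AE_iff_measurable[of "- K"]) (auto simp: borel_open)
    ultimately show False by simp
  qed
qed

lemma prob_measuresD:
  assumes "m \<in> prob_measures"
  shows "prob_space m" "sets m = sets borel" "space m = UNIV"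
  using assms sets_eq_imp_space_eq[of m borel] by (auto simp: prob_measures_def)

lemma borel_measurable_prob_measures:
  "m \<in> prob_measures \<Longrightarrow> continuous_on UNIV f \<Longrightarrow> f \<in> borel_measurable m"
  using borel_measurable_continuous_onI measurable_cong_sets[OF prob_measuresD(2) refl] by blast

lemma norm_integral_le_AE:
  fixes f :: "'b \<Rightarrow> 'a::{banach, second_countable_topology}"
  assumes "AE x in m. norm (f x) \<le> g x" and "integrable m f" "integrable m g"
  shows "norm (\<integral>x. f x \<partial>m) \<le> (\<integral>x. g x \<partial>m)"
  by (rule order_trans[OF integral_norm_bound integral_mono_AE]) (use assms in auto)

lemma integrable_continuous_on_ball:
  fixes f :: "'a::euclidean_space \<Rightarrow> 'b::{banach, second_countable_topology}"
  assumes m: "m \<in> prob_measures" "AE x in m. x \<in> cball 0 R" and f: "continuous_on UNIV f"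
  shows "integrable m f"
proof -
  interpret prob_space m using m(1) by (rule prob_measuresD)
  have "compact (f ` cball 0 R)"
    by (intro compact_continuous_image continuous_on_subset[OF f]) auto
  then obtain B where B: "\<And>x. x \<in> cball 0 R \<Longrightarrow> norm (f x) \<le> B"
    using compact_imp_bounded bounded_iff by (metis imageI)
  show ?thesis
  proof (rule integrable_const_bound)
    show "AE x in m. norm (f x) \<le> B" using m(2) by eventually_elim (rule B)
    show "f \<in> borel_measurable m" using m(1) f by (rule borel_measurable_prob_measures)
  qed
qed

text \<open>The function \<open>f\<close> may be unbounded: composed with the projection onto the ball it becomes
bounded, and its integrals do not change.\<close>

lemma continuous_integral_narrow:
  fixes f :: "'a::euclidean_space \<Rightarrow> real"
  assumes M: "continuous_map (top_of_set I) narrow_topology M" "\<And>s. s \<in> I \<Longrightarrow> AE x in M s. x \<in> cball 0 R"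
    and f: "continuous_on UNIV f" and R: "R > 0"
  shows "continuous_on I (\<lambda>s. \<integral>x. f x \<partial>M s)"
proof -
  let ?p = "closest_point (cball 0 R :: 'a set)"
  have p: "continuous_on UNIV (\<lambda>x. f (?p x))"
    using R by (intro continuous_on_compose2[OF f] continuous_on_closest_point) auto
  have "compact (f ` cball 0 R)"
    by (intro compact_continuous_image continuous_on_subset[OF f]) auto
  moreover have "range (\<lambda>x. f (?p x)) \<subseteq> f ` cball 0 R"
    using closest_point_in_set[of "cball 0 R :: 'a set"] R by auto
  ultimately have "(\<lambda>x. f (?p x)) \<in> bounded_continuous"
    using p by (auto simp: bounded_continuous_def intro: bounded_subset compact_imp_bounded)
  then have "continuous_on I (\<lambda>s. \<integral>x. f (?p x) \<partial>M s)"
    using M(1) by (simp add: continuous_map_narrow_iff)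
  moreover have "(\<integral>x. f (?p x) \<partial>M s) = (\<integral>x. f x \<partial>M s)" if "s \<in> I" for s
  proof (rule integral_cong_AE)
    have "M s \<in> prob_measures" using M(1) that by (auto simp: continuous_map_narrow_iff)
    then show "f \<in> borel_measurable (M s)" "(\<lambda>x. f (?p x)) \<in> borel_measurable (M s)"
      using f p by (auto intro: borel_measurable_prob_measures)
    show "AE x in M s. f (?p x) = f x"
      using M(2)[OF that] by eventually_elim (simp add: closest_point_self)
  qed
  ultimately show ?thesis by (simp cong: continuous_on_cong)
qed

locale communication_weight =
  fixes \<psi> :: "real \<Rightarrow> real" and L :: real
  assumes weight_pos: "\<And>r. r \<ge> 0 \<Longrightarrow> \<psi> r > 0"
    and weight_antimono: "antimono_on {0..} \<psi>"
    and weight_lipschitz: "L-lipschitz_on {0..} \<psi>"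
    and weight_0: "\<psi> 0 = 1"
begin

lemma weight_le_1: "r \<ge> 0 \<Longrightarrow> \<psi> r \<le> 1"
  using monotone_onD[OF weight_antimono, of 0 r] weight_0 by simp

lemma L_nonneg: "L \<ge> 0"
  using weight_lipschitz by (rule lipschitz_on_nonneg)

lemma weight_continuous: "continuous_on UNIV (\<lambda>y. \<psi> (norm (x - y)))"
  by (intro continuous_on_compose2[OF lipschitz_on_continuous_on[OF weight_lipschitz]] continuous_intros) auto

lemma weight_diff_le: "\<bar>\<psi> (norm (x - y)) - \<psi> (norm (z - y))\<bar> \<le> L * norm (x - z)"
proof -
  have "\<bar>\<psi> (norm (x - y)) - \<psi> (norm (z - y))\<bar> \<le> L * \<bar>norm (x - y) - norm (z - y)\<bar>"
    using lipschitz_onD[OF weight_lipschitz, of "norm (x - y)" "norm (z - y)"] by (simp add: dist_real_def)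
  also have "\<dots> \<le> L * norm (x - z)"
    using norm_triangle_ineq3[of "x - y" "z - y"] L_nonneg by (intro mult_left_mono) auto
  finally show ?thesis .
qed

lemma force_continuous: "continuous_on UNIV (force \<psi> x)"
  unfolding force_def by (intro continuous_intros weight_continuous)

lemma norm_force_le: "norm (force \<psi> x y) \<le> \<psi> (norm (x - y)) * (norm x + norm y)"
  using weight_pos[of "norm (x - y)"] norm_triangle_ineq4[of y x]
  by (auto simp: force_def intro!: mult_left_mono)

lemma force_diff_le: "norm (force \<psi> x y - force \<psi> z y) \<le> (L * (norm x + norm y) + 1) * norm (x - z)"
proof -
  have "force \<psi> x y - force \<psi> z y =
      (\<psi> (norm (x - y)) - \<psi> (norm (z - y))) *\<^sub>R (y - x) + \<psi> (norm (z - y)) *\<^sub>R (z - x)"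
    by (simp add: force_def algebra_simps)
  also have "norm \<dots> \<le> \<bar>\<psi> (norm (x - y)) - \<psi> (norm (z - y))\<bar> * norm (y - x) + \<psi> (norm (z - y)) * norm (z - x)"
    using weight_pos[of "norm (z - y)"] by (intro order_trans[OF norm_triangle_ineq]) simp
  also have "\<dots> \<le> (L * norm (x - z)) * (norm x + norm y) + 1 * norm (x - z)"
    using weight_diff_le[of x y z] norm_triangle_ineq4[of y x] weight_le_1[of "norm (z - y)"] L_nonneg
    by (intro add_mono mult_mono) (auto simp: norm_minus_commute)
  finally show ?thesis by (simp add: algebra_simps)
qed

context
  fixes m :: "'a::euclidean_space measure" and R :: real
  assumes m: "m \<in> prob_measures" and supp: "AE y in m. y \<in> cball 0 R"
begin

interpretation prob_space m using m by (rule prob_measuresD)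

lemma force_integrable: "integrable m (force \<psi> x)"
  using m supp force_continuous by (rule integrable_continuous_on_ball)

lemma weight_integrable: "integrable m (\<lambda>y. \<psi> (norm (x - y)))"
  using m supp weight_continuous by (rule integrable_continuous_on_ball)

lemma weight_integral_le_1: "(\<integral>y. \<psi> (norm (x - y)) \<partial>m) \<le> 1"
  by (rule integral_le_const[OF weight_integrable]) (simp add: weight_le_1)

lemma weight_integral_ge: "norm x \<le> \<rho> \<Longrightarrow> \<psi> (\<rho> + R) \<le> (\<integral>y. \<psi> (norm (x - y)) \<partial>m)"
proof (rule integral_ge_const[OF weight_integrable])
  assume x: "norm x \<le> \<rho>"
  show "AE y in m. \<psi> (\<rho> + R) \<le> \<psi> (norm (x - y))"
    using supp
  proof eventually_elim
    case (elim y)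
    have "norm (x - y) \<le> \<rho> + R" using elim x norm_triangle_ineq4[of x y] by simp
    moreover from this have "0 \<le> \<rho> + R" using norm_ge_zero order_trans by blast
    ultimately show ?case by (intro monotone_onD[OF weight_antimono]) auto
  qed
qed

lemma weight_integral_diff_le:
  "\<bar>(\<integral>y. \<psi> (norm (x - y)) \<partial>m) - (\<integral>y. \<psi> (norm (z - y)) \<partial>m)\<bar> \<le> L * norm (x - z)"
proof -
  have "\<bar>\<integral>y. \<psi> (norm (x - y)) - \<psi> (norm (z - y)) \<partial>m\<bar> \<le> (\<integral>y. L * norm (x - z) \<partial>m)"
    by (rule integral_abs_bound_integral) (auto intro!: weight_integrable weight_diff_le)
  then show ?thesis by (simp add: weight_integrable prob_space)
qed

lemma norm_force_integral_le:
  "norm (\<integral>y. force \<psi> x y \<partial>m) \<le> (\<integral>y. \<psi> (norm (x - y)) \<partial>m) * (norm x + R)"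
proof -
  have "norm (\<integral>y. force \<psi> x y \<partial>m) \<le> (\<integral>y. \<psi> (norm (x - y)) * (norm x + R) \<partial>m)"
  proof (rule norm_integral_le_AE)
    show "AE y in m. norm (force \<psi> x y) \<le> \<psi> (norm (x - y)) * (norm x + R)"
      using supp
    proof eventually_elim
      case (elim y)
      then have "\<psi> (norm (x - y)) * (norm x + norm y) \<le> \<psi> (norm (x - y)) * (norm x + R)"
        using weight_pos[of "norm (x - y)"] by (intro mult_left_mono) auto
      then show ?case using norm_force_le[of x y] by linarith
    qed
  qed (auto intro!: force_integrable weight_integrable)
  then show ?thesis by (simp add: weight_integrable)
qed

lemma force_integral_diff_le:
  assumes "norm x \<le> \<rho>"
  shows "norm ((\<integral>y. force \<psi> x y \<partial>m) - (\<integral>y. force \<psi> z y \<partial>m)) \<le> (L * (\<rho> + R) + 1) * norm (x - z)"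
proof -
  have "norm (\<integral>y. force \<psi> x y - force \<psi> z y \<partial>m) \<le> (\<integral>y. (L * (\<rho> + R) + 1) * norm (x - z) \<partial>m)"
  proof (rule norm_integral_le_AE)
    show "AE y in m. norm (force \<psi> x y - force \<psi> z y) \<le> (L * (\<rho> + R) + 1) * norm (x - z)"
      using supp
    proof eventually_elim
      case (elim y)
      then have "(L * (norm x + norm y) + 1) * norm (x - z) \<le> (L * (\<rho> + R) + 1) * norm (x - z)"
        using assms L_nonneg by (intro mult_right_mono add_mono mult_left_mono) auto
      then show ?case using force_diff_le[of x y z] by linarith
    qed
  qed (auto intro!: force_integrable)
  then show ?thesis by (simp add: force_integrable prob_space)
qed

text \<open>The force that a point \<open>y\<close> of the ball exerts on a point \<open>x\<close> outside has a non-positive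
component along \<open>x\<close>, by the Cauchy-Schwarz inequality; averaging preserves the sign.\<close>

lemma force_integral_inward:
  assumes "norm x \<ge> R"
  shows "x \<bullet> (\<integral>y. force \<psi> x y \<partial>m) \<le> 0"
proof -
  have "x \<bullet> (\<integral>y. force \<psi> x y \<partial>m) = (\<integral>y. x \<bullet> force \<psi> x y \<partial>m)"
    by (rule integral_inner_right[symmetric]) (rule force_integrable)
  also have "\<dots> \<le> (\<integral>y. 0 \<partial>m)"
  proof (rule integral_mono_AE)
    show "AE y in m. x \<bullet> force \<psi> x y \<le> 0"
      using supp
    proof eventually_elim
      case (elim y)
      have "x \<bullet> y \<le> norm x * norm y" by (rule norm_cauchy_schwarz)
      also have "\<dots> \<le> norm x * norm x" using elim assms by (intro mult_left_mono) auto
      finally have "x \<bullet> (y - x) \<le> 0" by (simp add: inner_diff_right dot_square_norm power2_eq_square)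
      then show ?case
        using weight_pos[of "norm (x - y)"] by (auto simp: force_def intro: mult_nonneg_nonpos)
    qed
  qed (auto intro: force_integrable)
  finally show ?thesis by simp
qed

end

text \<open>Both velocity fields are quotients \<open>N / D\<close>, where \<open>N\<close> is the averaged force and \<open>D\<close> is \<open>1\<close> or
the averaged weight \<open>P\<close>.  In both cases \<open>P \<le> D\<close>, and \<open>P\<close> is bounded below on every ball by a
positive value of \<open>\<psi>\<close>.  Since \<open>norm (N t x) \<le> P t x * (norm x + R)\<close>, the quotient grows at
most linearly, and the Lipschitz estimates of \<open>N\<close> and \<open>D\<close> pass to it.  Continuity in time is
narrow continuity of the delayed curve of measures.\<close>

theorem delayed_velocity_confining:
  fixes F :: "'a::euclidean_space measure \<Rightarrow> 'a \<Rightarrow> 'a"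
  assumes F: "F = velocity_A \<psi> \<or> F = velocity_B \<psi>" and R: "R > 0"
    and \<sigma>: "continuous_on {0..} \<sigma>" "\<And>t. t \<ge> 0 \<Longrightarrow> \<sigma> t \<in> I"
    and M: "continuous_map (top_of_set I) narrow_topology M"
    and supp: "\<And>s. s \<in> I \<Longrightarrow> AE x in M s. x \<in> cball 0 R"
  shows "confining_field (\<lambda>t. F (M (\<sigma> t))) R"
proof -
  define N where "N t x = (\<integral>y. force \<psi> x y \<partial>M (\<sigma> t))" for t x
  define P where "P t x = (\<integral>y. \<psi> (norm (x - y)) \<partial>M (\<sigma> t))" for t x
  define D where "D t x = (if F = velocity_A \<psi> then 1 else P t x)" for t x
  have FN: "F (M (\<sigma> t)) x = N t x /\<^sub>R D t x" for t x
    using F by (auto simp: velocity_A_def velocity_B_def N_def D_def P_def)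
  have prob: "M (\<sigma> t) \<in> prob_measures" and AE: "AE x in M (\<sigma> t). x \<in> cball 0 R" if "t \<ge> 0" for t
    using M \<sigma>(2)[OF that] supp by (auto simp: continuous_map_narrow_iff)
  note * = prob AE
  have P_pos: "P t x > 0" if "t \<ge> 0" for t x
    using weight_integral_ge[OF *, OF that that, of x "norm x"] weight_pos[of "norm x + R"] R
    by (simp add: P_def)
  have PD: "P t x \<le> D t x" if "t \<ge> 0" for t x
    using weight_integral_le_1[OF *, OF that that, of x] by (simp add: D_def P_def)
  have D_pos: "D t x > 0" if "t \<ge> 0" for t x
    using P_pos[OF that] PD[OF that] less_le_trans by blast
  have N_le: "norm (N t x) \<le> D t x * (norm x + R)" if "t \<ge> 0" for t x
  proof -
    have "norm (N t x) \<le> P t x * (norm x + R)"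
      using norm_force_integral_le[OF *, OF that that, of x] by (simp add: N_def P_def)
    also have "\<dots> \<le> D t x * (norm x + R)" using PD[OF that] R by (intro mult_right_mono) auto
    finally show ?thesis .
  qed
  have lip: "\<exists>K\<ge>0. \<forall>t\<ge>0. \<forall>x\<in>cball 0 \<rho>. \<forall>y\<in>cball 0 \<rho>.
      norm (F (M (\<sigma> t)) x - F (M (\<sigma> t)) y) \<le> K * norm (x - y)" for \<rho>
  proof (cases "\<rho> \<ge> 0")
    case True
    define p where "p = \<psi> (\<rho> + R)"
    have p: "p > 0" unfolding p_def using True R by (intro weight_pos) auto
    define K where "K = (L * (\<rho> + R) + 1) / p + (\<rho> + R) * L / p"
    have "K \<ge> 0" using True R p L_nonneg by (simp add: K_def)
    moreover have "norm (F (M (\<sigma> t)) x - F (M (\<sigma> t)) y) \<le> K * norm (x - y)"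
      if t: "t \<ge> 0" and x: "norm x \<le> \<rho>" and y: "norm y \<le> \<rho>" for t x y
    proof -
      have Dx: "D t x \<ge> p"
        using PD[OF t, of x] weight_integral_ge[OF *, OF t t x] by (simp add: P_def p_def)
      have Ddiff: "\<bar>D t y - D t x\<bar> \<le> L * norm (x - y)"
        using weight_integral_diff_le[OF *, OF t t, of y x] L_nonneg
        by (simp add: D_def P_def norm_minus_commute)
      have "N t x /\<^sub>R D t x - N t y /\<^sub>R D t y =
          (N t x - N t y) /\<^sub>R D t x + (inverse (D t x) - inverse (D t y)) *\<^sub>R N t y"
        by (simp only: scaleR_diff_left scaleR_diff_right) simp
      also have "inverse (D t x) - inverse (D t y) = (D t y - D t x) / (D t x * D t y)"
        using D_pos[OF t, of x] D_pos[OF t, of y] by (simp add: field_simps)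
      also have "norm ((N t x - N t y) /\<^sub>R D t x + ((D t y - D t x) / (D t x * D t y)) *\<^sub>R N t y)
          \<le> norm (N t x - N t y) / D t x + \<bar>D t y - D t x\<bar> / (D t x * D t y) * norm (N t y)"
        using D_pos[OF t, of x] D_pos[OF t, of y]
        by (intro order_trans[OF norm_triangle_ineq]) (simp add: abs_mult divide_inverse mult_ac)
      also have "\<dots> \<le> ((L * (\<rho> + R) + 1) * norm (x - y)) / p + (\<rho> + R) * (L * norm (x - y)) / p"
      proof (rule add_mono)
        show "norm (N t x - N t y) / D t x \<le> ((L * (\<rho> + R) + 1) * norm (x - y)) / p"
          using force_integral_diff_le[OF *, OF t t x, of y] Dx p
          by (intro frac_le) (auto simp: N_def intro: order_trans[OF norm_ge_zero])
        have "norm (N t y) \<le> D t y * (\<rho> + R)"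
          using N_le[OF t, of y] D_pos[OF t, of y] y
          by (smt (verit) mult_left_mono)
        then have "\<bar>D t y - D t x\<bar> / (D t x * D t y) * norm (N t y) \<le>
            \<bar>D t y - D t x\<bar> / (D t x * D t y) * (D t y * (\<rho> + R))"
          using D_pos[OF t, of x] D_pos[OF t, of y] by (intro mult_left_mono) auto
        also have "\<dots> = (\<rho> + R) * \<bar>D t y - D t x\<bar> / D t x"
          using D_pos[OF t, of y] by simp
        also have "\<dots> \<le> (\<rho> + R) * (L * norm (x - y)) / p"
          using Ddiff Dx p True R L_nonneg by (intro frac_le mult_left_mono mult_nonneg_nonneg) auto
        finally show "\<bar>D t y - D t x\<bar> / (D t x * D t y) * norm (N t y) \<le> (\<rho> + R) * (L * norm (x - y)) / p" .
      qed
      also have "\<dots> = K * norm (x - y)" unfolding K_def by (simp only: distrib_right times_divide_eq_left mult.assoc)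
      finally show ?thesis by (simp add: FN)
    qed
    ultimately show ?thesis by (intro exI[of _ K]) auto
  qed (auto intro!: exI[of _ 0])
  have cont: "continuous_on {0..} (\<lambda>t. F (M (\<sigma> t)) x)" for x
  proof -
    have int: "continuous_on {0..} (\<lambda>t. \<integral>y. h y \<partial>M (\<sigma> t))" if "continuous_on UNIV h" for h :: "'a \<Rightarrow> real"
      by (rule continuous_on_compose2[OF continuous_integral_narrow[OF M supp that R] \<sigma>(1)]) (use \<sigma>(2) in auto)
    have "continuous_on {0..} (\<lambda>t. N t x \<bullet> b)" for b
    proof -
      have "continuous_on {0..} (\<lambda>t. \<integral>y. force \<psi> x y \<bullet> b \<partial>M (\<sigma> t))"
        by (intro int continuous_intros force_continuous)
      moreover have "(\<integral>y. force \<psi> x y \<bullet> b \<partial>M (\<sigma> t)) = N t x \<bullet> b" if "t \<ge> 0" for t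
        unfolding N_def by (rule integral_inner_left) (rule force_integrable[OF *, OF that that])
      ultimately show ?thesis by (rule continuous_on_eq) auto
    qed
    then have "continuous_on {0..} (\<lambda>t. N t x)" by (intro continuous_on_componentwise[THEN iffD2]) auto
    moreover have "continuous_on {0..} (\<lambda>t. D t x)"
      unfolding D_def P_def using int[OF weight_continuous] by (cases "F = velocity_A \<psi>") auto
    ultimately show ?thesis
      unfolding FN using D_pos by (intro continuous_intros) (auto simp: less_imp_neq[symmetric])
  qed
  show ?thesis
  proof
    show "continuous_on ({0..} \<times> UNIV) (\<lambda>(t, x). F (M (\<sigma> t)) x)"
    proof (rule continuous_on_prod_lipschitz[OF cont])
      fix \<rho>
      from lip[of \<rho>] show "\<exists>K\<ge>0. \<forall>t\<in>{0..} \<inter> cball 0 \<rho>. \<forall>x\<in>cball 0 \<rho>. \<forall>y\<in>cball 0 \<rho>.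
          norm (F (M (\<sigma> t)) x - F (M (\<sigma> t)) y) \<le> K * norm (x - y)"
        by (elim ex_forward conj_forward) auto
    qed
    show "x \<bullet> F (M (\<sigma> t)) x \<le> 0" if "t \<ge> 0" "R \<le> norm x" for t x
      using force_integral_inward[OF *, OF that(1) that(1) that(2)] D_pos[OF that(1), of x]
      by (simp add: FN N_def mult_nonneg_nonpos divide_nonpos_pos)
    show "norm (F (M (\<sigma> t)) x) \<le> norm x + R" if "t \<ge> 0" for t x
      using N_le[OF that, of x] D_pos[OF that, of x] by (simp add: FN field_simps)
  qed (use R lip in auto)
qed

end

section \<open>Weak solutions of linear continuity equations\<close>

text \<open>The transport operator is the derivative of \<open>\<phi>\<close> in the space-time direction \<open>(V x, 1)\<close>.\<close>

lemma transport_integrand_eq_derivative: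
  fixes \<phi> :: "'a::euclidean_space \<times> real \<Rightarrow> real"
  assumes "\<phi> differentiable at (x, t)"
  shows "transport_integrand V \<phi> t x = frechet_derivative \<phi> (at (x, t)) (V x, 1)"
proof -
  let ?D = "frechet_derivative \<phi> (at (x, t))"
  have D: "(\<phi> has_derivative ?D) (at (x, t))" using assms frechet_derivative_works by blast
  interpret D: bounded_linear ?D using D by (rule has_derivative_bounded_linear)
  have "((\<lambda>s. \<phi> (x, s)) has_derivative (\<lambda>h. ?D (0, h))) (at t)"
    by (rule has_derivative_compose[of "\<lambda>s. (x, s)" "\<lambda>h. (0, h)" t UNIV \<phi>, OF _ D])
       (auto intro!: derivative_eq_intros)
  moreover have "(\<lambda>h. ?D (0, h)) = (*) (?D (0, 1))"
  proof
    fix h show "?D (0, h) = ?D (0, 1) * h" using D.scaleR[of h "(0, 1)"] by (simp add: mult.commute)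
  qed
  ultimately have "((\<lambda>s. \<phi> (x, s)) has_real_derivative ?D (0, 1)) (at t)"
    by (simp add: has_field_derivative_def)
  then have 1: "deriv (\<lambda>s. \<phi> (x, s)) t = ?D (0, 1)" by (rule DERIV_imp_deriv)
  have "((\<lambda>y. \<phi> (y, t)) has_derivative (\<lambda>v. ?D (v, 0))) (at x)"
    by (rule has_derivative_compose[of "\<lambda>y. (y, t)" "\<lambda>v. (v, 0)" x UNIV \<phi>, OF _ D])
       (auto intro!: derivative_eq_intros)
  then have 2: "frechet_derivative (\<lambda>y. \<phi> (y, t)) (at x) = (\<lambda>v. ?D (v, 0))"
    by (rule frechet_derivative_at[symmetric])
  have "V x \<bullet> grad (\<lambda>y. \<phi> (y, t)) x = (\<Sum>b\<in>Basis. (V x \<bullet> b) *\<^sub>R ?D (b, 0))"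
    by (simp add: grad_def 2 inner_sum_right mult.commute)
  also have "\<dots> = (\<Sum>b\<in>Basis. ?D ((V x \<bullet> b) *\<^sub>R b, 0))"
  proof (rule sum.cong)
    show "(V x \<bullet> b) *\<^sub>R ?D (b, 0) = ?D ((V x \<bullet> b) *\<^sub>R b, 0)" for b
      using D.scaleR[of "V x \<bullet> b" "(b, 0)"] by simp
  qed simp
  also have "\<dots> = ?D (\<Sum>b\<in>Basis. ((V x \<bullet> b) *\<^sub>R b, 0))" by (simp add: D.sum)
  also have "(\<Sum>b\<in>Basis. ((V x \<bullet> b) *\<^sub>R b, 0)) = (V x, 0 :: real)"
    by (simp add: prod_eq_iff fst_sum snd_sum euclidean_representation)
  finally show ?thesis
    using D.add[of "(0, 1)" "(V x, 0)"] by (simp add: transport_integrand_def 1)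
qed

text \<open>The functions \<open>max 0 (1 - n * infdist x C)\<close> decrease to the indicator function of a compact
set \<open>C\<close>, and compact sets form an intersection-stable generator of the Borel sets.\<close>

lemma measure_eqI_lipschitz_bounded_support:
  fixes m m' :: "'a::euclidean_space measure"
  assumes m: "m \<in> prob_measures" and m': "m' \<in> prob_measures"
    and eq: "\<And>f L r. L-lipschitz_on UNIV f \<Longrightarrow> (\<And>x. norm x > r \<Longrightarrow> f x = 0) \<Longrightarrow> (\<integral>x. f x \<partial>m) = (\<integral>x. f x \<partial>m' :: real)"
  shows "m = m'"
proof (rule measure_eqI_generator_eq)
  show "Int_stable (Collect compact :: 'a set set)" by (auto simp: Int_stable_def)
  show "Collect compact \<subseteq> Pow (UNIV :: 'a set)" by auto
  have "sets (borel :: 'a measure) = sigma_sets UNIV (Collect closed)"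
    by (subst borel_eq_closed) simp
  also have "\<dots> = sigma_sets UNIV (Collect compact)"
  proof (rule sigma_sets_eqI)
    fix C :: "'a set" assume "C \<in> Collect closed"
    then have "compact (C \<inter> cball 0 (real n))" for n by (auto simp: closed_Int_compact)
    then have "(\<Union>n. C \<inter> cball 0 (real n)) \<in> sigma_sets UNIV (Collect compact)"
      by (intro sigma_sets.Union) auto
    moreover have "(\<Union>n. C \<inter> cball 0 (real n)) = C"
      using real_arch_simple by auto
    ultimately show "C \<in> sigma_sets UNIV (Collect compact)" by simp
  next
    fix C :: "'a set" assume "C \<in> Collect compact"
    then show "C \<in> sigma_sets UNIV (Collect closed)" by (auto intro: compact_imp_closed)
  qed
  finally have sets: "sets (borel :: 'a measure) = sigma_sets UNIV (Collect compact)" .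
  then show "sets m = sigma_sets UNIV (Collect compact)" "sets m' = sigma_sets UNIV (Collect compact)"
    using prob_measuresD(2)[OF m] prob_measuresD(2)[OF m'] by auto
  show "range (\<lambda>n. cball (0 :: 'a) (real n)) \<subseteq> Collect compact" by auto
  show "(\<Union>n. cball (0 :: 'a) (real n)) = UNIV" using real_arch_simple by auto
  interpret m: prob_space m using m by (rule prob_measuresD)
  interpret m': prob_space m' using m' by (rule prob_measuresD)
  show "emeasure m (cball 0 (real n)) \<noteq> \<infinity>" for n by simp
  fix C :: "'a set" assume "C \<in> Collect compact"
  then have C: "compact C" by simp
  show "emeasure m C = emeasure m' C"
  proof (cases "C = {}")
    case False
    define f where "f n x = max 0 (1 - real (Suc n) * infdist x C)" for n x
    have f_cont: "continuous_on UNIV (f n)" for n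
      unfolding f_def by (intro continuous_intros)
    have lim: "(\<lambda>n. f n x) \<longlonglongrightarrow> indicator C x" for x
    proof (cases "x \<in> C")
      case True
      then show ?thesis by (simp add: f_def infdist_zero)
    next
      case x: False
      then have pos: "infdist x C > 0"
        using in_closed_iff_infdist_zero[OF compact_imp_closed[OF C] False] infdist_nonneg[of x C] by fastforce
      obtain N where "1 / infdist x C \<le> real N" using real_arch_simple by blast
      then have "f n x = 0" if "n \<ge> N" for n
      proof -
        have "1 / infdist x C \<le> real (Suc n)" using that \<open>1 / infdist x C \<le> real N\<close> by simp
        then show ?thesis using pos by (simp add: f_def field_simps)
      qed
      then have "\<forall>\<^sub>F n in sequentially. f n x = indicator C x"
        using x by (auto simp: eventually_sequentially)
      then show ?thesis by (rule tendsto_eventually)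
    qed
    have conv: "(\<lambda>n. \<integral>x. f n x \<partial>\<mu>) \<longlonglongrightarrow> measure \<mu> C" if "\<mu> \<in> prob_measures" for \<mu>
    proof -
      interpret prob_space \<mu> using that by (rule prob_measuresD)
      have "(\<lambda>n. \<integral>x. f n x \<partial>\<mu>) \<longlonglongrightarrow> (\<integral>x. indicator C x \<partial>\<mu>)"
      proof (rule integral_dominated_convergence[where w = "\<lambda>_. 1"])
        show "AE x in \<mu>. norm (f n x) \<le> 1" for n
          using infdist_nonneg[of _ C] by (auto simp: f_def)
      qed (use lim C that in \<open>auto intro!: borel_measurable_prob_measures f_cont borel_measurable_indicator
            simp: prob_measuresD(2)[OF that] compact_imp_closed\<close>)
      then show ?thesis
        using C that by (simp add: prob_measuresD compact_imp_closed)
    qed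
    have "(\<integral>x. f n x \<partial>m) = (\<integral>x. f n x \<partial>m')" for n
    proof -
      obtain r where r: "\<And>x. x \<in> C \<Longrightarrow> norm x \<le> r"
        using compact_imp_bounded[OF C] bounded_iff by metis
      show ?thesis
      proof (rule eq)
        show "(real (Suc n))-lipschitz_on UNIV (f n)"
        proof (rule lipschitz_onI)
          fix x y :: 'a
          have "\<bar>f n x - f n y\<bar> \<le> \<bar>real (Suc n) * infdist x C - real (Suc n) * infdist y C\<bar>"
            by (auto simp: f_def)
          also have "\<dots> = real (Suc n) * \<bar>infdist x C - infdist y C\<bar>"
            by (simp only: right_diff_distrib[symmetric] abs_mult abs_of_nat)
          also have "\<dots> \<le> real (Suc n) * dist x y"
            by (intro mult_left_mono infdist_triangle_abs) auto
          finally show "dist (f n x) (f n y) \<le> real (Suc n) * dist x y" by (simp add: dist_real_def)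
        qed simp
        show "f n x = 0" if "norm x > r + 1" for x
        proof -
          obtain y where y: "y \<in> C" "infdist x C = dist x y"
            using infdist_attains_inf[OF compact_imp_closed[OF C] False] by metis
          have "dist x y \<ge> 1"
            using r[OF y(1)] that norm_triangle_ineq2[of x y] by (simp add: dist_norm)
          then have "real (Suc n) * dist x y \<ge> 1 * 1" by (intro mult_mono) auto
          then show ?thesis using y by (simp add: f_def)
        qed
      qed
    qed
    then have "measure m C = measure m' C"
      using conv[OF m] conv[OF m'] LIMSEQ_unique by auto
    then show ?thesis by (simp add: m.emeasure_eq_measure m'.emeasure_eq_measure)
  qed simp
qed

lemma uniformly_continuous_bounded_support:
  fixes W :: "'a::euclidean_space \<Rightarrow> real"
  assumes W: "continuous_on UNIV W" and supp: "\<And>q. norm q > r \<Longrightarrow> W q = 0" and e: "e > 0"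
  obtains d where "d > 0" "\<And>p q. dist p q < d \<Longrightarrow> \<bar>W p - W q\<bar> < e"
proof -
  have "uniformly_continuous_on (cball 0 (r + 1)) W"
    by (intro compact_uniformly_continuous continuous_on_subset[OF W]) auto
  then obtain d where d: "d > 0"
    "\<And>p q. p \<in> cball 0 (r + 1) \<Longrightarrow> q \<in> cball 0 (r + 1) \<Longrightarrow> dist p q < d \<Longrightarrow> dist (W p) (W q) < e"
    using e unfolding uniformly_continuous_on_def by metis
  show ?thesis
  proof (rule that[of "min d 1"])
    fix p q :: 'a assume pq: "dist p q < min d 1"
    show "\<bar>W p - W q\<bar> < e"
    proof (cases "norm p \<le> r \<or> norm q \<le> r")
      case True
      then have "norm p \<le> r + 1" "norm q \<le> r + 1"
        using pq norm_triangle_ineq2[of p q] norm_triangle_ineq2[of q p]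
        by (auto simp: dist_norm norm_minus_commute)
      then show ?thesis using d(2)[of p q] pq by (auto simp: dist_real_def)
    qed (use supp[of p] supp[of q] e in auto)
  qed (use d in auto)
qed

lemma bounded_continuousI_bounded_support:
  fixes W :: "'a::euclidean_space \<Rightarrow> real"
  assumes W: "continuous_on UNIV W" and supp: "\<And>q. norm q > r \<Longrightarrow> W q = 0"
  obtains B where "B \<ge> 0" "\<And>q. \<bar>W q\<bar> \<le> B"
proof -
  have "compact (W ` cball 0 r)"
    by (intro compact_continuous_image continuous_on_subset[OF W]) auto
  then obtain B where B: "\<And>q. q \<in> cball 0 r \<Longrightarrow> \<bar>W q\<bar> \<le> B"
    using compact_imp_bounded bounded_iff by (metis imageI real_norm_def)
  show ?thesis
  proof (rule that[of "max 0 B"])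
    show "\<bar>W q\<bar> \<le> max 0 B" for q
      using B[of q] supp[of q] by (cases "norm q \<le> r") auto
  qed auto
qed

lemma integrable_bounded_continuous:
  fixes f :: "'a::euclidean_space \<Rightarrow> real"
  assumes "m \<in> prob_measures" "continuous_on UNIV f" "\<And>x. \<bar>f x\<bar> \<le> B"
  shows "integrable m f"
proof -
  interpret prob_space m using assms(1) by (rule prob_measuresD)
  show ?thesis
    by (rule integrable_const_bound[of _ B]) (use assms in \<open>auto intro: borel_measurable_prob_measures\<close>)
qed

lemma continuous_slice:
  assumes "continuous_on UNIV (G :: 'a::topological_space \<times> 'b::topological_space \<Rightarrow> 'c::topological_space)"
  shows "continuous_on A (\<lambda>x. G (x, t))"
  by (rule continuous_on_compose2[OF assms]) (auto intro!: continuous_intros)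

lemma continuous_integral_slices:
  fixes G :: "'a::euclidean_space \<times> real \<Rightarrow> real"
  assumes \<nu>: "continuous_map (top_of_set I) narrow_topology \<nu>"
    and G: "continuous_on UNIV G" and supp: "\<And>q. norm q > r \<Longrightarrow> G q = 0"
  shows "continuous_on I (\<lambda>t. \<integral>x. G (x, t) \<partial>\<nu> t)"
  unfolding continuous_on_iff
proof (intro ballI allI impI)
  fix s and e :: real assume s: "s \<in> I" and e: "e > 0"
  obtain B where B: "\<And>q. \<bar>G q\<bar> \<le> B" using bounded_continuousI_bounded_support[OF G supp] by metis
  have prob: "\<nu> t \<in> prob_measures" if "t \<in> I" for t
    using \<nu> that by (auto simp: continuous_map_narrow_iff)
  have int: "integrable (\<nu> t) (\<lambda>x. G (x, u))" if "t \<in> I" for t u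
    by (rule integrable_bounded_continuous[OF prob[OF that] continuous_slice[OF G] B])
  have "(\<lambda>x. G (x, s)) \<in> bounded_continuous"
    using B by (auto simp: bounded_continuous_def bounded_iff intro: continuous_slice[OF G])
  then have "continuous_on I (\<lambda>t. \<integral>x. G (x, s) \<partial>\<nu> t)"
    using \<nu> by (simp add: continuous_map_narrow_iff)
  then obtain d1 where d1: "d1 > 0" "\<And>t. t \<in> I \<Longrightarrow> dist t s < d1 \<Longrightarrow>
      dist (\<integral>x. G (x, s) \<partial>\<nu> t) (\<integral>x. G (x, s) \<partial>\<nu> s) < e / 2"
    unfolding continuous_on_iff using s e half_gt_zero by metis
  obtain d2 where d2: "d2 > 0" "\<And>p q. dist p q < d2 \<Longrightarrow> \<bar>G p - G q\<bar> < e / 2"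
    using uniformly_continuous_bounded_support[OF G supp half_gt_zero[OF e]] by metis
  show "\<exists>d>0. \<forall>t\<in>I. dist t s < d \<longrightarrow> dist (\<integral>x. G (x, t) \<partial>\<nu> t) (\<integral>x. G (x, s) \<partial>\<nu> s) < e"
  proof (intro exI[of _ "min d1 d2"] conjI ballI impI)
    fix t assume t: "t \<in> I" "dist t s < min d1 d2"
    interpret prob_space "\<nu> t" using prob[OF t(1)] by (rule prob_measuresD)
    have "\<bar>\<integral>x. G (x, t) - G (x, s) \<partial>\<nu> t\<bar> \<le> (\<integral>x. e / 2 \<partial>\<nu> t)"
      using t d2(2)[of "(_, t)" "(_, s)"]
      by (intro integral_abs_bound_integral Bochner_Integration.integrable_diff int less_imp_le) (auto simp: dist_Pair_Pair)
    then have "dist (\<integral>x. G (x, t) \<partial>\<nu> t) (\<integral>x. G (x, s) \<partial>\<nu> t) \<le> e / 2"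
      using int[OF t(1)] by (simp add: dist_real_def prob_space)
    then show "dist (\<integral>x. G (x, t) \<partial>\<nu> t) (\<integral>x. G (x, s) \<partial>\<nu> s) < e"
      using d1(2)[of t] t dist_triangle[of "\<integral>x. G (x, t) \<partial>\<nu> t" "\<integral>x. G (x, s) \<partial>\<nu> s" "\<integral>x. G (x, s) \<partial>\<nu> t"]
      by simp
  qed (use d1 d2 in auto)
qed

text \<open>Only test functions that vanish from the time \<open>S\<close> on are admitted, so that the field matters
only before that time.\<close>

definition weak_transport_solution ::
    "real \<Rightarrow> real \<Rightarrow> (real \<Rightarrow> 'a::euclidean_space \<Rightarrow> 'a) \<Rightarrow> (real \<Rightarrow> 'a measure) \<Rightarrow> bool" where
  "weak_transport_solution T S V \<nu> \<longleftrightarrow> (\<forall>\<phi>\<in>test_functions (UNIV \<times> {..<S}).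
     (AE t in lborel. t \<in> {0..<T} \<longrightarrow> integrable (\<nu> t) (transport_integrand (V t) \<phi> t)) \<and>
     set_integrable lborel {0..<T} (\<lambda>t. \<integral>x. transport_integrand (V t) \<phi> t x \<partial>\<nu> t) \<and>
     (LINT t:{0..<T}|lborel. (\<integral>x. transport_integrand (V t) \<phi> t x \<partial>\<nu> t)) + (\<integral>x. \<phi> (x, 0) \<partial>\<nu> 0) = 0)"

text \<open>The weak formulation extends from smooth test functions to functions \<open>W\<close> that only have a
derivative \<open>G\<close> along the field, in the uniform sense of the assumption \<open>lagrangian\<close>.

Let \<open>\<phi>\<close> be a mollification of \<open>W\<close>.  A difference quotient of \<open>\<phi>\<close> at \<open>(x, t)\<close> in the
direction \<open>(V t x, 1)\<close> is an average of difference quotients of \<open>W\<close> at nearby points \<open>(y, r)\<close>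
in the same direction, which is not the direction of the field at \<open>(y, r)\<close>.  The assumption
says that even so they are close to \<open>G (x, t)\<close>.  Hence the transport operator applied to \<open>\<phi>\<close>
is uniformly close to \<open>G\<close>, and no derivative of \<open>V\<close> or \<open>W\<close> ever appears.  Since the kernel
looks only forward in time, the values of \<open>\<phi>\<close> at non-negative times involve \<open>W\<close> at such times
only, and \<open>\<phi>\<close> vanishes after time \<open>b\<close> as \<open>W\<close> does.\<close>

lemma weak_formulation_lagrangian:
  fixes W G :: "'a::euclidean_space \<times> real \<Rightarrow> real" and V :: "real \<Rightarrow> 'a \<Rightarrow> 'a"
  assumes T: "T > 0" "b < S"
    and \<nu>: "continuous_map (top_of_set {0..<T}) narrow_topology \<nu>"
    and weak: "weak_transport_solution T S V \<nu>"
    and W: "continuous_on UNIV W" "\<And>q. norm q > r \<Longrightarrow> W q = 0" "\<And>x t. t > b \<Longrightarrow> W (x, t) = 0"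
    and G: "continuous_on UNIV G" "\<And>q. norm q > r \<Longrightarrow> G q = 0"
    and lagrangian: "\<And>\<eta>. \<eta> > 0 \<Longrightarrow> \<exists>\<delta>>0. \<forall>x t y r h. 0 \<le> t \<longrightarrow> norm (y - x) < \<delta> \<longrightarrow> t \<le> r \<longrightarrow> r < t + \<delta> \<longrightarrow>
        0 < h \<longrightarrow> h < \<delta> \<longrightarrow> \<bar>W (y + h *\<^sub>R V t x, r + h) - W (y, r) - h * G (x, t)\<bar> \<le> \<eta> * h"
  shows "set_integrable lborel {0..<T} (\<lambda>t. \<integral>x. G (x, t) \<partial>\<nu> t)"
    and "(LINT t:{0..<T}|lborel. (\<integral>x. G (x, t) \<partial>\<nu> t)) + (\<integral>x. W (x, 0) \<partial>\<nu> 0) = 0"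
proof -
  have prob: "\<nu> t \<in> prob_measures" if "t \<in> {0..<T}" for t
    using \<nu> that by (auto simp: continuous_map_narrow_iff)
  obtain BG where BG: "BG \<ge> 0" "\<And>q. \<bar>G q\<bar> \<le> BG" using bounded_continuousI_bounded_support[OF G] by metis
  obtain BW where BW: "\<And>q. \<bar>W q\<bar> \<le> BW" using bounded_continuousI_bounded_support[OF W(1,2)] by metis
  let ?g = "\<lambda>t. \<integral>x. G (x, t) \<partial>\<nu> t"
  have g_int: "integrable (\<nu> t) (\<lambda>x. G (x, t))" if "t \<in> {0..<T}" for t
    by (rule integrable_bounded_continuous[OF prob[OF that] continuous_slice[OF G(1)] BG(2)])
  show g: "set_integrable lborel {0..<T} ?g"
  proof (rule set_integrable_bound)
    show "set_integrable lborel {0..<T} (\<lambda>t. BG)"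
      unfolding set_integrable_def using emeasure_bounded_finite[of "{0..<T}"]
      by (intro integrable_scaleR_left integrable_real_indicator) auto
    have "set_borel_measurable borel {0..<T} ?g"
      unfolding set_borel_measurable_def
      by (rule borel_measurable_continuous_on_indicator[OF _ continuous_integral_slices[OF \<nu> G]]) auto
    then show "set_borel_measurable lborel {0..<T} ?g" by (simp add: set_borel_measurable_def)
    show "AE t in lborel. t \<in> {0..<T} \<longrightarrow> norm (?g t) \<le> norm BG"
    proof (intro AE_I2 impI)
      fix t assume t: "t \<in> {0..<T}"
      interpret prob_space "\<nu> t" using prob[OF t] by (rule prob_measuresD)
      have "\<bar>?g t\<bar> \<le> (\<integral>x. BG \<partial>\<nu> t)"
        by (rule integral_abs_bound_integral[OF g_int[OF t]]) (use BG in auto)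
      then show "norm (?g t) \<le> norm BG" by (simp add: prob_space)
    qed
  qed
  have approx: "\<bar>(LINT t:{0..<T}|lborel. ?g t) + (\<integral>x. W (x, 0) \<partial>\<nu> 0)\<bar> \<le> \<eta> * (T + 1)" if \<eta>: "\<eta> > 0" for \<eta>
  proof -
    obtain \<delta> where \<delta>: "\<delta> > 0" "\<And>x t y r h. 0 \<le> t \<Longrightarrow> norm (y - x) < \<delta> \<Longrightarrow> t \<le> r \<Longrightarrow> r < t + \<delta> \<Longrightarrow>
        0 < h \<Longrightarrow> h < \<delta> \<Longrightarrow> \<bar>W (y + h *\<^sub>R V t x, r + h) - W (y, r) - h * G (x, t)\<bar> \<le> \<eta> * h"
      using lagrangian[OF \<eta>] by blast
    obtain d where d: "d > 0" "\<And>p q. dist p q < d \<Longrightarrow> \<bar>W p - W q\<bar> < \<eta>"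
      using uniformly_continuous_bounded_support[OF W(1,2) \<eta>] by metis
    \<comment> \<open>the kernel below is supported in the ball of radius \<open>2 * \<epsilon>\<close> about the origin\<close>
    define \<epsilon> where "\<epsilon> = min \<delta> d / 3"
    have \<epsilon>: "\<epsilon> > 0" "2 * \<epsilon> < \<delta>" "2 * \<epsilon> < d" using \<delta> d by (auto simp: \<epsilon>_def min_def)
    obtain K :: "'a \<times> real \<Rightarrow> real" where K: "\<And>k. Ck k K" "\<And>q. K q \<ge> 0"
      "\<And>q. K q \<noteq> 0 \<Longrightarrow> dist (0, \<epsilon>) q \<le> \<epsilon>" "integrable lborel K" "(\<integral>q. K q \<partial>lborel) = 1"
      using mollifier_exists[OF \<epsilon>(1), of "(0, \<epsilon>)"] by metis
    have Kc: "continuous_on UNIV K" by (rule Ck_imp_continuous[OF K(1)])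
    have Kb: "bounded {q. K q \<noteq> 0}"
      by (rule bounded_subset[of "cball (0, \<epsilon>) \<epsilon>"]) (use K(3) in auto)
    have Kq: "norm q \<le> 2 * \<epsilon>" "norm (fst q) \<le> \<epsilon>" "0 \<le> snd q" "snd q \<le> 2 * \<epsilon>" if "K q \<noteq> 0" for q
    proof -
      have "dist (0, \<epsilon>) q \<le> \<epsilon>" using K(3) that .
      then show "norm q \<le> 2 * \<epsilon>" "norm (fst q) \<le> \<epsilon>" "0 \<le> snd q" "snd q \<le> 2 * \<epsilon>"
        using norm_triangle_ineq2[of q "(0, \<epsilon>)"] dist_fst_le[of "(0, \<epsilon>)" q] dist_snd_le[of "(0, \<epsilon>)" q] \<epsilon>
        by (auto simp: dist_norm norm_minus_commute)
    qed
    define \<phi> where "\<phi> = mollify W K"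
    obtain lo hi where box: "cball (0 :: 'a \<times> real) r \<subseteq> cbox lo hi"
      using bounded_subset_cbox_symmetric[OF bounded_cball] by metis
    have \<phi>_Ck: "Ck k \<phi>" for k
      unfolding \<phi>_def
      by (rule Ck_mollify[OF W(1) _ K(1), of lo hi]) (use box W(2) in \<open>meson linorder_not_less mem_cball_0 subsetD\<close>)
    have \<phi>_nz: "\<exists>q. K q \<noteq> 0 \<and> W (p + q) \<noteq> 0" if "\<phi> p \<noteq> 0" for p
    proof (rule ccontr)
      assume "\<not> ?thesis"
      then have "W (p + q) * K q = 0" for q by fastforce
      then have "(\<lambda>q. W (p + q) * K q) = (\<lambda>q. 0)" by blast
      then show False using that by (simp add: \<phi>_def mollify_def)
    qed
    have supp: "{p. \<phi> p \<noteq> 0} \<subseteq> cball 0 (r + 2 * \<epsilon>) \<inter> UNIV \<times> {..b}"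
    proof
      fix p assume "p \<in> {p. \<phi> p \<noteq> 0}"
      then obtain q where q: "K q \<noteq> 0" "W (p + q) \<noteq> 0" using \<phi>_nz by blast
      have "norm (p + q) \<le> r" using q(2) W(2) by (meson linorder_not_less)
      then have "norm p \<le> r + 2 * \<epsilon>" using Kq(1)[OF q(1)] norm_triangle_ineq4[of "p + q" q] by simp
      moreover have "snd (p + q) \<le> b" using q(2) W(3)[of "snd (p + q)" "fst (p + q)"] by (metis linorder_not_less prod.collapse)
      then have "snd p \<le> b" using Kq(3)[OF q(1)] by simp
      ultimately show "p \<in> cball 0 (r + 2 * \<epsilon>) \<inter> UNIV \<times> {..b}" by (auto simp: mem_Times_iff)
    qed
    have "closure {p. \<phi> p \<noteq> 0} \<subseteq> cball 0 (r + 2 * \<epsilon>) \<inter> UNIV \<times> {..b}"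
      by (rule closure_minimal[OF supp]) (intro closed_Int closed_Times closed_cball closed_UNIV closed_atMost)
    then have "compact (closure {p. \<phi> p \<noteq> 0})" "closure {p. \<phi> p \<noteq> 0} \<subseteq> UNIV \<times> {..<S}"
      using T(2) by (auto simp: compact_eq_bounded_closed intro: bounded_subset[OF bounded_cball])
    then have \<phi>: "\<phi> \<in> test_functions (UNIV \<times> {..<S})"
      using \<phi>_Ck by (simp add: test_functions_def)
    have Wdiff: "\<bar>W (p + q) - W p\<bar> \<le> \<eta>" if "K q \<noteq> 0" for p q
      using d(2)[of "p + q" p] Kq(1)[OF that] \<epsilon> by (simp add: dist_norm less_imp_le)
    have \<phi>_near: "\<bar>\<phi> p - W p\<bar> \<le> \<eta>" for p
      unfolding \<phi>_def by (rule mollify_near[OF W(1) Kc Kb K(2,5) Wdiff])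
    have deriv_near: "\<bar>transport_integrand (V t) \<phi> t x - G (x, t)\<bar> \<le> \<eta>" if t: "t \<ge> 0" for t x
    proof -
      let ?p = "(x, t)" and ?v = "(V t x, 1 :: real)"
      have \<phi>D: "(\<phi> has_derivative frechet_derivative \<phi> (at ?p)) (at ?p)"
        using \<phi>_Ck[of "Suc 0"] by (rule Ck_has_derivative)
      \<comment> \<open>the difference quotients for positive \<open>h\<close> determine the derivative\<close>
      have quot: "\<bar>(\<phi> (?p + h *\<^sub>R ?v) - \<phi> ?p) / h - G (x, t)\<bar> \<le> \<eta>" if h: "0 < h" "h < \<delta>" for h
      proof -
        let ?W' = "\<lambda>q. W (q + h *\<^sub>R ?v) - W q"
        have W': "continuous_on UNIV ?W'"
          by (intro continuous_intros continuous_on_compose2[OF W(1)]) auto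
        have "mollify ?W' K ?p = \<phi> (?p + h *\<^sub>R ?v) - \<phi> ?p"
          using integrable_mollify[OF W(1) Kc Kb, of "?p + h *\<^sub>R ?v"] integrable_mollify[OF W(1) Kc Kb, of ?p]
          by (simp add: mollify_def \<phi>_def left_diff_distrib add_ac flip: Bochner_Integration.integral_diff)
        moreover have "\<bar>mollify ?W' K ?p - h * G (x, t)\<bar> \<le> \<eta> * h"
        proof (rule mollify_near[OF W' Kc Kb K(2,5)])
          fix q assume q: "K q \<noteq> 0"
          have "\<bar>W (x + fst q + h *\<^sub>R V t x, t + snd q + h) - W (x + fst q, t + snd q) - h * G (x, t)\<bar> \<le> \<eta> * h"
            using Kq[OF q] \<epsilon> t h by (intro \<delta>(2)) auto
          then show "\<bar>?W' (?p + q) - h * G (x, t)\<bar> \<le> \<eta> * h"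
            by (cases q) (simp add: add_ac)
        qed
        ultimately have "\<bar>\<phi> (?p + h *\<^sub>R ?v) - \<phi> ?p - h * G (x, t)\<bar> / h \<le> \<eta>"
          using h by (simp add: field_simps)
        moreover have "(\<phi> (?p + h *\<^sub>R ?v) - \<phi> ?p) / h - G (x, t) = (\<phi> (?p + h *\<^sub>R ?v) - \<phi> ?p - h * G (x, t)) / h"
          using h by (simp add: field_simps)
        ultimately show ?thesis using h by simp
      qed
      have "((\<lambda>h. \<phi> (?p + h *\<^sub>R ?v)) has_derivative (\<lambda>h. frechet_derivative \<phi> (at ?p) (h *\<^sub>R ?v))) (at 0)"
        by (rule has_derivative_compose[of "\<lambda>h. ?p + h *\<^sub>R ?v" "\<lambda>h. h *\<^sub>R ?v" 0 UNIV \<phi>])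
           (use \<phi>D in \<open>auto intro!: derivative_eq_intros simp: zero_prod_def[symmetric]\<close>)
      then have "((\<lambda>h. \<phi> (?p + h *\<^sub>R ?v)) has_real_derivative frechet_derivative \<phi> (at ?p) ?v) (at 0)"
        unfolding has_field_derivative_def
        by (rule has_derivative_eq_rhs)
           (use linear_scale[OF has_derivative_linear[OF \<phi>D], of _ ?v] in \<open>auto simp: fun_eq_iff\<close>)
      then have "((\<lambda>h. (\<phi> (?p + h *\<^sub>R ?v) - \<phi> ?p) / h) \<longlongrightarrow> frechet_derivative \<phi> (at ?p) ?v) (at_right 0)"
        unfolding DERIV_def by (auto intro: tendsto_within_subset simp: zero_prod_def[symmetric])
      then have "((\<lambda>h. \<bar>(\<phi> (?p + h *\<^sub>R ?v) - \<phi> ?p) / h - G (x, t)\<bar>) \<longlongrightarrow>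
          \<bar>frechet_derivative \<phi> (at ?p) ?v - G (x, t)\<bar>) (at_right 0)"
        by (intro tendsto_intros)
      moreover have "\<forall>\<^sub>F h in at_right 0. \<bar>(\<phi> (?p + h *\<^sub>R ?v) - \<phi> ?p) / h - G (x, t)\<bar> \<le> \<eta>"
        unfolding eventually_at_right_field using quot \<delta>(1) by blast
      ultimately have "\<bar>frechet_derivative \<phi> (at ?p) ?v - G (x, t)\<bar> \<le> \<eta>"
        by (rule tendsto_upperbound) simp
      then show ?thesis
        using transport_integrand_eq_derivative[of \<phi> x t "V t", OF differentiableI[OF \<phi>D]] by simp
    qed
    let ?f = "\<lambda>t. \<integral>x. transport_integrand (V t) \<phi> t x \<partial>\<nu> t"
    have f: "AE t in lborel. t \<in> {0..<T} \<longrightarrow> integrable (\<nu> t) (transport_integrand (V t) \<phi> t)"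
      "set_integrable lborel {0..<T} ?f" "(LINT t:{0..<T}|lborel. ?f t) + (\<integral>x. \<phi> (x, 0) \<partial>\<nu> 0) = 0"
      using weak \<phi> by (auto simp: weak_transport_solution_def)
    have "\<bar>(LINT t:{0..<T}|lborel. ?f t - ?g t)\<bar> \<le> (LINT t:{0..<T}|lborel. \<eta>)"
      unfolding set_lebesgue_integral_def real_norm_def[symmetric]
    proof (rule norm_integral_le_AE)
      show "AE t in lborel. norm (indicat_real {0..<T} t *\<^sub>R (?f t - ?g t)) \<le> indicat_real {0..<T} t *\<^sub>R \<eta>"
        using f(1)
      proof eventually_elim
        case (elim t)
        show ?case
        proof (cases "t \<in> {0..<T}")
          case True
          interpret prob_space "\<nu> t" using prob[OF True] by (rule prob_measuresD)
          have "\<bar>\<integral>x. transport_integrand (V t) \<phi> t x - G (x, t) \<partial>\<nu> t\<bar> \<le> (\<integral>x. \<eta> \<partial>\<nu> t)"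
            using True elim deriv_near g_int by (intro integral_abs_bound_integral) auto
          then show ?thesis using True elim g_int by (simp add: prob_space)
        qed simp
      qed
      show "integrable lborel (\<lambda>t. indicat_real {0..<T} t *\<^sub>R (?f t - ?g t))"
        using set_integral_diff(1)[OF f(2) g] by (simp add: set_integrable_def)
      show "integrable lborel (\<lambda>t. indicat_real {0..<T} t *\<^sub>R \<eta>)"
        using emeasure_bounded_finite[of "{0..<T}"]
        by (intro integrable_scaleR_left integrable_real_indicator) auto
    qed
    also have "\<dots> = \<eta> * T" using T by (simp add: set_lebesgue_integral_def)
    finally have 1: "\<bar>(LINT t:{0..<T}|lborel. ?f t) - (LINT t:{0..<T}|lborel. ?g t)\<bar> \<le> \<eta> * T"
      using f(2) g by simp
    have 0: "0 \<in> {0..<T}" using T by simp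
    interpret prob_space "\<nu> 0" using prob[OF 0] by (rule prob_measuresD)
    have W_int: "integrable (\<nu> 0) (\<lambda>x. W (x, 0))"
      by (rule integrable_bounded_continuous[OF prob[OF 0] continuous_slice[OF W(1)] BW])
    have \<phi>_int: "integrable (\<nu> 0) (\<lambda>x. \<phi> (x, 0))"
    proof (rule integrable_bounded_continuous[OF prob[OF 0] continuous_slice[OF Ck_imp_continuous[OF \<phi>_Ck]]])
      show "\<bar>\<phi> (x, 0)\<bar> \<le> BW + \<eta>" for x using \<phi>_near[of "(x, 0)"] BW[of "(x, 0)"] by linarith
    qed
    have "\<bar>\<integral>x. \<phi> (x, 0) - W (x, 0) \<partial>\<nu> 0\<bar> \<le> (\<integral>x. \<eta> \<partial>\<nu> 0)"
      by (rule integral_abs_bound_integral) (use W_int \<phi>_int \<phi>_near in auto)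
    then have "\<bar>(\<integral>x. \<phi> (x, 0) \<partial>\<nu> 0) - (\<integral>x. W (x, 0) \<partial>\<nu> 0)\<bar> \<le> \<eta>"
      using W_int \<phi>_int by (simp add: prob_space)
    with 1 f(3) show ?thesis by (simp add: distrib_left)
  qed
  show "(LINT t:{0..<T}|lborel. ?g t) + (\<integral>x. W (x, 0) \<partial>\<nu> 0) = 0"
  proof (rule ccontr)
    assume "\<not> ?thesis"
    then have pos: "\<bar>(LINT t:{0..<T}|lborel. ?g t) + (\<integral>x. W (x, 0) \<partial>\<nu> 0)\<bar> > 0" (is "?a > 0") by simp
    have "?a \<le> (?a / (2 * (T + 1))) * (T + 1)" by (rule approx) (use pos T in auto)
    also have "(?a / (2 * (T + 1))) * (T + 1) = ?a / 2" using T by (simp add: field_simps)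
    finally show False using pos by simp
  qed
qed

lemma C1_increment:
  fixes \<zeta> \<rho> :: "real \<Rightarrow> real"
  assumes "\<And>t. t \<ge> 0 \<Longrightarrow> (\<zeta> has_real_derivative (- \<rho> t)) (at t within {0..})" and "0 \<le> r" "h > 0"
  obtains s where "r < s" "s < r + h" "\<zeta> (r + h) - \<zeta> r = - (h * \<rho> s)"
proof -
  have "\<exists>s\<in>{r<..<r + h}. \<zeta> (r + h) - \<zeta> r = - \<rho> s * (r + h - r)"
  proof (rule mvt_simple)
    fix s assume "r \<le> s" "s \<le> r + h"
    then have "(\<zeta> has_real_derivative (- \<rho> s)) (at s within {r..r + h})"
      using assms by (intro has_field_derivative_subset[OF assms(1)]) auto
    then show "(\<zeta> has_derivative (\<lambda>x. - \<rho> s * x)) (at s within {r..r + h})"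
      by (simp only: has_field_derivative_def)
  qed (use assms in auto)
  then show ?thesis using that by (auto simp: mult.commute)
qed

lemma bounded_on_halfline:
  fixes f :: "real \<Rightarrow> real"
  assumes f: "continuous_on {0..} f" and zero: "\<And>t. t \<ge> b \<Longrightarrow> f t = 0"
  shows "\<exists>M\<ge>0. \<forall>t\<ge>0. \<bar>f t\<bar> \<le> M"
proof -
  have "compact (f ` {0..b})"
    by (intro compact_continuous_image continuous_on_subset[OF f]) auto
  then obtain M where M: "\<And>t. t \<in> {0..b} \<Longrightarrow> \<bar>f t\<bar> \<le> M"
    using compact_imp_bounded bounded_iff by (metis imageI real_norm_def)
  have "\<bar>f t\<bar> \<le> max 0 M" if "0 \<le> t" for t
    using M[of t] zero[of t] that by (cases "t \<le> b") auto
  then show ?thesis by (intro exI[of _ "max 0 M"]) auto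
qed

lemma slab_modulus:
  fixes f :: "real \<Rightarrow> 'a::euclidean_space \<Rightarrow> 'b::metric_space"
  assumes "continuous_on ({0..c} \<times> cball 0 r) (\<lambda>(t, x). f t x)" and "e > 0"
  shows "\<exists>d>0. \<forall>s t x y. s \<in> {0..c} \<longrightarrow> t \<in> {0..c} \<longrightarrow> norm x \<le> r \<longrightarrow> norm y \<le> r \<longrightarrow>
      \<bar>s - t\<bar> + norm (x - y) < d \<longrightarrow> dist (f s x) (f t y) < e"
proof -
  have "uniformly_continuous_on ({0..c} \<times> cball 0 r) (\<lambda>(t, x). f t x)"
    by (intro compact_uniformly_continuous assms compact_Times) auto
  then obtain d where d: "d > 0" "\<And>p q. p \<in> {0..c} \<times> cball 0 r \<Longrightarrow> q \<in> {0..c} \<times> cball 0 r \<Longrightarrow>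
      dist p q < d \<Longrightarrow> dist (case p of (t, x) \<Rightarrow> f t x) (case q of (t, x) \<Rightarrow> f t x) < e"
    using assms(2) unfolding uniformly_continuous_on_def by metis
  have "dist (f s x) (f t y) < e" if "s \<in> {0..c}" "t \<in> {0..c}" "norm x \<le> r" "norm y \<le> r"
    "\<bar>s - t\<bar> + norm (x - y) < d" for s t x y
  proof -
    have "dist (s, x) (t, y) \<le> \<bar>s - t\<bar> + norm (x - y)"
      using sqrt_sum_squares_le_sum_abs[of "s - t" "norm (x - y)"] by (simp add: dist_Pair_Pair dist_real_def dist_norm[of x y])
    then show ?thesis using d(2)[of "(s, x)" "(t, y)"] that by simp
  qed
  then show ?thesis using d(1) by blast
qed

context confining_field
begin

text \<open>The solution of the backward transport equation with final value \<open>f\<close> at time \<open>b\<close>: it is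
constant along the trajectories of \<open>V\<close> during the interval from \<open>0\<close> to \<open>b\<close>.  Clamping the time
makes it continuous on the whole of space-time.\<close>

definition transported :: "real \<Rightarrow> ('a \<Rightarrow> real) \<Rightarrow> 'a \<times> real \<Rightarrow> real" where
  "transported b f = (\<lambda>(x, t). f (flow V (max 0 (min t b)) b x))"

lemma transported_continuous:
  assumes "b \<ge> 0" and f: "continuous_on UNIV f"
  shows "continuous_on UNIV (transported b f)"
proof -
  have "continuous_on UNIV (\<lambda>q::'a \<times> real. (max 0 (min (snd q) b), fst q))"
    by (intro continuous_intros)
  moreover have "(\<lambda>q::'a \<times> real. (max 0 (min (snd q) b), fst q)) ` UNIV \<subseteq> {0..b} \<times> UNIV"
    using assms by auto
  ultimately have "continuous_on UNIV (\<lambda>q::'a \<times> real. case (max 0 (min (snd q) b), fst q) of (s, x) \<Rightarrow> flow V s b x)"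
    by (rule continuous_on_compose2[OF flow_continuous_start])
  then have "continuous_on UNIV (\<lambda>q::'a \<times> real. f (flow V (max 0 (min (snd q) b)) b (fst q)))"
    by (intro continuous_on_compose2[OF f]) auto
  then show ?thesis by (simp add: transported_def split_beta)
qed

lemma transported_support:
  assumes "b \<ge> 0" and f: "\<And>x. norm x > r \<Longrightarrow> f x = 0"
  obtains B where "B \<ge> 0" "\<And>x t. norm x > B \<Longrightarrow> transported b f (x, t) = 0"
proof (rule that[of "exp (2 * b) * (\<bar>r\<bar> + R)"])
  fix x :: 'a and t assume x: "norm x > exp (2 * b) * (\<bar>r\<bar> + R)"
  define s where "s = max 0 (min t b)"
  have s: "0 \<le> s" "s \<le> b" using assms by (auto simp: s_def)
  have "(norm (flow V s s x))\<^sup>2 \<le> exp (4 * (b - s)) * ((norm (flow V s b x))\<^sup>2 + R\<^sup>2)"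
    by (rule trajectory_backward_bound[OF trajectory_subset[OF flow_trajectory]])
       (use s growth in auto)
  also have "\<dots> \<le> exp (4 * b) * ((norm (flow V s b x))\<^sup>2 + R\<^sup>2)"
    using s by (intro mult_right_mono) auto
  finally have *: "(norm x)\<^sup>2 \<le> exp (4 * b) * ((norm (flow V s b x))\<^sup>2 + R\<^sup>2)"
    using s by (simp add: flow_start)
  have "norm (flow V s b x) > r"
  proof (rule ccontr)
    assume "\<not> norm (flow V s b x) > r"
    then have "(norm (flow V s b x))\<^sup>2 \<le> \<bar>r\<bar>\<^sup>2" by (intro power_mono) auto
    then have "(norm (flow V s b x))\<^sup>2 + R\<^sup>2 \<le> (\<bar>r\<bar> + R)\<^sup>2"
    proof -
      have "2 * \<bar>r\<bar> * R \<ge> 0" using R_pos by simp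
      then show ?thesis using \<open>(norm (flow V s b x))\<^sup>2 \<le> \<bar>r\<bar>\<^sup>2\<close> unfolding power2_sum by linarith
    qed
    then have "exp (4 * b) * ((norm (flow V s b x))\<^sup>2 + R\<^sup>2) \<le> exp (4 * b) * (\<bar>r\<bar> + R)\<^sup>2"
      by (intro mult_left_mono) auto
    also have "\<dots> = (exp (2 * b) * (\<bar>r\<bar> + R))\<^sup>2"
      by (simp add: power_mult_distrib power2_eq_square mult_exp_exp)
    finally have "(norm x)\<^sup>2 \<le> (exp (2 * b) * (\<bar>r\<bar> + R))\<^sup>2" using * by linarith
    then have "norm x \<le> exp (2 * b) * (\<bar>r\<bar> + R)"
      by (rule power2_le_imp_le) (use R_pos in auto)
    then show False using x by simp
  qed
  then show "transported b f (x, t) = 0" using f by (simp add: transported_def s_def)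
qed (use R_pos in auto)

text \<open>Along a trajectory only the time factor \<open>\<zeta>\<close> of the product varies, which gives the derivative
\<open>- \<rho>\<close> times the transported function.  The increment in question is taken along the straight
segment in the direction \<open>V t x\<close> instead.  Over a time \<open>h\<close> the segment deviates from the
trajectory that starts at the same point by at most \<open>h\<close> times the oscillation of \<open>V\<close> near
\<open>(t, x)\<close>, and the transported function is Lipschitz in space, so the error is \<open>h\<close> times a small
constant.  Everything is uniform because the product vanishes outside a compact set.\<close>

lemma transported_lagrangian:
  fixes \<zeta> \<rho> :: "real \<Rightarrow> real"
  assumes b: "b \<ge> 0" and f: "Lf-lipschitz_on UNIV f" "\<And>x. norm x > r0 \<Longrightarrow> f x = 0"
    and \<rho>: "continuous_on UNIV \<rho>" "\<And>t. t \<ge> b \<Longrightarrow> \<rho> t = 0"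
    and \<zeta>: "\<And>t. t \<ge> 0 \<Longrightarrow> (\<zeta> has_real_derivative (- \<rho> t)) (at t within {0..})" "\<And>t. t \<ge> b \<Longrightarrow> \<zeta> t = 0"
    and \<eta>: "\<eta> > 0"
  shows "\<exists>\<delta>>0. \<forall>x t y r h. 0 \<le> t \<longrightarrow> norm (y - x) < \<delta> \<longrightarrow> t \<le> r \<longrightarrow> r < t + \<delta> \<longrightarrow> 0 < h \<longrightarrow> h < \<delta> \<longrightarrow>
    \<bar>\<zeta> (r + h) * transported b f (y + h *\<^sub>R V t x, r + h) - \<zeta> r * transported b f (y, r)
      - h * (- \<rho> t * transported b f (x, t))\<bar> \<le> \<eta> * h"
proof -
  let ?w = "transported b f"
  have f_cont: "continuous_on UNIV f" using f(1) by (rule lipschitz_on_continuous_on)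
  have w_cont: "continuous_on UNIV ?w" using b f_cont by (rule transported_continuous)
  obtain B where B: "B \<ge> 0" "\<And>x t. norm x > B \<Longrightarrow> ?w (x, t) = 0"
    by (rule transported_support[where f = f and r = r0, OF b], erule f(2)) (rule that)
  \<comment> \<open>a radius that contains all points and trajectories considered below, and a bound for the times\<close>
  define r1 where "r1 = max b (max R (B + 4))"
  have r1: "b \<le> r1" "R \<le> r1" "B + 4 \<le> r1" "r1 > 0" using B by (auto simp: r1_def)
  obtain C where C: "C \<ge> 0" "\<And>s t x y. 0 \<le> s \<Longrightarrow> s \<le> t \<Longrightarrow> t \<le> r1 \<Longrightarrow> norm x \<le> r1 \<Longrightarrow> norm y \<le> r1 \<Longrightarrow>
      norm (flow V s t x - flow V s t y) \<le> C * norm (x - y)"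
    by (rule flow_lipschitz[of r1]) (rule that)
  obtain Mf where Mf: "Mf \<ge> 0" "\<And>x. \<bar>f x\<bar> \<le> Mf"
    by (rule bounded_continuousI_bounded_support[OF f_cont], erule f(2)) (rule that)
  have w_bound: "\<bar>?w q\<bar> \<le> Mf" for q using Mf(2) by (cases q) (simp add: transported_def)
  have \<zeta>_cont: "continuous_on {0..} \<zeta>"
    using \<zeta>(1) by (intro DERIV_continuous_on) auto
  obtain M\<zeta> where M\<zeta>: "M\<zeta> \<ge> 0" "\<And>t. 0 \<le> t \<Longrightarrow> \<bar>\<zeta> t\<bar> \<le> M\<zeta>"
    using bounded_on_halfline[OF \<zeta>_cont \<zeta>(2)] by blast
  obtain M\<rho> where M\<rho>: "M\<rho> \<ge> 0" "\<And>t. 0 \<le> t \<Longrightarrow> \<bar>\<rho> t\<bar> \<le> M\<rho>"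
    using bounded_on_halfline[OF continuous_on_subset[OF \<rho>(1) subset_UNIV] \<rho>(2)] by blast
  have uc_\<rho>: "uniformly_continuous_on {0..b + 2} \<rho>"
    by (intro compact_uniformly_continuous continuous_on_subset[OF \<rho>(1)]) auto
  \<comment> \<open>each of the three error terms gets a third of \<open>\<eta>\<close>; adding \<open>1\<close> avoids division by zero\<close>
  define e1 where "e1 = \<eta> / (3 * (M\<zeta> * Lf * C + 1))"
  define e2 where "e2 = \<eta> / (3 * (Mf + 1))"
  define e3 where "e3 = \<eta> / (3 * (M\<rho> + 1))"
  have Lf: "Lf \<ge> 0" using f(1) by (rule lipschitz_on_nonneg)
  have "M\<zeta> * Lf * C \<ge> 0" using M\<zeta> Lf C by auto
  then have e: "e1 > 0" "e2 > 0" "e3 > 0" using \<eta> Mf M\<rho> by (auto simp: e1_def e2_def e3_def)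
  have "continuous_on ({0..b + 2} \<times> cball 0 r1) (\<lambda>(t, x). V t x)"
    by (rule continuous_on_subset[OF continuous]) auto
  from slab_modulus[OF this e(1)]
  obtain d1 where d1: "d1 > 0" "\<And>s t x y. s \<in> {0..b + 2} \<Longrightarrow> t \<in> {0..b + 2} \<Longrightarrow> norm x \<le> r1 \<Longrightarrow> norm y \<le> r1 \<Longrightarrow>
      \<bar>s - t\<bar> + norm (x - y) < d1 \<Longrightarrow> norm (V s x - V t y) < e1"
    unfolding dist_norm by blast
  obtain d2 where d2: "d2 > 0" "\<And>s t. s \<in> {0..b + 2} \<Longrightarrow> t \<in> {0..b + 2} \<Longrightarrow> \<bar>s - t\<bar> < d2 \<Longrightarrow> \<bar>\<rho> s - \<rho> t\<bar> < e2"
    using uc_\<rho> e(2) unfolding uniformly_continuous_on_def dist_real_def by metis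
  have "continuous_on ({0..b + 2} \<times> cball 0 r1) (\<lambda>q. ?w (snd q, fst q))"
    by (intro continuous_on_compose2[OF w_cont] continuous_intros) auto
  then have "continuous_on ({0..b + 2} \<times> cball 0 r1) (\<lambda>(t, x). ?w (x, t))"
    by (simp add: split_beta)
  from slab_modulus[OF this e(3)]
  obtain d3 where d3: "d3 > 0" "\<And>s t x y. s \<in> {0..b + 2} \<Longrightarrow> t \<in> {0..b + 2} \<Longrightarrow> norm x \<le> r1 \<Longrightarrow> norm y \<le> r1 \<Longrightarrow>
      \<bar>s - t\<bar> + norm (x - y) < d3 \<Longrightarrow> \<bar>?w (x, s) - ?w (y, t)\<bar> < e3"
    unfolding dist_real_def by blast
  \<comment> \<open>the second entry keeps \<open>h *\<^sub>R V t x\<close> short compared with the distance of \<open>x\<close> to the support\<close>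
  define \<delta> where "\<delta> = Min {1 / 2, 1 / (2 * (B + R + 2)), d1 / (2 * (r1 + R + 3)), d2 / 3, d3 / 3}"
  have \<delta>_le: "\<delta> \<le> 1 / 2" "\<delta> \<le> 1 / (2 * (B + R + 2))" "\<delta> \<le> d1 / (2 * (r1 + R + 3))" "\<delta> \<le> d2 / 3" "\<delta> \<le> d3 / 3"
    unfolding \<delta>_def by (rule Min_le; simp)+
  have \<delta>: "\<delta> > 0"
    unfolding \<delta>_def using B R_pos r1 d1(1) d2(1) d3(1) by (subst Min_gr_iff) auto
  have \<delta>1: "\<delta> * (r1 + R + 3) < d1"
  proof -
    define k where "k = r1 + R + 3"
    have k: "k > 0" using r1 R_pos by (simp add: k_def)
    have "\<delta> * k \<le> d1 / (2 * k) * k"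
      using \<delta>_le(3) k by (intro mult_right_mono) (auto simp: k_def)
    also have "\<dots> = d1 / 2" using k by simp
    finally show ?thesis using d1(1) by (simp add: k_def)
  qed
  have \<delta>BR: "\<delta> * (B + R + 2) \<le> 1 / 2"
  proof -
    define k where "k = B + R + 2"
    have k: "k > 0" using B(1) R_pos by (simp add: k_def)
    have "\<delta> * k \<le> 1 / (2 * k) * k"
      using \<delta>_le(2) k by (intro mult_right_mono) (auto simp: k_def)
    also have "\<dots> = 1 / 2" using k by simp
    finally show ?thesis by (simp add: k_def)
  qed
  show ?thesis
  proof (intro exI[of _ \<delta>] conjI allI impI \<delta>)
    fix x y :: 'a and t r h :: real
    assume t: "0 \<le> t" and yx: "norm (y - x) < \<delta>" and r: "t \<le> r" "r < t + \<delta>" and h: "0 < h" "h < \<delta>"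
    let ?v = "V t x"
    let ?E = "\<zeta> (r + h) * ?w (y + h *\<^sub>R ?v, r + h) - \<zeta> r * ?w (y, r) - h * (- \<rho> t * ?w (x, t))"
    \<comment> \<open>in the first two cases all terms vanish\<close>
    consider "t > b" | "t \<le> b" "norm x > B + 1" | "t \<le> b" "norm x \<le> B + 1" by linarith
    then show "\<bar>?E\<bar> \<le> \<eta> * h"
    proof cases
      case 1
      then show ?thesis using \<zeta>(2) \<rho>(2) r h \<eta> by simp
    next
      case 2
      have "norm (h *\<^sub>R ?v) \<le> \<delta> * (norm x + R)"
        using h growth[OF t, of x] by (auto intro!: mult_mono)
      moreover have "\<delta> * (norm x + R) + \<delta> = \<delta> * (B + R + 2) + \<delta> * (norm x - B - 1)"
        by (simp add: algebra_simps)
      moreover have "\<delta> * (norm x - B - 1) \<le> 1 / 2 * (norm x - B - 1)"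
        using \<delta>_le(1) 2 by (intro mult_right_mono) auto
      moreover have "norm x \<le> norm (y + h *\<^sub>R ?v) + norm (y - x) + norm (h *\<^sub>R ?v)"
        using norm_triangle_ineq4[of "y + h *\<^sub>R ?v" "(y - x) + h *\<^sub>R ?v"] norm_triangle_ineq[of "y - x" "h *\<^sub>R ?v"]
        by (simp add: algebra_simps)
      ultimately have "norm (y + h *\<^sub>R ?v) > B" using \<delta>BR yx 2 by argo
      moreover have "norm y > B"
        using yx \<delta>_le(1) 2 norm_triangle_ineq2[of x y] by (simp add: norm_minus_commute)
      ultimately have "?w (y + h *\<^sub>R ?v, r + h) = 0" "?w (y, r) = 0" "?w (x, t) = 0"
        using 2 B by auto
      then show ?thesis using \<eta> h by simp
    next
      case 3
      have ny: "norm y \<le> B + 2"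
        using yx \<delta>_le(1) 3 norm_triangle_ineq2[of y x] by simp
      have nv: "norm (h *\<^sub>R ?v) \<le> 1 / 2"
      proof -
        have "norm (h *\<^sub>R ?v) \<le> \<delta> * (B + R + 2)"
          using h growth[OF t, of x] 3 R_pos B by (auto intro!: mult_mono)
        then show ?thesis using \<delta>BR by simp
      qed
      have nyv: "norm (y + h *\<^sub>R ?v) \<le> B + 3"
        using ny nv norm_triangle_ineq[of y "h *\<^sub>R ?v"] by simp
      obtain s where s: "r < s" "s < r + h" "\<zeta> (r + h) - \<zeta> r = - (h * \<rho> s)"
        using C1_increment[OF \<zeta>(1), of r h] t r h by auto
      have first: "\<bar>\<zeta> (r + h) * (?w (y + h *\<^sub>R ?v, r + h) - ?w (y, r))\<bar> \<le> \<eta> / 3 * h"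
      proof (cases "r + h \<le> b")
        case True
        define \<xi> where "\<xi> u = flow V r u y" for u
        have r0: "0 \<le> r" using t r by simp
        have \<xi>_traj: "trajectory V {r..r + h} \<xi>"
          unfolding \<xi>_def using r0 by (intro trajectory_subset[OF flow_trajectory]) auto
        have \<xi>_norm: "norm (\<xi> u) \<le> r1" if "r \<le> u" for u
          unfolding \<xi>_def using that r0 ny r1 by (intro flow_norm_le) auto
        have \<xi>_y: "norm (\<xi> u - y) \<le> (r1 + R) * \<delta>" if "r \<le> u" "u \<le> r + h" for u
        proof -
          have "norm (\<xi> u - y) \<le> (r1 + R) * (u - r)"
            unfolding \<xi>_def using that r0 ny r1 by (intro flow_increment) auto
          also have "\<dots> \<le> (r1 + R) * \<delta>" using that h r1 R_pos by (intro mult_left_mono) auto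
          finally show ?thesis .
        qed
        have Vclose: "norm (V u (\<xi> u) - ?v) \<le> e1" if u: "u \<in> {r..r + h}" for u
        proof (rule less_imp_le, rule d1(2))
          have "norm (\<xi> u - x) \<le> norm (\<xi> u - y) + norm (y - x)"
            using norm_triangle_ineq[of "\<xi> u - y" "y - x"] by simp
          then have "\<bar>u - t\<bar> + norm (\<xi> u - x) \<le> 2 * \<delta> + ((r1 + R) * \<delta> + \<delta>)"
            using \<xi>_y[of u] u r h yx by auto
          also have "\<dots> = \<delta> * (r1 + R + 3)" by (simp add: algebra_simps)
          finally show "\<bar>u - t\<bar> + norm (\<xi> u - x) < d1" using \<delta>1 by simp
        qed (use u r h t \<delta>_le(1) True 3 r1 \<xi>_norm[of u] in auto)
        have "norm ((\<xi> (r + h) - (r + h) *\<^sub>R ?v) - (\<xi> r - r *\<^sub>R ?v)) \<le> e1 * norm (r + h - r)"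
        proof (rule differentiable_bound[of "{r..r + h}" "\<lambda>u. \<xi> u - u *\<^sub>R ?v" "\<lambda>u k. k *\<^sub>R (V u (\<xi> u) - ?v)"])
          fix u assume u: "u \<in> {r..r + h}"
          have "(\<xi> has_derivative (\<lambda>k. k *\<^sub>R V u (\<xi> u))) (at u within {r..r + h})"
            using \<xi>_traj u by (auto simp: trajectory_def has_vector_derivative_def)
          then show "((\<lambda>u. \<xi> u - u *\<^sub>R ?v) has_derivative (\<lambda>k. k *\<^sub>R (V u (\<xi> u) - ?v))) (at u within {r..r + h})"
            by (auto intro!: derivative_eq_intros simp: scaleR_diff_right)
          show "onorm (\<lambda>k. k *\<^sub>R (V u (\<xi> u) - ?v)) \<le> e1"
            using Vclose[OF u] by (intro onorm_le) (simp add: mult.commute[of e1] mult_left_mono)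
        qed (use h in auto)
        moreover have "(\<xi> (r + h) - (r + h) *\<^sub>R ?v) - (\<xi> r - r *\<^sub>R ?v) = \<xi> (r + h) - (y + h *\<^sub>R ?v)"
          using r0 by (simp add: \<xi>_def flow_start algebra_simps)
        ultimately have close: "norm ((y + h *\<^sub>R ?v) - \<xi> (r + h)) \<le> e1 * h"
          using h by (simp add: norm_minus_commute)
        have w1: "?w (y + h *\<^sub>R ?v, r + h) = f (flow V (r + h) b (y + h *\<^sub>R ?v))"
          using True r0 h by (simp add: transported_def)
        have w2: "?w (y, r) = f (flow V (r + h) b (\<xi> (r + h)))"
          using True r0 h by (simp add: transported_def \<xi>_def flow_semigroup)
        have "\<bar>?w (y + h *\<^sub>R ?v, r + h) - ?w (y, r)\<bar> \<le>
            Lf * norm (flow V (r + h) b (y + h *\<^sub>R ?v) - flow V (r + h) b (\<xi> (r + h)))"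
          unfolding w1 w2 using lipschitz_onD[OF f(1)] by (simp add: dist_norm)
        also have "\<dots> \<le> Lf * (C * norm ((y + h *\<^sub>R ?v) - \<xi> (r + h)))"
          using True r0 h r1 nyv \<xi>_norm[of "r + h"] Lf by (intro mult_left_mono C(2)) auto
        also have "\<dots> \<le> Lf * (C * (e1 * h))"
          using close Lf C(1) by (intro mult_left_mono) auto
        finally have "\<bar>\<zeta> (r + h)\<bar> * \<bar>?w (y + h *\<^sub>R ?v, r + h) - ?w (y, r)\<bar> \<le> M\<zeta> * (Lf * (C * (e1 * h)))"
          using M\<zeta> r0 h by (intro mult_mono) auto
        also have "\<dots> = (M\<zeta> * Lf * C) * e1 * h" by (simp add: mult_ac)
        also have "\<dots> \<le> (M\<zeta> * Lf * C + 1) * e1 * h"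
          using e h by (intro mult_right_mono) auto
        also have "\<dots> = \<eta> / 3 * h"
          using \<open>M\<zeta> * Lf * C \<ge> 0\<close> by (simp add: e1_def field_simps)
        finally show ?thesis by (simp add: abs_mult)
      next
        case False
        then show ?thesis using \<zeta>(2)[of "r + h"] \<eta> h by simp
      qed
      have "\<bar>(\<rho> t - \<rho> s) * ?w (y, r)\<bar> \<le> e2 * Mf"
        unfolding abs_mult
      proof (rule mult_mono)
        show "\<bar>\<rho> t - \<rho> s\<bar> \<le> e2"
          by (rule less_imp_le, rule d2(2)) (use t r s h 3 \<delta>_le(1,4) in auto)
      qed (use w_bound e in auto)
      moreover have "\<bar>\<rho> t * (?w (x, t) - ?w (y, r))\<bar> \<le> M\<rho> * e3"
        unfolding abs_mult
      proof (rule mult_mono)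
        show "\<bar>?w (x, t) - ?w (y, r)\<bar> \<le> e3"
          by (rule less_imp_le, rule d3(2))
             (use t r s h 3 yx ny r1 \<delta>_le(1,5) in \<open>auto simp: norm_minus_commute\<close>)
      qed (use M\<rho> t in auto)
      moreover have "e2 * Mf \<le> \<eta> / 3" "M\<rho> * e3 \<le> \<eta> / 3"
        using \<eta> Mf(1) M\<rho>(1) by (auto simp: e2_def e3_def field_simps)
      moreover have "?E = \<zeta> (r + h) * (?w (y + h *\<^sub>R ?v, r + h) - ?w (y, r)) +
          h * ((\<rho> t - \<rho> s) * ?w (y, r) + \<rho> t * (?w (x, t) - ?w (y, r)))"
      proof -
        have "\<zeta> r = \<zeta> (r + h) + h * \<rho> s" using s(3) by simp
        then show ?thesis by (simp add: algebra_simps)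
      qed
      moreover have "\<bar>h * ((\<rho> t - \<rho> s) * ?w (y, r) + \<rho> t * (?w (x, t) - ?w (y, r)))\<bar> \<le> h * (\<eta> / 3 + \<eta> / 3)"
      proof -
        have "\<bar>(\<rho> t - \<rho> s) * ?w (y, r) + \<rho> t * (?w (x, t) - ?w (y, r))\<bar> \<le> \<eta> / 3 + \<eta> / 3"
          using calculation(1-4) by linarith
        then show ?thesis unfolding abs_mult[of h] using h by (intro mult_mono) auto
      qed
      ultimately have "\<bar>?E\<bar> \<le> \<eta> / 3 * h + h * (\<eta> / 3 + \<eta> / 3)"
        using first by linarith
      also have "\<dots> = \<eta> * h" by (simp add: field_simps)
      finally show ?thesis .
    qed
  qed
qed

lemma flow_measurable: "t \<ge> 0 \<Longrightarrow> flow V 0 t \<in> borel_measurable borel"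
proof (rule borel_measurable_continuous_onI)
  assume t: "t \<ge> 0"
  have "continuous_on UNIV (\<lambda>x::'a. case (t, x) of (t, x) \<Rightarrow> flow V 0 t x)"
    by (rule continuous_on_compose2[OF flow_continuous_end]) (use t in \<open>auto intro!: continuous_intros\<close>)
  then show "continuous_on UNIV (flow V 0 t)" by simp
qed

text \<open>Uniqueness for the linear continuity equation, by duality.  Let \<open>m t\<close> be the integral with
respect to \<open>\<nu> t\<close> of the function transported backwards from \<open>f\<close> at time \<open>b\<close>.  Testing with its
product with the primitive \<open>\<zeta>\<close> of \<open>- \<rho>\<close> shows that the integral of \<open>\<rho> t * (m t - m 0)\<close> over the
interval from \<open>0\<close> to \<open>b\<close> is zero, for every continuous \<open>\<rho>\<close> that vanishes at both ends.  The choice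
\<open>\<rho> t = (b - t) * (m t - m 0)\<close> makes the integrand non-negative, and so \<open>m\<close> is constant.  But
\<open>m b = m 0\<close> says that \<open>f\<close> has the same integral with respect to \<open>\<nu> b\<close> and to the image of \<open>\<nu> 0\<close>
under the flow.\<close>

theorem weak_solution_is_transported:
  assumes T: "T > 0" "S \<le> T"
    and \<nu>: "continuous_map (top_of_set {0..<T}) narrow_topology \<nu>"
    and weak: "weak_transport_solution T S V \<nu>"
    and b: "0 \<le> b" "b < S"
  shows "\<nu> b = distr (\<nu> 0) borel (flow V 0 b)"
proof (rule measure_eqI_lipschitz_bounded_support)
  have prob: "\<nu> t \<in> prob_measures" if "t \<in> {0..<T}" for t
    using \<nu> that by (auto simp: continuous_map_narrow_iff)
  then show "\<nu> b \<in> prob_measures" using b T by simp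
  have prob0: "\<nu> 0 \<in> prob_measures" using prob T by simp
  have flow_meas: "flow V 0 b \<in> measurable (\<nu> 0) borel"
    using flow_measurable[OF b(1)] measurable_cong_sets[OF prob_measuresD(2)[OF prob0] refl] by blast
  show "distr (\<nu> 0) borel (flow V 0 b) \<in> prob_measures"
    unfolding prob_measures_def using prob_space.prob_space_distr[OF prob_measuresD(1)[OF prob0] flow_meas] by simp
  fix f :: "'a \<Rightarrow> real" and Lf r0
  assume f: "Lf-lipschitz_on UNIV f" "\<And>x. norm x > r0 \<Longrightarrow> f x = 0"
  have f_cont: "continuous_on UNIV f" using f(1) by (rule lipschitz_on_continuous_on)
  let ?w = "transported b f"
  define m where "m t = (\<integral>x. ?w (x, t) \<partial>\<nu> t)" for t
  have w_cont: "continuous_on UNIV ?w" using b(1) f_cont by (rule transported_continuous)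
  obtain B where B: "B \<ge> 0" "\<And>x t. norm x > B \<Longrightarrow> ?w (x, t) = 0"
    by (rule transported_support[where f = f and r = r0, OF b(1)], erule f(2)) (rule that)
  define r where "r = B + b + 1"
  have big: "norm (fst q) > B \<or> \<bar>snd q\<bar> > b + 1" if "norm q > r" for q :: "'a \<times> real"
    using that norm_Pair_le[of "fst q" "snd q"] by (auto simp: r_def)
  have m_cont: "continuous_on {0..b} m"
  proof -
    \<comment> \<open>a cut-off in time, equal to \<open>1\<close> on the interval of interest, provides compact support\<close>
    define c where "c t = max 0 (min 1 (b + 1 - \<bar>t\<bar>))" for t :: real
    have "continuous_on {0..<T} (\<lambda>t. \<integral>x. (\<lambda>q. c (snd q) * ?w q) (x, t) \<partial>\<nu> t)"
    proof (rule continuous_integral_slices[OF \<nu>])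
      show "continuous_on UNIV (\<lambda>q. c (snd q) * ?w q)"
        unfolding c_def by (intro continuous_intros w_cont)
      show "c (snd q) * ?w q = 0" if "norm q > r" for q
        using big[OF that] B(2)[of "fst q" "snd q"] by (auto simp: c_def)
    qed
    then have "continuous_on {0..b} (\<lambda>t. c t * m t)"
      using b T by (auto simp: m_def intro: continuous_on_subset)
    then show ?thesis by (rule continuous_on_eq) (auto simp: c_def)
  qed
  have "m b = m 0"
  proof (cases "b = 0")
    case False
    then have b0: "b > 0" using b by simp
    define clip where "clip t = max 0 (min t b)" for t :: real
    define \<rho> where "\<rho> t = max 0 (b - t) * (m (clip t) - m 0)" for t
    have "continuous_on UNIV (\<lambda>t. m (clip t))"
      unfolding clip_def by (rule continuous_on_compose2[OF m_cont]) (use b in \<open>auto intro!: continuous_intros\<close>)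
    then have \<rho>_cont: "continuous_on UNIV \<rho>"
      unfolding \<rho>_def by (intro continuous_intros)
    have \<rho>_0: "\<rho> t = 0" if "t \<le> 0 \<or> t \<ge> b" for t
      using that b by (auto simp: \<rho>_def clip_def)
    define \<zeta>0 where "\<zeta>0 t = integral {0..b} \<rho> - integral {0..t} \<rho>" for t
    \<comment> \<open>for negative times \<open>\<zeta>\<close> is cut off linearly to keep the support compact\<close>
    define \<zeta> where "\<zeta> t = \<zeta>0 (max 0 t) * max 0 (1 + min t 0)" for t
    have \<zeta>_eq: "\<zeta> t = \<zeta>0 t" if "t \<ge> 0" for t using that by (simp add: \<zeta>_def)
    have \<zeta>0_deriv: "(\<zeta>0 has_real_derivative (- \<rho> t)) (at t within {0..})" if "t \<ge> 0" for t
      unfolding \<zeta>0_def has_real_derivative_iff_has_vector_derivative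
      using integral_has_vector_derivative_halfline[OF continuous_on_subset[OF \<rho>_cont subset_UNIV] that]
      by (auto intro!: derivative_eq_intros)
    have \<zeta>_deriv: "(\<zeta> has_real_derivative (- \<rho> t)) (at t within {0..})" if "t \<ge> 0" for t
      by (rule has_field_derivative_transform_within[OF \<zeta>0_deriv[OF that], of 1]) (use that \<zeta>_eq in auto)
    have "continuous_on {0..} \<zeta>0"
      using \<zeta>0_deriv by (intro DERIV_continuous_on) auto
    then have "continuous_on UNIV (\<lambda>t. \<zeta>0 (max 0 t))"
      by (rule continuous_on_compose2) (auto intro!: continuous_intros)
    then have \<zeta>_cont: "continuous_on UNIV \<zeta>"
      unfolding \<zeta>_def by (intro continuous_intros)
    have \<zeta>_0: "\<zeta> t = 0" if "t \<ge> b" for t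
    proof -
      have "integral {0..b} \<rho> + integral {b..t} \<rho> = integral {0..t} \<rho>"
        using that b by (intro Henstock_Kurzweil_Integration.integral_combine integrable_continuous_real
            continuous_on_subset[OF \<rho>_cont]) auto
      moreover have "integral {b..t} \<rho> = integral {b..t} (\<lambda>_. 0)"
        by (rule Henstock_Kurzweil_Integration.integral_cong) (use \<rho>_0 in auto)
      ultimately show ?thesis using that b \<zeta>_eq[of t] by (simp add: \<zeta>0_def)
    qed
    let ?W = "\<lambda>q. \<zeta> (snd q) * ?w q" and ?G = "\<lambda>q. - \<rho> (snd q) * ?w q"
    have W: "continuous_on UNIV ?W" "\<And>q. norm q > r \<Longrightarrow> ?W q = 0" "\<And>x t. t > b \<Longrightarrow> ?W (x, t) = 0"
    proof -
      show "continuous_on UNIV ?W"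
        by (intro continuous_intros continuous_on_compose2[OF \<zeta>_cont] w_cont) auto
      show "?W q = 0" if "norm q > r" for q
        using big[OF that] B(2)[of "fst q" "snd q"] \<zeta>_0[of "snd q"] b
        by (cases "snd q \<ge> 0") (auto simp: \<zeta>_def)
    qed (use \<zeta>_0 in auto)
    have G: "continuous_on UNIV ?G" "\<And>q. norm q > r \<Longrightarrow> ?G q = 0"
    proof -
      show "continuous_on UNIV ?G"
        by (intro continuous_intros continuous_on_compose2[OF \<rho>_cont] w_cont) auto
      show "?G q = 0" if "norm q > r" for q
        using big[OF that] B(2)[of "fst q" "snd q"] \<rho>_0[of "snd q"] b by force
    qed
    have "(LINT t:{0..<T}|lborel. (\<integral>x. ?G (x, t) \<partial>\<nu> t)) + (\<integral>x. ?W (x, 0) \<partial>\<nu> 0) = 0"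
    proof (rule weak_formulation_lagrangian(2)[OF T(1) b(2) \<nu> weak W G])
      fix \<eta> :: real assume "\<eta> > 0"
      from transported_lagrangian[OF b(1) f \<rho>_cont _ \<zeta>_deriv _ this] \<rho>_0 \<zeta>_0
      show "\<exists>\<delta>>0. \<forall>x t y r h. 0 \<le> t \<longrightarrow> norm (y - x) < \<delta> \<longrightarrow> t \<le> r \<longrightarrow> r < t + \<delta> \<longrightarrow> 0 < h \<longrightarrow> h < \<delta> \<longrightarrow>
          \<bar>?W (y + h *\<^sub>R V t x, r + h) - ?W (y, r) - h * ?G (x, t)\<bar> \<le> \<eta> * h"
        by simp
    qed
    moreover have "(\<integral>x. ?W (x, 0) \<partial>\<nu> 0) = integral {0..b} \<rho> * m 0"
      using \<zeta>_eq[of 0] by (simp add: m_def \<zeta>0_def)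
    moreover have "(LINT t:{0..<T}|lborel. (\<integral>x. ?G (x, t) \<partial>\<nu> t)) = integral {0..b} (\<lambda>t. - \<rho> t * m t)"
    proof -
      have "(LINT t:{0..<T}|lborel. (\<integral>x. ?G (x, t) \<partial>\<nu> t)) = (LINT t:{0..b}|lborel. - \<rho> t * m t)"
        unfolding set_lebesgue_integral_def
        by (rule Bochner_Integration.integral_cong) (use \<rho>_0 b T in \<open>auto simp: m_def indicator_def\<close>)
      also have "\<dots> = integral {0..b} (\<lambda>t. - \<rho> t * m t)"
        by (rule set_borel_integral_eq_integral(2), rule borel_integrable_atLeastAtMost')
           (intro continuous_intros m_cont continuous_on_subset[OF \<rho>_cont] subset_UNIV)
      finally show ?thesis .
    qed
    ultimately have "integral {0..b} (\<lambda>t. - \<rho> t * m t) + integral {0..b} (\<lambda>t. \<rho> t * m 0) = 0"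
      by simp
    moreover have int: "(\<lambda>t. - \<rho> t * m t) integrable_on {0..b}" "(\<lambda>t. \<rho> t * m 0) integrable_on {0..b}"
      by (intro integrable_continuous_real continuous_intros m_cont continuous_on_subset[OF \<rho>_cont] subset_UNIV)+
    ultimately have "((\<lambda>t. - \<rho> t * m t + \<rho> t * m 0) has_integral 0) {0..b}"
      using has_integral_add[OF integrable_integral[OF int(1)] integrable_integral[OF int(2)]] by simp
    then have "((\<lambda>t. - (- \<rho> t * m t + \<rho> t * m 0)) has_integral - 0) {0..b}"
      by (rule has_integral_neg)
    then have hi: "((\<lambda>t. (b - t) * (m t - m 0)\<^sup>2) has_integral 0) {0..b}"
      by (rule has_integral_eq[rotated, THEN has_integral_eq_rhs])
         (auto simp: \<rho>_def clip_def power2_eq_square algebra_simps)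
    have zero: "(b - t) * (m t - m 0)\<^sup>2 = 0" if "t \<in> {0..b}" for t
      by (rule has_integral_0_cbox_imp_0[of 0 b "\<lambda>t. (b - t) * (m t - m 0)\<^sup>2"])
         (use hi that b0 in \<open>auto intro!: continuous_intros m_cont\<close>)
    have closure: "closure {0..<b} = {0..b}" using b0 by (rule closure_atLeastLessThan)
    show ?thesis
    proof (rule continuous_constant_on_closure[of "{0..<b}" m "m 0" b])
      show "m t = m 0" if "t \<in> {0..<b}" for t using zero[of t] that by simp
    qed (use m_cont b0 in \<open>simp_all add: closure\<close>)
  qed simp
  then show "(\<integral>x. f x \<partial>\<nu> b) = (\<integral>x. f x \<partial>distr (\<nu> 0) borel (flow V 0 b))"
    using b flow_meas borel_measurable_continuous_onI[OF f_cont]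
    by (simp add: m_def transported_def flow_start[OF b(1)] integral_distr)
qed

end

section \<open>Push-forward along the flow\<close>

lemma test_function_has_derivative:
  "\<phi> \<in> test_functions U \<Longrightarrow> (\<phi> has_derivative frechet_derivative \<phi> (at p)) (at p)"
  by (rule Ck_has_derivative[of 0]) (simp add: test_functions_def del: Ck.simps)

lemma test_function_outside:
  assumes \<phi>: "\<phi> \<in> test_functions U" and p: "p \<notin> U"
  shows "\<phi> p = 0" and "frechet_derivative \<phi> (at p) = (\<lambda>_. 0)"
proof -
  let ?S = "- closure {q. \<phi> q \<noteq> 0}"
  have S: "open ?S" "p \<in> ?S" using \<phi> p by (auto simp: test_functions_def)
  have zero: "\<phi> q = 0" if "q \<in> ?S" for q
    using that closure_subset[of "{q. \<phi> q \<noteq> 0}"] by auto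
  from zero[OF S(2)] show "\<phi> p = 0" .
  have "(\<phi> has_derivative (\<lambda>_. 0)) (at p)"
    by (rule has_derivative_transform_within_open[OF has_derivative_const S]) (rule zero[symmetric])
  then show "frechet_derivative \<phi> (at p) = (\<lambda>_. 0)" by (rule frechet_derivative_at[symmetric])
qed

lemma test_functions_mono: "U \<subseteq> U' \<Longrightarrow> test_functions U \<subseteq> test_functions U'"
  by (auto simp: test_functions_def)

lemma test_function_transport_integrand:
  assumes "\<phi> \<in> test_functions U"
  shows "transport_integrand V \<phi> t x = frechet_derivative \<phi> (at (x, t)) (V x, 1)"
  by (intro transport_integrand_eq_derivative differentiableI[OF test_function_has_derivative[OF assms]])

text \<open>The smoothness hypothesis concerns each fixed direction; expanding the direction in the basis
gives joint continuity.\<close>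

lemma test_function_derivative_continuous:
  fixes \<phi> :: "'a::euclidean_space \<Rightarrow> real"
  assumes \<phi>: "\<phi> \<in> test_functions U" and f: "continuous_on A f" and v: "continuous_on A v"
  shows "continuous_on A (\<lambda>q. frechet_derivative \<phi> (at (f q)) (v q))"
proof -
  have lin: "linear (frechet_derivative \<phi> (at p))" for p
    by (rule has_derivative_linear[OF test_function_has_derivative[OF \<phi>]])
  have Ck: "Ck (Suc 0) \<phi>" using \<phi> by (simp add: test_functions_def del: Ck.simps)
  have expand: "frechet_derivative \<phi> (at p) w = (\<Sum>b\<in>Basis. (w \<bullet> b) * frechet_derivative \<phi> (at p) b)" for p w
  proof -
    have "frechet_derivative \<phi> (at p) (\<Sum>b\<in>Basis. (w \<bullet> b) *\<^sub>R b) = (\<Sum>b\<in>Basis. (w \<bullet> b) * frechet_derivative \<phi> (at p) b)"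
      by (simp add: linear_sum[OF lin] linear_scale[OF lin])
    then show ?thesis by (simp add: euclidean_representation)
  qed
  have "continuous_on A (\<lambda>q. \<Sum>b\<in>Basis. (v q \<bullet> b) * frechet_derivative \<phi> (at (f q)) b)"
  proof (intro continuous_on_sum continuous_on_mult continuous_on_inner v continuous_on_const)
    fix b :: 'a
    have "continuous_on UNIV (\<lambda>p. frechet_derivative \<phi> (at p) b)" using Ck by simp
    then show "continuous_on A (\<lambda>q. frechet_derivative \<phi> (at (f q)) b)"
      by (rule continuous_on_compose2[OF _ f]) simp
  qed
  then show ?thesis by (rule continuous_on_eq) (rule expand[symmetric])
qed

context confining_field
begin

context
  fixes \<mu>0 :: "'a measure"
  assumes \<mu>0: "\<mu>0 \<in> prob_measures" and supp: "AE x in \<mu>0. x \<in> cball 0 R"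
begin

interpretation prob_space \<mu>0 using \<mu>0 by (rule prob_measuresD)

lemma flow_measurable_initial: "t \<ge> 0 \<Longrightarrow> flow V 0 t \<in> measurable \<mu>0 borel"
  using flow_measurable measurable_cong_sets[OF prob_measuresD(2)[OF \<mu>0] refl] by blast

lemma pushforward_supported:
  assumes "t \<ge> 0"
  shows "AE x in distr \<mu>0 borel (flow V 0 t). x \<in> cball 0 R"
proof (subst AE_distr_iff[OF flow_measurable_initial[OF assms]])
  show "{x \<in> space borel. x \<in> cball (0 :: 'a) R} \<in> sets borel" by simp
  show "AE x in \<mu>0. flow V 0 t x \<in> cball 0 R"
    using supp by eventually_elim (use assms flow_norm_le[of 0 t _ R] in auto)
qed

lemma pushforward_prob: "t \<ge> 0 \<Longrightarrow> distr \<mu>0 borel (flow V 0 t) \<in> prob_measures"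
  unfolding prob_measures_def using prob_space_distr[OF flow_measurable_initial] by simp

lemma pushforward_continuous:
  "continuous_map (top_of_set {0..}) narrow_topology (\<lambda>t. distr \<mu>0 borel (flow V 0 t))"
  unfolding continuous_map_narrow_iff
proof (intro conjI ballI)
  show "(\<lambda>t. distr \<mu>0 borel (flow V 0 t)) \<in> topspace (top_of_set {0..}) \<rightarrow> prob_measures"
    using pushforward_prob by auto
  fix f :: "'a \<Rightarrow> real" assume "f \<in> bounded_continuous"
  then have f: "continuous_on UNIV f" and "bounded (range f)" by (auto simp: bounded_continuous_def)
  then obtain B where B: "\<And>x. \<bar>f x\<bar> \<le> B" by (auto simp: bounded_iff)
  have fm: "f \<in> borel_measurable borel" using f by (rule borel_measurable_continuous_onI)
  have eq: "(\<integral>x. f x \<partial>distr \<mu>0 borel (flow V 0 t)) = (\<integral>x. f (flow V 0 t x) \<partial>\<mu>0)" if "t \<ge> 0" for t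
    using flow_measurable_initial[OF that] fm by (rule integral_distr)
  have "continuous_on {0..} (\<lambda>t. \<integral>x. f (flow V 0 t x) \<partial>\<mu>0)"
    unfolding continuous_on_sequentially comp_def
  proof (intro allI ballI impI)
    fix s :: "nat \<Rightarrow> real" and t :: real
    assume t: "t \<in> {0..}" and s: "(\<forall>n. s n \<in> {0..}) \<and> s \<longlonglongrightarrow> t"
    show "(\<lambda>n. \<integral>x. f (flow V 0 (s n) x) \<partial>\<mu>0) \<longlonglongrightarrow> (\<integral>x. f (flow V 0 t x) \<partial>\<mu>0)"
    proof (rule integral_dominated_convergence[where w = "\<lambda>_. B"])
      show "(\<lambda>x. f (flow V 0 t x)) \<in> borel_measurable \<mu>0"
        using measurable_compose[OF flow_measurable_initial fm] t by simp
      show "(\<lambda>x. f (flow V 0 (s n) x)) \<in> borel_measurable \<mu>0" for n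
        using measurable_compose[OF flow_measurable_initial fm] s by simp
      show "AE x in \<mu>0. (\<lambda>n. f (flow V 0 (s n) x)) \<longlonglongrightarrow> f (flow V 0 t x)"
      proof (rule AE_I2)
        fix x
        have "continuous_on {0..} (\<lambda>t. f (flow V 0 t x))"
          using trajectory_continuous[OF flow_trajectory[of 0 x]]
          by (intro continuous_on_compose2[OF f]) auto
        then show "(\<lambda>n. f (flow V 0 (s n) x)) \<longlonglongrightarrow> f (flow V 0 t x)"
          using s t unfolding continuous_on_sequentially comp_def by blast
      qed
    qed (use B in auto)
  qed
  then have "continuous_on {0..} (\<lambda>t. \<integral>x. f x \<partial>distr \<mu>0 borel (flow V 0 t))"
    by (rule continuous_on_eq) (use eq in auto)
  then show "continuous_map (top_of_set {0..}) euclideanreal (\<lambda>t. \<integral>x. f x \<partial>distr \<mu>0 borel (flow V 0 t))"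
    by simp
qed

text \<open>By the change of variables the inner integral is the integral with respect to \<open>\<mu>0\<close> of the time
derivative of \<open>\<phi>\<close> along the trajectories.  After exchanging the integrals, the fundamental
theorem of calculus leaves \<open>- \<phi> (x, 0)\<close>, because \<open>\<phi>\<close> vanishes at time \<open>T\<close>.\<close>

lemma pushforward_weak_solution:
  assumes T: "T > 0" and \<phi>: "\<phi> \<in> test_functions (UNIV \<times> {..<T})"
  defines "\<mu> \<equiv> \<lambda>t. distr \<mu>0 borel (flow V 0 t)"
  shows "t \<ge> 0 \<Longrightarrow> integrable (\<mu> t) (transport_integrand (V t) \<phi> t)"
    and "set_integrable lborel {0..<T} (\<lambda>t. \<integral>x. transport_integrand (V t) \<phi> t x \<partial>\<mu> t)"
    and "(LINT t:{0..<T}|lborel. (\<integral>x. transport_integrand (V t) \<phi> t x \<partial>\<mu> t)) + (\<integral>x. \<phi> (x, 0) \<partial>\<mu>0) = 0"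
proof -
  define \<Psi> where "\<Psi> t x = frechet_derivative \<phi> (at (x, t)) (V t x, 1)" for t x
  have TI: "transport_integrand (V t) \<phi> t = \<Psi> t" for t
    unfolding \<Psi>_def using test_function_transport_integrand[OF \<phi>] by blast
  have \<Psi>_cont: "continuous_on ({0..} \<times> UNIV) (\<lambda>(t, x). \<Psi> t x)"
  proof -
    have vc: "continuous_on ({0..} \<times> UNIV) (\<lambda>q. (V (fst q) (snd q), 1 :: real))"
      using continuous by (intro continuous_on_Pair continuous_on_const) (simp add: split_beta)
    have "continuous_on ({0..} \<times> UNIV) (\<lambda>q. frechet_derivative \<phi> (at (snd q, fst q)) (V (fst q) (snd q), 1))"
      by (rule test_function_derivative_continuous[OF \<phi> _ vc]) (intro continuous_intros)
    then show ?thesis by (simp add: \<Psi>_def split_beta)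
  qed
  have \<Psi>_slice: "continuous_on UNIV (\<Psi> t)" if "t \<ge> 0" for t
  proof -
    have "continuous_on UNIV (\<lambda>x. case (t, x) of (t, x) \<Rightarrow> \<Psi> t x)"
      by (rule continuous_on_compose2[OF \<Psi>_cont]) (use that in \<open>auto intro!: continuous_intros\<close>)
    then show ?thesis by simp
  qed
  show "integrable (\<mu> t) (transport_integrand (V t) \<phi> t)" if "t \<ge> 0" for t
    unfolding TI \<mu>_def
    by (rule integrable_continuous_on_ball[OF pushforward_prob[OF that] pushforward_supported[OF that] \<Psi>_slice[OF that]])
  \<comment> \<open>the time derivative of \<open>\<lambda>t. \<phi> (flow V 0 t x, t)\<close>\<close>
  define h where "h t x = \<Psi> t (flow V 0 t x)" for t x
  have h_cont: "continuous_on ({0..} \<times> UNIV) (\<lambda>(t, x). h t x)"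
  proof -
    have "continuous_on ({0..} \<times> UNIV) (\<lambda>q. (fst q, flow V 0 (fst q) (snd q)))"
      using flow_continuous_end by (intro continuous_intros) (simp add: split_beta)
    moreover have "(\<lambda>q. (fst q, flow V 0 (fst q) (snd q))) ` ({0..} \<times> UNIV) \<subseteq> {0..} \<times> UNIV" by auto
    ultimately have "continuous_on ({0..} \<times> UNIV) (\<lambda>q. case (fst q, flow V 0 (fst q) (snd q)) of (t, x) \<Rightarrow> \<Psi> t x)"
      by (rule continuous_on_compose2[OF \<Psi>_cont])
    then show ?thesis by (simp add: h_def split_beta)
  qed
  let ?p = "closest_point (cball 0 R :: 'a set)"
  let ?c = "\<lambda>t :: real. max 0 (min t T)"
  \<comment> \<open>clamping time and space gives a function that is bounded and measurable everywhere and agrees with \<open>h\<close> where it matters\<close>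
  define k where "k t x = indicator {0..<T} t * h (?c t) (?p x)" for t x
  have p_cont: "continuous_on UNIV ?p"
    using R_pos by (intro continuous_on_closest_point) auto
  have hc: "continuous_on UNIV (\<lambda>q. h (?c (fst q)) (?p (snd q)))"
  proof -
    have "continuous_on UNIV (\<lambda>q :: real \<times> 'a. (?c (fst q), ?p (snd q)))"
      by (intro continuous_intros continuous_on_compose2[OF p_cont]) auto
    then have "continuous_on UNIV (\<lambda>q :: real \<times> 'a. case (?c (fst q), ?p (snd q)) of (t, x) \<Rightarrow> h t x)"
      by (rule continuous_on_compose2[OF h_cont]) auto
    then show ?thesis by simp
  qed
  obtain M where M: "\<And>t x. \<bar>h (?c t) (?p x)\<bar> \<le> M"
  proof -
    have "compact ((\<lambda>(t, x). h t x) ` ({0..T} \<times> cball 0 R))"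
      by (intro compact_continuous_image continuous_on_subset[OF h_cont] compact_Times) auto
    then obtain M where "\<And>q. q \<in> {0..T} \<times> cball 0 R \<Longrightarrow> norm (case q of (t, x) \<Rightarrow> h t x) \<le> M"
      using compact_imp_bounded bounded_iff by (metis imageI)
    moreover have "(?c t, ?p x) \<in> {0..T} \<times> cball 0 R" for t x
      using T R_pos closest_point_in_set[of "cball 0 R" x] by auto
    ultimately have "\<bar>h (?c t) (?p x)\<bar> \<le> M" for t x by fastforce
    then show ?thesis by (rule that)
  qed
  interpret P: pair_sigma_finite lborel \<mu>0 ..
  have sets: "sets (lborel \<Otimes>\<^sub>M \<mu>0) = sets (borel :: (real \<times> 'a) measure)"
  proof -
    have "sets (lborel \<Otimes>\<^sub>M \<mu>0) = sets (borel \<Otimes>\<^sub>M (borel :: 'a measure))"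
      by (rule sets_pair_measure_cong) (simp_all add: prob_measuresD(2)[OF \<mu>0])
    then show ?thesis by (simp only: borel_prod)
  qed
  have k_int: "integrable (lborel \<Otimes>\<^sub>M \<mu>0) (\<lambda>(t, x). k t x)"
  proof (rule Bochner_Integration.integrable_bound)
    show "integrable (lborel \<Otimes>\<^sub>M \<mu>0) (\<lambda>q. indicator ({0..<T} \<times> space \<mu>0) q * M)"
      using emeasure_bounded_finite[of "{0..<T}"]
      by (intro integrable_mult_left integrable_real_indicator)
         (auto simp: emeasure_pair_measure_Times emeasure_space_1)
    have "(\<lambda>q. indicator {0..<T} (fst q) * h (?c (fst q)) (?p (snd q))) \<in> borel_measurable borel"
      using borel_measurable_continuous_onI[OF hc] by (intro borel_measurable_times borel_measurable_indicator') (auto simp: borel_prod[symmetric])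
    moreover have "(\<lambda>(t, x). k t x) = (\<lambda>q. indicator {0..<T} (fst q) * h (?c (fst q)) (?p (snd q)))"
      by (auto simp: k_def fun_eq_iff)
    ultimately show "(\<lambda>(t, x). k t x) \<in> borel_measurable (lborel \<Otimes>\<^sub>M \<mu>0)"
      unfolding measurable_cong_sets[OF sets refl] by (simp only:)
    show "AE q in lborel \<Otimes>\<^sub>M \<mu>0. norm (case q of (t, x) \<Rightarrow> k t x) \<le> norm (indicat_real ({0..<T} \<times> space \<mu>0) q * M)"
    proof (rule AE_I2)
      fix q :: "real \<times> 'a"
      show "norm (case q of (t, x) \<Rightarrow> k t x) \<le> norm (indicat_real ({0..<T} \<times> space \<mu>0) q * M)"
        using M[of "fst q" "snd q"] prob_measuresD(3)[OF \<mu>0]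
        by (cases q) (auto simp: k_def indicator_def)
    qed
  qed
  have inner: "indicator {0..<T} t *\<^sub>R (\<integral>x. transport_integrand (V t) \<phi> t x \<partial>\<mu> t) = (\<integral>x. k t x \<partial>\<mu>0)" for t
  proof (cases "t \<in> {0..<T}")
    case True
    then have t: "t \<ge> 0" by simp
    have "(\<integral>x. transport_integrand (V t) \<phi> t x \<partial>\<mu> t) = (\<integral>x. h t x \<partial>\<mu>0)"
      unfolding TI \<mu>_def h_def
      using flow_measurable_initial[OF t] borel_measurable_continuous_onI[OF \<Psi>_slice[OF t]] by (rule integral_distr)
    also have "\<dots> = (\<integral>x. k t x \<partial>\<mu>0)"
    proof (rule integral_cong_AE)
      have "continuous_on UNIV (\<lambda>x. case (t, x) of (t, x) \<Rightarrow> h t x)"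
        by (rule continuous_on_compose2[OF h_cont]) (use t in \<open>auto intro!: continuous_intros\<close>)
      then show "(\<lambda>x. h t x) \<in> borel_measurable \<mu>0"
        by (intro borel_measurable_prob_measures[OF \<mu>0]) simp
      have "continuous_on UNIV (\<lambda>x. (\<lambda>q. h (?c (fst q)) (?p (snd q))) (t, x))"
        by (rule continuous_on_compose2[OF hc]) (auto intro!: continuous_intros)
      then show "(\<lambda>x. k t x) \<in> borel_measurable \<mu>0"
        unfolding k_def by (intro borel_measurable_prob_measures[OF \<mu>0] continuous_intros) simp
      show "AE x in \<mu>0. h t x = k t x"
        using supp by eventually_elim (use True in \<open>simp add: k_def closest_point_self\<close>)
    qed
    finally show ?thesis using True by simp
  qed (simp add: k_def)
  show "set_integrable lborel {0..<T} (\<lambda>t. \<integral>x. transport_integrand (V t) \<phi> t x \<partial>\<mu> t)"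
    unfolding set_integrable_def inner using P.integrable_fst[OF k_int] by simp
  have "(LINT t:{0..<T}|lborel. (\<integral>x. transport_integrand (V t) \<phi> t x \<partial>\<mu> t)) = (\<integral>t. (\<integral>x. k t x \<partial>\<mu>0) \<partial>lborel)"
    unfolding set_lebesgue_integral_def inner ..
  also have "\<dots> = (\<integral>x. (\<integral>t. k t x \<partial>lborel) \<partial>\<mu>0)"
    by (rule P.Fubini_integral[OF k_int, symmetric])
  also have "\<dots> = (\<integral>x. - \<phi> (x, 0) \<partial>\<mu>0)"
  proof (rule integral_cong_AE)
    have \<phi>c: "continuous_on UNIV \<phi>"
      using \<phi> Ck_imp_continuous[of 0 \<phi>] by (simp add: test_functions_def del: Ck.simps)
    show "(\<lambda>x. - \<phi> (x, 0)) \<in> borel_measurable \<mu>0"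
      by (intro borel_measurable_prob_measures[OF \<mu>0] continuous_intros continuous_slice[OF \<phi>c])
    show "(\<lambda>x. \<integral>t. k t x \<partial>lborel) \<in> borel_measurable \<mu>0"
      using P.integrable_snd[OF k_int] by (rule borel_measurable_integrable)
    show "AE x in \<mu>0. (\<integral>t. k t x \<partial>lborel) = - \<phi> (x, 0)"
      using supp
    proof eventually_elim
      case (elim x)
      let ?u = "\<lambda>t. \<phi> (flow V 0 t x, t)"
      have hT: "h T x = 0"
        using test_function_outside(2)[OF \<phi>, of "(flow V 0 T x, T)"] by (simp add: h_def \<Psi>_def)
      have "k t x = indicator {0..T} t *\<^sub>R h t x" for t
        using elim hT by (cases "t = T") (auto simp: k_def closest_point_self indicator_def)
      then have "(\<integral>t. k t x \<partial>lborel) = (\<integral>t. indicator {0..T} t *\<^sub>R h t x \<partial>lborel)" by simp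
      also have "\<dots> = ?u T - ?u 0"
      proof (rule integral_FTC_Icc)
        show "(?u has_vector_derivative h t x) (at t within {0..T})" if "0 \<le> t" "t \<le> T" for t
        proof -
          have "((\<lambda>t. flow V 0 t x) has_vector_derivative V t (flow V 0 t x)) (at t within {0..T})"
            using trajectory_subset[OF flow_trajectory[of 0 x], of "{0..T}"] that by (auto simp: trajectory_def)
          then have "((\<lambda>t. (flow V 0 t x, t)) has_derivative (\<lambda>r. (r *\<^sub>R V t (flow V 0 t x), r))) (at t within {0..T})"
            unfolding has_vector_derivative_def by (intro has_derivative_Pair has_derivative_ident)
          from has_derivative_compose[OF this test_function_has_derivative[OF \<phi>]]
          have "(?u has_derivative (\<lambda>r. frechet_derivative \<phi> (at (flow V 0 t x, t)) (r *\<^sub>R V t (flow V 0 t x), r))) (at t within {0..T})" .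
          moreover have "frechet_derivative \<phi> (at q) (r *\<^sub>R v, r) = r *\<^sub>R frechet_derivative \<phi> (at q) (v, 1)" for q r v
            using linear_scale[OF has_derivative_linear[OF test_function_has_derivative[OF \<phi>, of q]], of r "(v, 1)"] by simp
          ultimately show ?thesis by (simp add: has_vector_derivative_def h_def \<Psi>_def)
        qed
        have "continuous_on {0..T} (\<lambda>t. case (t, x) of (t, x) \<Rightarrow> h t x)"
          by (rule continuous_on_compose2[OF h_cont]) (auto intro!: continuous_intros)
        then show "continuous_on {0..T} (\<lambda>t. h t x)" by simp
      qed (use T in simp)
      also have "\<dots> = - \<phi> (x, 0)"
        using test_function_outside(1)[OF \<phi>, of "(flow V 0 T x, T)"] by (simp add: flow_start)
      finally show ?case .
    qed
  qed
  finally show "(LINT t:{0..<T}|lborel. (\<integral>x. transport_integrand (V t) \<phi> t x \<partial>\<mu> t)) + (\<integral>x. \<phi> (x, 0) \<partial>\<mu>0) = 0"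
    by simp
qed

end

end

section \<open>The delayed continuity equation\<close>

lemma (in confining_field) flow_cong:
  assumes U: "confining_field U R'" and eq: "\<And>s x. 0 \<le> s \<Longrightarrow> s \<le> t \<Longrightarrow> V s x = U s x" and t: "t \<ge> 0"
  shows "flow V 0 t x = flow U 0 t x"
proof -
  have "trajectory V {0..t} (\<lambda>s. flow U 0 s x)"
    using eq by (intro trajectory_cong[OF trajectory_subset[OF confining_field.flow_trajectory[OF U order_refl]]]) auto
  from trajectory_eq_flow[OF this order_refl, of t] show ?thesis
    using t by (simp add: confining_field.flow_start[OF U])
qed

theorem theorem3p5:
  fixes \<psi> \<tau> \<tau>' :: "real \<Rightarrow> real"
    and F :: "'a::euclidean_space measure \<Rightarrow> 'a \<Rightarrow> 'a"
    and g :: "real \<Rightarrow> 'a measure"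
    and \<tau>_low \<tau>_up c R T :: real
  assumes psi_pos: "\<And>r. r \<ge> 0 \<Longrightarrow> \<psi> r > 0"
    and psi_noninc: "antimono_on {0..} \<psi>"
    and psi_lip: "\<exists>L. L-lipschitz_on {0..} \<psi>"
    and psi_0: "\<psi> 0 = 1"
    and F: "F = velocity_A \<psi> \<or> F = velocity_B \<psi>"
    and tau_W1inf: "W1inf_loc {0<..} \<tau> \<tau>'"
    and tau_cont: "continuous_on {0..} \<tau>"
    and tau_low: "0 < \<tau>_low"
    and tau_bounds: "\<And>t. t \<ge> 0 \<Longrightarrow> \<tau>_low \<le> \<tau> t \<and> \<tau> t \<le> \<tau>_up"
    and c: "0 < c" "c < 1"
    and tau_deriv: "AE t in lborel. t > 0 \<longrightarrow> \<tau>' t \<le> c"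
    and g_cont: "continuous_map (top_of_set {-\<tau> 0..0}) narrow_topology g"
    and R: "R > 0"
    and g_supp: "\<And>t. t \<in> {-\<tau> 0..0} \<Longrightarrow> msupport (g t) \<subseteq> cball 0 R"
    and T: "T > 0"
  shows "\<exists>\<mu>. mv_solution \<psi> F \<tau> g T \<mu> \<and>
    (\<forall>\<nu>. mv_solution \<psi> F \<tau> g T \<nu> \<longrightarrow> (\<forall>t\<in>{0..<T}. \<nu> t = \<mu> t)) \<and>
    (\<exists>K. compact K \<and> (\<forall>t\<in>{0..<T}. msupport (\<mu> t) \<subseteq> K)) \<and>
    (\<exists>X. flow_map T (\<lambda>t. F (\<mu> (t - \<tau> t))) X \<and>
      (\<forall>Y. flow_map T (\<lambda>t. F (\<mu> (t - \<tau> t))) Y \<longrightarrow> (\<forall>t\<in>{0..<T}. Y t = X t)) \<and>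
      (\<forall>t\<in>{0..<T}. X t \<in> borel_measurable borel \<and> \<mu> t = distr (\<mu> 0) borel (X t)))"
proof -
  obtain L where "L-lipschitz_on {0..} \<psi>" using psi_lip by blast
  then interpret communication_weight \<psi> L
    using psi_pos psi_noninc psi_0 by unfold_locales auto
  define \<sigma> where "\<sigma> t = t - \<tau> t" for t
  have \<tau>0: "\<tau> 0 > 0" using tau_bounds[of 0] tau_low by auto
  have \<sigma>_cont: "continuous_on {0..} \<sigma>"
    unfolding \<sigma>_def by (intro continuous_intros tau_cont)
  have \<sigma>_ge: "\<sigma> t \<in> {- \<tau> 0..}" if "t \<ge> 0" for t
  proof -
    have "\<tau> t - \<tau> 0 \<le> c * (t - 0)"
      by (rule weak_derivative_le_imp_increment_le[of \<tau> \<tau>'])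
         (use tau_W1inf tau_cont tau_deriv c that in \<open>auto simp: W1inf_loc_def\<close>)
    also have "\<dots> \<le> 1 * t" using c that mult_right_mono[of c 1 t] by simp
    finally show ?thesis by (simp add: \<sigma>_def)
  qed
  have \<sigma>_le: "\<sigma> t \<le> t - \<tau>_low" if "t \<ge> 0" for t
    using tau_bounds[OF that] by (simp add: \<sigma>_def)
  have g_prob: "g t \<in> prob_measures" if "t \<in> {- \<tau> 0..0}" for t
    using g_cont that by (auto simp: continuous_map_narrow_iff)
  have g_AE: "AE x in g t. x \<in> cball 0 R" if "t \<in> {- \<tau> 0..0}" for t
    using AE_in_msupport[OF prob_measuresD(2)[OF g_prob[OF that]]] by eventually_elim (use g_supp[OF that] in auto)
  have g0: "g 0 \<in> prob_measures" "AE x in g 0. x \<in> cball 0 R"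
    using g_prob[of 0] g_AE[of 0] \<tau>0 by auto
  define V where "V M = (\<lambda>t. F (M (\<sigma> t)))" for M
  define curve where "curve M \<longleftrightarrow> continuous_map (top_of_set {- \<tau> 0..}) narrow_topology M \<and>
      (\<forall>s\<ge>- \<tau> 0. AE x in M s. x \<in> cball 0 R)" for M :: "real \<Rightarrow> 'a measure"
  have V: "confining_field (V M) R" if "curve M" for M
    unfolding V_def
    by (rule delayed_velocity_confining[OF F R \<sigma>_cont \<sigma>_ge]) (use that in \<open>auto simp: curve_def\<close>)
  \<comment> \<open>one step of the method of steps: the history, continued by the flow of the velocity field of \<open>M\<close>\<close>
  define step where "step M t = (if t \<le> 0 then g t else distr (g 0) borel (flow (V M) 0 t))" for M t
  have step_eq: "step M t = distr (g 0) borel (flow (V M) 0 t)" if "curve M" "t \<ge> 0" for M t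
  proof (cases "t = 0")
    case True
    have "flow (V M) 0 0 = (\<lambda>x. x)"
      using confining_field.flow_start[OF V[OF that(1)]] by auto
    then show ?thesis using True prob_measuresD[OF g0(1)] by (simp add: step_def distr_id2)
  qed (use that in \<open>simp add: step_def\<close>)
  have curve_step: "curve (step M)" if M: "curve M" for M
  proof -
    interpret confining_field "V M" R using M by (rule V)
    have AE: "AE x in step M s. x \<in> cball 0 R" if "s \<ge> - \<tau> 0" for s
    proof (cases "s \<ge> 0")
      case True
      then show ?thesis unfolding step_eq[OF M True] by (rule pushforward_supported[OF g0])
    next
      case False
      then have "step M s = g s" by (simp add: step_def)
      with that False show ?thesis using g_AE[of s] by (simp only: atLeastAtMost_iff) simp
    qed
    have prob: "step M s \<in> prob_measures" if "s \<ge> - \<tau> 0" for s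
    proof (cases "s \<ge> 0")
      case True
      then show ?thesis unfolding step_eq[OF M True] by (rule pushforward_prob[OF g0])
    qed (use that g_prob[of s] in \<open>simp add: step_def\<close>)
    have "continuous_on {- \<tau> 0..} (\<lambda>s. \<integral>x. f x \<partial>step M s)" if f: "f \<in> bounded_continuous" for f
    proof -
      have "continuous_on {- \<tau> 0..0} (\<lambda>s. \<integral>x. f x \<partial>g s)"
        using g_cont f by (simp add: continuous_map_narrow_iff)
      then have 1: "continuous_on {- \<tau> 0..0} (\<lambda>s. \<integral>x. f x \<partial>step M s)"
        by (rule continuous_on_eq) (simp add: step_def)
      have "continuous_on {0..} (\<lambda>s. \<integral>x. f x \<partial>distr (g 0) borel (flow (V M) 0 s))"
        using pushforward_continuous[OF g0] f by (simp add: continuous_map_narrow_iff)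
      then have 2: "continuous_on {0..} (\<lambda>s. \<integral>x. f x \<partial>step M s)"
        by (rule continuous_on_eq) (simp add: step_eq[OF M])
      have "{- \<tau> 0..} = {- \<tau> 0..0} \<union> {0..}" using \<tau>0 by auto
      then show ?thesis using continuous_on_closed_Un[OF _ _ 1 2] by simp
    qed
    then show ?thesis using AE prob by (auto simp: curve_def continuous_map_narrow_iff)
  qed
  \<comment> \<open>start from the history, frozen after time \<open>0\<close>\<close>
  define Ms where "Ms k = (step ^^ k) (\<lambda>t. g (min t 0))" for k
  have Ms_Suc: "Ms (Suc k) = step (Ms k)" for k by (simp add: Ms_def)
  have curve_0: "curve (Ms 0)"
  proof -
    have "continuous_on {- \<tau> 0..} (\<lambda>s. \<integral>x. f x \<partial>g (min s 0))" if f: "f \<in> bounded_continuous" for f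
    proof (rule continuous_on_compose2[of "{- \<tau> 0..0}" "\<lambda>s. \<integral>x. f x \<partial>g s"])
      show "continuous_on {- \<tau> 0..0} (\<lambda>s. \<integral>x. f x \<partial>g s)"
        using g_cont f by (simp add: continuous_map_narrow_iff)
    qed (use \<tau>0 in \<open>auto intro!: continuous_intros\<close>)
    moreover have "min s 0 \<in> {- \<tau> 0..0}" if "s \<ge> - \<tau> 0" for s using that \<tau>0 by auto
    ultimately show ?thesis using g_prob g_AE by (auto simp: curve_def continuous_map_narrow_iff Ms_def)
  qed
  have curve: "curve (Ms k)" for k
    by (induction k) (use curve_0 curve_step Ms_Suc in auto)
  have flow_agree: "flow (V M) 0 t = flow (V M') 0 t"
    if "curve M" "curve M'" "t \<ge> 0" "\<And>s. s \<le> t - \<tau>_low \<Longrightarrow> M s = M' s" for M M' t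
  proof
    fix x
    show "flow (V M) 0 t x = flow (V M') 0 t x"
    proof (rule confining_field.flow_cong[OF V[OF that(1)] V[OF that(2)] _ that(3)])
      fix s x assume s: "0 \<le> s" "s \<le> t"
      then have "M (\<sigma> s) = M' (\<sigma> s)" using \<sigma>_le[OF s(1)] by (intro that(4)) simp
      then show "V M s x = V M' s x" by (simp add: V_def)
    qed
  qed
  \<comment> \<open>the velocity at time \<open>t\<close> depends on the curve up to \<open>t - \<tau>_low\<close> only, so each step settles a further interval of length \<open>\<tau>_low\<close>\<close>
  have agree: "Ms (Suc k) t = Ms k t" if "t \<le> real k * \<tau>_low" for k t
    using that
  proof (induction k arbitrary: t)
    case 0
    then show ?case by (simp add: Ms_def step_def)
  next
    case (Suc k)
    show ?case
    proof (cases "t \<le> 0")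
      case False
      have "flow (V (Ms (Suc k))) 0 t = flow (V (Ms k)) 0 t"
        by (rule flow_agree[OF curve curve]) (use False Suc in \<open>auto simp: algebra_simps\<close>)
      then show ?thesis using False by (simp add: Ms_Suc[of "Suc k"] Ms_Suc[of k] step_def)
    qed (simp add: Ms_Suc[of "Suc k"] Ms_Suc[of k] step_def)
  qed
  obtain N :: nat where N: "T \<le> real N * \<tau>_low"
    using real_arch_simple[of "T / \<tau>_low"] tau_low by (auto simp: field_simps)
  define \<mu> where "\<mu> = Ms N"
  have \<mu>_curve: "curve \<mu>" by (simp add: \<mu>_def curve)
  have \<mu>_step: "\<mu> t = step \<mu> t" if "t \<le> T" for t
    using agree[of t N] that N by (simp add: \<mu>_def Ms_Suc)
  have \<mu>_g: "\<mu> t = g t" if "t \<le> 0" for t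
    using \<mu>_step[of t] that T by (simp add: step_def)
  interpret confining_field "V \<mu>" R using \<mu>_curve by (rule V)
  have \<mu>_flow: "\<mu> t = distr (g 0) borel (flow (V \<mu>) 0 t)" if "0 \<le> t" "t \<le> T" for t
    using \<mu>_step[OF that(2)] step_eq[OF \<mu>_curve that(1)] by simp
  have V_eq: "F (\<mu> (t - \<tau> t)) = V \<mu> t" for t by (simp add: V_def \<sigma>_def)
  have \<mu>_prob: "\<mu> s \<in> prob_measures" and \<mu>_AE: "AE x in \<mu> s. x \<in> cball 0 R" if "s \<ge> - \<tau> 0" for s
    using \<mu>_curve that by (auto simp: curve_def continuous_map_narrow_iff)
  have \<mu>_cont: "continuous_map (top_of_set {0..<T}) narrow_topology \<mu>"
  proof (rule continuous_map_from_subtopology_mono)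
    show "continuous_map (top_of_set {- \<tau> 0..}) narrow_topology \<mu>"
      using \<mu>_curve unfolding curve_def by blast
  qed (use \<tau>0 in auto)
  have sol: "mv_solution \<psi> F \<tau> g T \<mu>"
    unfolding mv_solution_def
  proof (intro conjI ballI \<mu>_cont)
    show "\<mu> s = g s" if "s \<in> {- \<tau> 0..0}" for s using \<mu>_g that by simp
    show "AE t in lborel. t \<in> {0..<T} \<longrightarrow> (AE x in \<mu> t. integrable (\<mu> (t - \<tau> t)) (force \<psi> x))"
    proof (intro AE_I2 impI)
      fix t x assume "t \<in> {0..<T}"
      then have "\<sigma> t \<ge> - \<tau> 0" using \<sigma>_ge[of t] by simp
      then show "integrable (\<mu> (t - \<tau> t)) (force \<psi> x)"
        using force_integrable[OF \<mu>_prob \<mu>_AE] unfolding \<sigma>_def by blast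
    qed
    fix \<phi> :: "'a \<times> real \<Rightarrow> real" assume \<phi>: "\<phi> \<in> test_functions (UNIV \<times> {..<T})"
    note weak = pushforward_weak_solution[OF g0 T \<phi>]
    show "AE t in lborel. t \<in> {0..<T} \<longrightarrow> integrable (\<mu> t) (transport_integrand (F (\<mu> (t - \<tau> t))) \<phi> t)"
      using weak(1) by (intro AE_I2) (simp add: V_eq \<mu>_flow)
    show "set_integrable lborel {0..<T} (\<lambda>t. \<integral>x. transport_integrand (F (\<mu> (t - \<tau> t))) \<phi> t x \<partial>\<mu> t)"
      by (rule set_integrable_cong[THEN iffD1, OF refl refl _ weak(2)]) (simp add: V_eq \<mu>_flow)
    have "(LINT t:{0..<T}|lborel. (\<integral>x. transport_integrand (F (\<mu> (t - \<tau> t))) \<phi> t x \<partial>\<mu> t)) =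
        (LINT t:{0..<T}|lborel. (\<integral>x. transport_integrand (V \<mu> t) \<phi> t x \<partial>distr (g 0) borel (flow (V \<mu>) 0 t)))"
      by (rule set_lebesgue_integral_cong) (auto simp: V_eq \<mu>_flow)
    then show "(LINT t:{0..<T}|lborel. (\<integral>x. transport_integrand (F (\<mu> (t - \<tau> t))) \<phi> t x \<partial>\<mu> t))
        + (\<integral>x. \<phi> (x, 0) \<partial>g 0) = 0"
      using weak(3) by simp
  qed
  have uniq: "\<nu> t = \<mu> t" if \<nu>: "mv_solution \<psi> F \<tau> g T \<nu>" and t: "t \<in> {0..<T}" for \<nu> t
  proof -
    have \<nu>_cont: "continuous_map (top_of_set {0..<T}) narrow_topology \<nu>"
      and \<nu>_g: "\<And>s. s \<in> {- \<tau> 0..0} \<Longrightarrow> \<nu> s = g s"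
      using \<nu> by (auto simp: mv_solution_def)
    have \<nu>_0: "\<nu> 0 = g 0" using \<nu>_g \<tau>0 by simp
    have "\<forall>t\<in>{0..<T}. t < real k * \<tau>_low \<longrightarrow> \<nu> t = \<mu> t" for k
    proof (induction k)
      case (Suc k)
      \<comment> \<open>by the induction hypothesis the field of \<open>\<nu>\<close> is that of \<open>\<mu>\<close> up to time \<open>S\<close>, so the linear uniqueness theorem applies from time \<open>0\<close>\<close>
      define S where "S = min (real (Suc k) * \<tau>_low) T"
      have integrand: "transport_integrand (F (\<nu> (t - \<tau> t))) \<phi> t = transport_integrand (V \<mu> t) \<phi> t"
        if \<phi>: "\<phi> \<in> test_functions (UNIV \<times> {..<S})" and t: "t \<in> {0..<T}" for \<phi> t
      proof (cases "t < S")
        case True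
        have "\<sigma> t < real k * \<tau>_low" "\<sigma> t < T" "\<sigma> t \<ge> - \<tau> 0"
          using \<sigma>_le[of t] \<sigma>_ge[of t] t True tau_low by (auto simp: S_def algebra_simps)
        then have "\<nu> (\<sigma> t) = \<mu> (\<sigma> t)"
          using Suc.IH \<nu>_g[of "\<sigma> t"] \<mu>_g[of "\<sigma> t"] by (cases "\<sigma> t \<le> 0") auto
        then show ?thesis by (simp add: V_def \<sigma>_def)
      next
        case False
        then have "frechet_derivative \<phi> (at (x, t)) = (\<lambda>_. 0)" for x
          by (intro test_function_outside(2)[OF \<phi>]) simp
        then show ?thesis by (simp add: fun_eq_iff test_function_transport_integrand[OF \<phi>])
      qed
      have weak: "weak_transport_solution T S (V \<mu>) \<nu>"
        unfolding weak_transport_solution_def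
      proof
        fix \<phi> :: "'a \<times> real \<Rightarrow> real" assume \<phi>: "\<phi> \<in> test_functions (UNIV \<times> {..<S})"
        have "UNIV \<times> {..<S} \<subseteq> UNIV \<times> {..<T}" by (auto simp: S_def)
        then have \<phi>T: "\<phi> \<in> test_functions (UNIV \<times> {..<T})" using \<phi> test_functions_mono by blast
        have 1: "AE t in lborel. t \<in> {0..<T} \<longrightarrow> integrable (\<nu> t) (transport_integrand (F (\<nu> (t - \<tau> t))) \<phi> t)"
          and 2: "set_integrable lborel {0..<T} (\<lambda>t. \<integral>x. transport_integrand (F (\<nu> (t - \<tau> t))) \<phi> t x \<partial>\<nu> t)"
          and 3: "(LINT t:{0..<T}|lborel. (\<integral>x. transport_integrand (F (\<nu> (t - \<tau> t))) \<phi> t x \<partial>\<nu> t)) + (\<integral>x. \<phi> (x, 0) \<partial>g 0) = 0"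
          using \<nu> \<phi>T unfolding mv_solution_def by blast+
        have "AE t in lborel. t \<in> {0..<T} \<longrightarrow> integrable (\<nu> t) (transport_integrand (V \<mu> t) \<phi> t)"
          using 1 by eventually_elim (simp add: integrand[OF \<phi>])
        moreover have "set_integrable lborel {0..<T} (\<lambda>t. \<integral>x. transport_integrand (V \<mu> t) \<phi> t x \<partial>\<nu> t)"
          by (rule set_integrable_cong[THEN iffD1, OF refl refl _ 2]) (simp add: integrand[OF \<phi>])
        moreover have "(LINT t:{0..<T}|lborel. (\<integral>x. transport_integrand (F (\<nu> (t - \<tau> t))) \<phi> t x \<partial>\<nu> t)) =
            (LINT t:{0..<T}|lborel. (\<integral>x. transport_integrand (V \<mu> t) \<phi> t x \<partial>\<nu> t))"
          by (rule set_lebesgue_integral_cong) (auto simp: integrand[OF \<phi>])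
        ultimately show "(AE t in lborel. t \<in> {0..<T} \<longrightarrow> integrable (\<nu> t) (transport_integrand (V \<mu> t) \<phi> t)) \<and>
          set_integrable lborel {0..<T} (\<lambda>t. \<integral>x. transport_integrand (V \<mu> t) \<phi> t x \<partial>\<nu> t) \<and>
          (LINT t:{0..<T}|lborel. (\<integral>x. transport_integrand (V \<mu> t) \<phi> t x \<partial>\<nu> t)) + (\<integral>x. \<phi> (x, 0) \<partial>\<nu> 0) = 0"
          using 3 \<nu>_0 by simp
      qed
      show ?case
      proof (intro ballI impI)
        fix b assume b: "b \<in> {0..<T}" "b < real (Suc k) * \<tau>_low"
        have "\<nu> b = distr (\<nu> 0) borel (flow (V \<mu>) 0 b)"
          by (rule weak_solution_is_transported[where S = S, OF T _ \<nu>_cont weak]) (use b in \<open>simp_all add: S_def\<close>)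
        then show "\<nu> b = \<mu> b" using \<mu>_flow[of b] b \<nu>_0 by simp
      qed
    qed simp
    from this[of N] show ?thesis using t N by auto
  qed
  have flow: "flow_map T (\<lambda>t. F (\<mu> (t - \<tau> t))) (flow (V \<mu>) 0)"
  proof -
    have "trajectory (V \<mu>) {0..<T} (\<lambda>s. flow (V \<mu>) 0 s x)" for x
      by (rule trajectory_subset[OF flow_trajectory]) auto
    then show ?thesis by (simp add: flow_map_def V_eq flow_start trajectory_def)
  qed
  have flow_uniq: "Y t = flow (V \<mu>) 0 t" if Y: "flow_map T (\<lambda>t. F (\<mu> (t - \<tau> t))) Y" and t: "t \<in> {0..<T}" for Y t
  proof
    fix x
    have traj: "trajectory (V \<mu>) {0..<T} (\<lambda>s. Y s x)" and Y0: "Y 0 x = x"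
      using Y by (auto simp: flow_map_def V_eq trajectory_def)
    have "{0..t} \<subseteq> {0..<T}" using t by auto
    from trajectory_eq_flow[OF trajectory_subset[OF traj this] order_refl, of t]
    show "Y t x = flow (V \<mu>) 0 t x" using t Y0 by simp
  qed
  show ?thesis
  proof (intro exI[of _ \<mu>] conjI)
    show "\<exists>K. compact K \<and> (\<forall>t\<in>{0..<T}. msupport (\<mu> t) \<subseteq> K)"
      using msupport_subset_closed[OF prob_measuresD(2)[OF \<mu>_prob] _ \<mu>_AE] \<tau>0
      by (intro exI[of _ "cball 0 R"]) auto
    show "\<exists>X. flow_map T (\<lambda>t. F (\<mu> (t - \<tau> t))) X \<and>
      (\<forall>Y. flow_map T (\<lambda>t. F (\<mu> (t - \<tau> t))) Y \<longrightarrow> (\<forall>t\<in>{0..<T}. Y t = X t)) \<and>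
      (\<forall>t\<in>{0..<T}. X t \<in> borel_measurable borel \<and> \<mu> t = distr (\<mu> 0) borel (X t))"
    proof (intro exI[of _ "flow (V \<mu>) 0"] conjI allI impI ballI flow)
      show "Y t = flow (V \<mu>) 0 t" if "flow_map T (\<lambda>t. F (\<mu> (t - \<tau> t))) Y" "t \<in> {0..<T}" for Y t
        using that by (rule flow_uniq)
      show "flow (V \<mu>) 0 t \<in> borel_measurable borel" if "t \<in> {0..<T}" for t
        using that by (intro flow_measurable) simp
      show "\<mu> t = distr (\<mu> 0) borel (flow (V \<mu>) 0 t)" if "t \<in> {0..<T}" for t
        using \<mu>_flow[of t] \<mu>_g[of 0] that by simp
    qed
    show "\<forall>\<nu>. mv_solution \<psi> F \<tau> g T \<nu> \<longrightarrow> (\<forall>t\<in>{0..<T}. \<nu> t = \<mu> t)"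
      using uniq by blast
  qed (rule sol)
qed

end
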